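(* Let $G$ be Hall's universal locally finite group, let $\mathbb{U}$ be the Urysohn universal metric space, and let $\alpha:G\curvearrowright\mathbb{U}$ be the universal action by isometries defined in the context. Then $\alpha$ is weakly generic; namely, the set of all $\beta\in\mathrm{Hom}(G,\mathrm{Iso}(\mathbb{U}))$ that are weakly equivalent to $\alpha$ is a dense $G_\delta$ subset of the Polish space $\mathrm{Hom}(G,\mathrm{Iso}(\mathbb{U}))$.
   Context: Hall's universal locally finite group is the Fraïssé limit of the class of all finite groups. The Urysohn universal metric space $\mathbb{U}$ is the completion of the Fraïssé limit of the class of all finite metric spaces with rational distances (the rational Urysohn space). Space of actions. $\mathrm{Iso}(\mathbb{U})$ is the Polish group of all isometries of $\mathbb{U}$ onto itself with the topology of pointwise convergence. Actions of $G$ on $\mathbb{U}$ by isometries are identified with elements of $\mathrm{Hom}(G,\mathrm{Iso}(\mathbb{U}))$, the set of all homomorphisms $G\to\mathrm{Iso}(\mathbb{U})$, which is a closed subspace of $\mathrm{Iso}(\mathbb{U})^G$ with the product topology, hence Polish. Weak equivalence. Homomorphisms $f,g:G\to\mathrm{Iso}(\mathbb{U})$ are weakly equivalent if there are an isometry $\phi$ of $\mathbb{U}$ onto itself and an automorphism $\psi:G\to G$ such that $f(v)x=\phi^{-1}g(\psi(v))\phi x$ for all $x\in\mathbb{U}$ and $v\in G$. An element of $\mathrm{Hom}(G,\mathrm{Iso}(\mathbb{U}))$ is weakly generic if its weak equivalence class is comeager. The action $\alpha$. A pointed free action of a group $F$ on a metric space $Y$ is a tuple $(F\curvearrowright Y,(y_i)_{i\in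 I})$, where $F\curvearrowright Y$ is a free action by isometries and $(y_i)_{i\in I}$ contains exactly one point of each orbit. An embedding of $(F\curvearrowright Y,(y_i)_{i\in I})$ into $(H\curvearrowright Z,(z_j)_{j\in J})$ is a pair $(\phi,\psi)$, where $\phi:F\to H$ is an injective group homomorphism and $\psi:Y\to Z$ is an isometric embedding which maps $\{y_i:i\in I\}$ into $\{z_j:j\in J\}$ and satisfies $\psi(f\cdot y)=\phi(f)\cdot\psi(y)$ for all $f\in F$, $y\in Y$. The class of all pointed free actions of finite groups on (nonempty) finite metric spaces with rational distances is, with these embeddings, a Fraïssé class. Let $(\alpha_0:G\curvearrowright X,(x_i)_{i\in I})$ be its Fraïssé limit, that is, the unique direct limit of a sequence of members of the class such that every member of the class embeds into it and, whenever $A,B$ are members of the class, $\rho$ is an embedding of $A$ into the limit and $\iota$ is an embedding of $A$ into $B$, there is an embedding $\rho'$ of $B$ into the limit with $\rho=\rho'\circ\iota$. The acting group $G$ is (isomorphic to) Hall's universal locally finite group, and the completion of $X$ is (isometric to) $\mathbb{U}$; $\alpha:G\curvearrowright\mathbb{U}$ denotes the unique extension of $\alpha_0$ to an action by isometries on the completion, viewed as an element of $\mathrm{Hom}(G,\mathrm{Iso}(\mathbb{U}))$ via these identifications (its weak equivalence class does not depend on their choice). *)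

theory Defs
  imports "HOL-Analysis.Analysis" "HOL-Algebra.Group_Action"
begin

text \<open>
  A Fraisse limit is a direct limit of a sequence of members of the class which embeds all members
  and has the extension property. A structure is a direct limit of a sequence of embeddings when the
  members of the sequence embed into it compatibly and their images exhaust it. Members of the three
  classes below are finite, so up to isomorphism their underlying sets are subsets of \<^typ>\<open>nat\<close>;
  quantifying over the classes therefore means quantifying over members carried by \<^typ>\<open>nat\<close>.
  Functions between structures only matter on the underlying sets.
\<close>

section \<open>Hall's universal locally finite group\<close>

definition finite_group :: "'g monoid \<Rightarrow> bool" where
  "finite_group A \<longleftrightarrow> group A \<and> finite (carrier A)"

definition hall_group :: "'g monoid \<Rightarrow> bool" where
  "hall_group G \<longleftrightarrow>
     group G
   \<and> (\<exists>(A :: nat \<Rightarrow> nat monoid) \<iota> \<rho>.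
        (\<forall>n. finite_group (A n)
           \<and> \<iota> n \<in> mon (A n) (A (Suc n))
           \<and> \<rho> n \<in> mon (A n) G
           \<and> (\<forall>a\<in>carrier (A n). \<rho> (Suc n) (\<iota> n a) = \<rho> n a))
      \<and> carrier G = (\<Union>n. \<rho> n ` carrier (A n)))
   \<and> (\<forall>A :: nat monoid. finite_group A \<longrightarrow> (\<exists>\<rho>. \<rho> \<in> mon A G))
   \<and> (\<forall>(A :: nat monoid) (B :: nat monoid) \<rho> \<iota>.
        finite_group A \<and> finite_group B \<and> \<rho> \<in> mon A G \<and> \<iota> \<in> mon A B
        \<longrightarrow> (\<exists>\<rho>'. \<rho>' \<in> mon B G \<and> (\<forall>a\<in>carrier A. \<rho> a = \<rho>' (\<iota> a))))"


section \<open>The Urysohn universal metric space\<close>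

definition finite_rational_metric :: "'x set \<Rightarrow> ('x \<Rightarrow> 'x \<Rightarrow> real) \<Rightarrow> bool" where
  "finite_rational_metric M d \<longleftrightarrow>
     Metric_space M d \<and> finite M \<and> (\<forall>x\<in>M. \<forall>y\<in>M. d x y \<in> \<rat>)"

definition isometric_embedding ::
    "'x set \<Rightarrow> ('x \<Rightarrow> 'x \<Rightarrow> real) \<Rightarrow> 'y set \<Rightarrow> ('y \<Rightarrow> 'y \<Rightarrow> real) \<Rightarrow> ('x \<Rightarrow> 'y) \<Rightarrow> bool" where
  "isometric_embedding M d N e f \<longleftrightarrow>
     f ` M \<subseteq> N \<and> (\<forall>x\<in>M. \<forall>y\<in>M. e (f x) (f y) = d x y)"

definition rational_urysohn :: "'x set \<Rightarrow> ('x \<Rightarrow> 'x \<Rightarrow> real) \<Rightarrow> bool" where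
  "rational_urysohn Q d \<longleftrightarrow>
     Metric_space Q d
   \<and> (\<exists>(M :: nat \<Rightarrow> nat set) e \<iota> \<rho>.
        (\<forall>n. finite_rational_metric (M n) (e n)
           \<and> isometric_embedding (M n) (e n) (M (Suc n)) (e (Suc n)) (\<iota> n)
           \<and> isometric_embedding (M n) (e n) Q d (\<rho> n)
           \<and> (\<forall>x\<in>M n. \<rho> (Suc n) (\<iota> n x) = \<rho> n x))
      \<and> Q = (\<Union>n. \<rho> n ` M n))
   \<and> (\<forall>(M :: nat set) e.
        finite_rational_metric M e \<longrightarrow> (\<exists>\<rho>. isometric_embedding M e Q d \<rho>))
   \<and> (\<forall>(M :: nat set) e (N :: nat set) e' \<rho> \<iota>.
        finite_rational_metric M e \<and> finite_rational_metric N e'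
        \<and> isometric_embedding M e Q d \<rho> \<and> isometric_embedding M e N e' \<iota>
        \<longrightarrow> (\<exists>\<rho>'. isometric_embedding N e' Q d \<rho>' \<and> (\<forall>x\<in>M. \<rho> x = \<rho>' (\<iota> x))))"

text \<open>
  The completion of a metric space is a complete metric space in which it sits as a dense subspace;
  completeness is part of the sort of \<open>'u\<close>.
\<close>

definition urysohn_space :: "'u::complete_space itself \<Rightarrow> bool" where
  "urysohn_space TYPE('u) \<longleftrightarrow> (\<exists>Q :: 'u set. rational_urysohn Q dist \<and> closure Q = UNIV)"


section \<open>Pointed free actions and their Fraisse limit\<close>

record ('g, 'y) pointed_action =
  grp :: "'g monoid"
  pts :: "'y set"
  met :: "'y \<Rightarrow> 'y \<Rightarrow> real"
  act :: "'g \<Rightarrow> 'y \<Rightarrow> 'y"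
  base :: "'y set"

text \<open>
  The field \<^const>\<open>base\<close> is the set of distinguished points. The library's \<^const>\<open>group_action\<close>
  includes that \<^const>\<open>grp\<close> is a group.
\<close>

definition pointed_free_action :: "('g, 'y) pointed_action \<Rightarrow> bool" where
  "pointed_free_action A \<longleftrightarrow>
     Metric_space (pts A) (met A)
   \<and> group_action (grp A) (pts A) (act A)
   \<and> (\<forall>g\<in>carrier (grp A). \<forall>x\<in>pts A. \<forall>y\<in>pts A. met A (act A g x) (act A g y) = met A x y)
   \<and> (\<forall>g\<in>carrier (grp A). \<forall>x\<in>pts A. act A g x = x \<longrightarrow> g = \<one>\<^bsub>grp A\<^esub>)
   \<and> base A \<subseteq> pts A
   \<and> (\<forall>x\<in>pts A. \<exists>!p. p \<in> base A \<and> p \<in> orbit (grp A) (act A) x)"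

definition finite_rational_action :: "('g, 'y) pointed_action \<Rightarrow> bool" where
  "finite_rational_action A \<longleftrightarrow>
     pointed_free_action A
   \<and> finite (carrier (grp A))
   \<and> finite_rational_metric (pts A) (met A)
   \<and> pts A \<noteq> {}"

definition action_embedding ::
    "('f, 'y) pointed_action \<Rightarrow> ('h, 'z) pointed_action \<Rightarrow> ('f \<Rightarrow> 'h) \<Rightarrow> ('y \<Rightarrow> 'z) \<Rightarrow> bool" where
  "action_embedding A B \<phi> \<psi> \<longleftrightarrow>
     \<phi> \<in> mon (grp A) (grp B)
   \<and> isometric_embedding (pts A) (met A) (pts B) (met B) \<psi>
   \<and> \<psi> ` base A \<subseteq> base B
   \<and> (\<forall>f\<in>carrier (grp A). \<forall>y\<in>pts A. \<psi> (act A f y) = act B (\<phi> f) (\<psi> y))"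

definition action_fraisse_limit :: "('g, 'x) pointed_action \<Rightarrow> bool" where
  "action_fraisse_limit L \<longleftrightarrow>
     pointed_free_action L
   \<and> (\<exists>(A :: nat \<Rightarrow> (nat, nat) pointed_action) \<phi> \<psi> \<phi>L \<psi>L.
        (\<forall>n. finite_rational_action (A n)
           \<and> action_embedding (A n) (A (Suc n)) (\<phi> n) (\<psi> n)
           \<and> action_embedding (A n) L (\<phi>L n) (\<psi>L n)
           \<and> (\<forall>f\<in>carrier (grp (A n)). \<phi>L (Suc n) (\<phi> n f) = \<phi>L n f)
           \<and> (\<forall>y\<in>pts (A n). \<psi>L (Suc n) (\<psi> n y) = \<psi>L n y))
      \<and> carrier (grp L) = (\<Union>n. \<phi>L n ` carrier (grp (A n)))
      \<and> pts L = (\<Union>n. \<psi>L n ` pts (A n))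
      \<and> base L = (\<Union>n. \<psi>L n ` base (A n)))
   \<and> (\<forall>A :: (nat, nat) pointed_action.
        finite_rational_action A \<longrightarrow> (\<exists>\<phi> \<psi>. action_embedding A L \<phi> \<psi>))
   \<and> (\<forall>(A :: (nat, nat) pointed_action) (B :: (nat, nat) pointed_action) \<phi>L \<psi>L \<phi> \<psi>.
        finite_rational_action A \<and> finite_rational_action B
        \<and> action_embedding A L \<phi>L \<psi>L \<and> action_embedding A B \<phi> \<psi>
        \<longrightarrow> (\<exists>\<phi>' \<psi>'. action_embedding B L \<phi>' \<psi>'
              \<and> (\<forall>f\<in>carrier (grp A). \<phi>L f = \<phi>' (\<phi> f))
              \<and> (\<forall>y\<in>pts A. \<psi>L y = \<psi>' (\<psi> y))))"


section \<open>The space of actions\<close>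

definition isometries :: "('u::metric_space \<Rightarrow> 'u) set" where
  "isometries = {f. surj f \<and> (\<forall>x y. dist (f x) (f y) = dist x y)}"

definition Iso_group :: "('u::metric_space \<Rightarrow> 'u) monoid" where
  "Iso_group = \<lparr>carrier = isometries, mult = (\<circ>), one = id\<rparr>"

text \<open>The topology of pointwise convergence is the one induced by the product topology on \<open>'u \<Rightarrow> 'u\<close>.\<close>

definition Iso_topology :: "('u::metric_space \<Rightarrow> 'u) topology" where
  "Iso_topology = subtopology (product_topology (\<lambda>_. euclidean) UNIV) isometries"

text \<open>
  Homomorphisms are taken extensional, as \<^const>\<open>product_topology\<close> over \<^term>\<open>carrier G\<close> requires.
\<close>

definition Hom_Iso :: "'g monoid \<Rightarrow> ('g \<Rightarrow> 'u::metric_space \<Rightarrow> 'u) set" where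
  "Hom_Iso G = hom G Iso_group \<inter> extensional (carrier G)"

definition Hom_topology :: "'g monoid \<Rightarrow> ('g \<Rightarrow> 'u::metric_space \<Rightarrow> 'u) topology" where
  "Hom_topology G = subtopology (product_topology (\<lambda>_. Iso_topology) (carrier G)) (Hom_Iso G)"

definition weakly_equivalent ::
    "'g monoid \<Rightarrow> ('g \<Rightarrow> 'u::metric_space \<Rightarrow> 'u) \<Rightarrow> ('g \<Rightarrow> 'u \<Rightarrow> 'u) \<Rightarrow> bool" where
  "weakly_equivalent G f g \<longleftrightarrow>
     (\<exists>\<phi>\<in>isometries. \<exists>\<psi>\<in>iso G G.
        \<forall>v\<in>carrier G. \<forall>x. f v x = inv_into UNIV \<phi> (g (\<psi> v) (\<phi> x)))"

definition weak_class ::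
    "'g monoid \<Rightarrow> ('g \<Rightarrow> 'u::metric_space \<Rightarrow> 'u) \<Rightarrow> ('g \<Rightarrow> 'u \<Rightarrow> 'u) set" where
  "weak_class G \<alpha> = {\<beta> \<in> Hom_Iso G. weakly_equivalent G \<beta> \<alpha>}"

definition comeager_in :: "'a topology \<Rightarrow> 'a set \<Rightarrow> bool" where
  "comeager_in X S \<longleftrightarrow>
     S \<subseteq> topspace X
   \<and> (\<exists>\<D>. countable \<D> \<and> (\<forall>D\<in>\<D>. openin X D \<and> X closure_of D = topspace X)
          \<and> topspace X \<inter> \<Inter>\<D> \<subseteq> S)"

definition weakly_generic :: "'g monoid \<Rightarrow> ('g \<Rightarrow> 'u::metric_space \<Rightarrow> 'u) \<Rightarrow> bool" where
  "weakly_generic G \<alpha> \<longleftrightarrow> \<alpha> \<in> Hom_Iso G \<and> comeager_in (Hom_topology G) (weak_class G \<alpha>)"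

text \<open>
  \<open>universal_action L G \<alpha>\<close>: the Fraisse limit \<open>L\<close>, with its acting group identified with \<open>G\<close> via
  \<open>h\<close> and the completion of its space identified with \<open>'u\<close> via \<open>j\<close>, extends to \<open>\<alpha>\<close>. By density
  of the image of \<open>j\<close> the extension is determined by \<open>L\<close>, \<open>h\<close> and \<open>j\<close>.
\<close>

definition universal_action ::
    "('h, 'x) pointed_action \<Rightarrow> 'g monoid \<Rightarrow> ('g \<Rightarrow> 'u::complete_space \<Rightarrow> 'u) \<Rightarrow> bool" where
  "universal_action L G \<alpha> \<longleftrightarrow>
     action_fraisse_limit L
   \<and> \<alpha> \<in> Hom_Iso G
   \<and> (\<exists>h j. h \<in> iso (grp L) G
        \<and> isometric_embedding (pts L) (met L) UNIV dist j
        \<and> closure (j ` pts L) = UNIV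
        \<and> (\<forall>g\<in>carrier (grp L). \<forall>x\<in>pts L. \<alpha> (h g) (j x) = j (act L g x)))"

end

theory Submission
  imports Defs
begin

text \<open>
  Call an action \<open>\<beta>\<close> of \<open>G\<close> on the space extensive if, for finite subgroups \<open>F\<close> and \<open>H\<close> of \<open>G\<close>, an
  embedding \<open>\<theta>\<close> of \<open>F\<close> into \<open>H\<close> and a finite tuple \<open>u\<close> of points, every \<open>H\<close>-invariant metric on finitely
  many copies of \<open>H\<close> that almost extends the metric of the \<open>F\<close>-orbits of \<open>u\<close> is almost realized by \<open>\<beta>\<close> along
  an embedding of \<open>H\<close> into \<open>G\<close> over \<open>F\<close>, at points near \<open>u\<close>. Rounding the parameters turns this into
  countably many open conditions on \<open>\<beta>\<close>. An approximate back-and-forth argument shows that any two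
  extensive actions are weakly equivalent, and \<open>\<alpha>\<close> is extensive because the Fraisse limit has the
  extension property and its base points are dense. Hence the weak equivalence class of \<open>\<alpha>\<close> is the set of
  extensive actions, a countable intersection of open sets. For density, a finite piece of an arbitrary
  action is approximately realized inside \<open>\<alpha>\<close>; back-and-forth between \<open>\<alpha>\<close> and itself extends the
  resulting partial automorphism of \<open>G\<close> and partial isometry to global ones, which conjugate \<open>\<alpha>\<close> close to the
  given action. The homogeneity of \<open>G\<close> and of the space thus comes from \<open>\<alpha>\<close> itself.
\<close>

section \<open>Integer metrics and gluing\<close>

text \<open>The obstacle is that the limit extends only exact rational data, sending base points to
  base points, whereas distances in the space are real and \<beta> need not be free. So every metric
  is rounded to an integer metric over a denominator \<open>N\<close>, and an approximate
  prescription is made exact by gluing: the configuration already present and the desired one are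
  placed side by side in one invariant metric, with corresponding points at distance at most
  \<open>e\<close>. The limit realizes this metric exactly over the old configuration, and the
  second half of it is the desired realization, displaced by a multiple of the error. Since the
  displacement is linear in the error, halving the errors in the back-and-forth gives convergent
  sequences. The constants record the proportion: 2 for base points of the limit, 3 for arbitrary
  points of the space, 5 after moving the parameters into a countable set, 10 for one step, where
  the errors of matching and rounding add up, and 40 for a whole back-and-forth, where each of two
  tuples drifts by 20. Integrality also leaves only countably many metrics on a finite set.\<close>

definition int_metric :: "'a set \<Rightarrow> ('a \<Rightarrow> 'a \<Rightarrow> int) \<Rightarrow> bool" where
  "int_metric S d \<longleftrightarrow>
     (\<forall>x\<in>S. \<forall>y\<in>S. (d x y = 0 \<longleftrightarrow> x = y) \<and> d x y = d y x \<and> (\<forall>z\<in>S. d x z \<le> d x y + d y z))"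

lemma int_metricI:
  assumes "\<And>x y. \<lbrakk>x \<in> S; y \<in> S\<rbrakk> \<Longrightarrow> d x y = 0 \<longleftrightarrow> x = y"
    and "\<And>x y. \<lbrakk>x \<in> S; y \<in> S\<rbrakk> \<Longrightarrow> d x y = d y x"
    and "\<And>x y z. \<lbrakk>x \<in> S; y \<in> S; z \<in> S\<rbrakk> \<Longrightarrow> d x z \<le> d x y + d y z"
  shows "int_metric S d"
  using assms unfolding int_metric_def by blast

lemma
  assumes "int_metric S d" "x \<in> S" "y \<in> S"
  shows int_metric_zero: "d x y = 0 \<longleftrightarrow> x = y"
    and int_metric_sym: "d x y = d y x"
    and int_metric_triangle: "z \<in> S \<Longrightarrow> d x z \<le> d x y + d y z"
    and int_metric_nonneg: "0 \<le> d x y"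
proof -
  show *: "d x y = 0 \<longleftrightarrow> x = y" "d x y = d y x" and "z \<in> S \<Longrightarrow> d x z \<le> d x y + d y z"
    using assms unfolding int_metric_def by blast+
  have "d x x \<le> d x y + d y x" "d x x = 0"
    using assms unfolding int_metric_def by blast+
  with * show "0 \<le> d x y"
    by linarith
qed

lemma int_metric_vimage:
  assumes "int_metric S d" "f ` T \<subseteq> S" "inj_on f T"
  shows "int_metric T (\<lambda>x y. d (f x) (f y))"
proof (rule int_metricI)
  show "d (f x) (f y) = 0 \<longleftrightarrow> x = y" if "x \<in> T" "y \<in> T" for x y
    using int_metric_zero[OF assms(1), of "f x" "f y"] assms(2,3) that
    by (auto simp: inj_on_def)
  show "d (f x) (f y) = d (f y) (f x)" if "x \<in> T" "y \<in> T" for x y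
    using int_metric_sym[OF assms(1), of "f x" "f y"] assms(2) that by auto
  show "d (f x) (f z) \<le> d (f x) (f y) + d (f y) (f z)" if "x \<in> T" "y \<in> T" "z \<in> T" for x y z
    using int_metric_triangle[OF assms(1), of "f x" "f y" "f z"] assms(2) that by auto
qed

text \<open>Rounding up is subadditive, so the triangle inequality survives it. The added 1
  separates distinct points at \<open>p\<close>-distance 0, so that a pseudometric suffices; it
  occurs on the right of the triangle inequality whenever it occurs on the left.\<close>

lemma int_metric_ceiling:
  fixes p :: "'a \<Rightarrow> 'a \<Rightarrow> real"
  assumes "\<And>x y. \<lbrakk>x \<in> S; y \<in> S\<rbrakk> \<Longrightarrow> 0 \<le> p x y"
    and "\<And>x y. \<lbrakk>x \<in> S; y \<in> S\<rbrakk> \<Longrightarrow> p x y = p y x"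
    and "\<And>x y z. \<lbrakk>x \<in> S; y \<in> S; z \<in> S\<rbrakk> \<Longrightarrow> p x z \<le> p x y + p y z"
  shows "int_metric S (\<lambda>x y. if x = y then 0 else \<lceil>p x y\<rceil> + 1)"
proof (rule int_metricI)
  have nn: "0 \<le> \<lceil>p x y\<rceil>" if "x \<in> S" "y \<in> S" for x y
    using assms(1)[OF that] by linarith
  show "(if x = y then 0 else \<lceil>p x y\<rceil> + 1) = 0 \<longleftrightarrow> x = y" if "x \<in> S" "y \<in> S" for x y
    using nn[OF that] by (smt (verit))
  show "(if x = y then 0 else \<lceil>p x y\<rceil> + 1) = (if y = x then 0 else \<lceil>p y x\<rceil> + 1)"
    if "x \<in> S" "y \<in> S" for x y
    using assms(2)[OF that] by auto
  show "(if x = z then 0 else \<lceil>p x z\<rceil> + 1)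
      \<le> (if x = y then 0 else \<lceil>p x y\<rceil> + 1) + (if y = z then 0 else \<lceil>p y z\<rceil> + 1)"
    if "x \<in> S" "y \<in> S" "z \<in> S" for x y z
  proof -
    have "\<lceil>p x z\<rceil> \<le> \<lceil>p x y\<rceil> + \<lceil>p y z\<rceil>"
      using assms(3)[OF that] ceiling_add_le[of "p x y" "p y z"] ceiling_mono[of "p x z" "p x y + p y z"]
      by linarith
    with nn that show ?thesis
      by (smt (verit))
  qed
qed

text \<open>
  \<open>\<rho>\<close> is a metric on each class of \<open>R\<close> only, and \<open>x\<close> is to be glued to \<open>\<pi> x\<close> at distance \<open>e\<close>.
\<close>

locale gluing =
  fixes X :: "'a set" and R :: "'a \<Rightarrow> 'a \<Rightarrow> bool" and \<rho> :: "'a \<Rightarrow> 'a \<Rightarrow> int"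
    and Y :: "'b set" and \<delta> :: "'b \<Rightarrow> 'b \<Rightarrow> int" and \<pi> :: "'a \<Rightarrow> 'b" and e :: int
  assumes finite_X: "finite X"
    and R_refl: "x \<in> X \<Longrightarrow> R x x"
    and R_sym: "\<lbrakk>x \<in> X; y \<in> X; R x y\<rbrakk> \<Longrightarrow> R y x"
    and R_trans: "\<lbrakk>x \<in> X; y \<in> X; z \<in> X; R x y; R y z\<rbrakk> \<Longrightarrow> R x z"
    and \<rho>_zero: "\<lbrakk>x \<in> X; y \<in> X; R x y\<rbrakk> \<Longrightarrow> \<rho> x y = 0 \<longleftrightarrow> x = y"
    and \<rho>_sym: "\<lbrakk>x \<in> X; y \<in> X; R x y\<rbrakk> \<Longrightarrow> \<rho> x y = \<rho> y x"
    and \<rho>_triangle: "\<lbrakk>x \<in> X; y \<in> X; z \<in> X; R x y; R y z\<rbrakk> \<Longrightarrow> \<rho> x z \<le> \<rho> x y + \<rho> y z"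
    and \<delta>_metric: "int_metric Y \<delta>"
    and \<pi>_in: "x \<in> X \<Longrightarrow> \<pi> x \<in> Y"
    and close: "\<lbrakk>x \<in> X; y \<in> X; R x y\<rbrakk> \<Longrightarrow> \<bar>\<rho> x y - \<delta> (\<pi> x) (\<pi> y)\<bar> \<le> 2 * e"
    and e_pos: "1 \<le> e"
begin

text \<open>These are the integer potentials of the weighted graph whose edges are the
  \<open>R\<close>-related pairs of \<open>X\<close> with length \<open>\<rho>\<close>, all pairs of
  \<open>Y\<close> with length \<open>\<delta>\<close>, and the links from \<open>x\<close> to
  \<open>\<pi> x\<close> with length \<open>e\<close>. By duality \<open>glued\<close> is the
  shortest-path metric of this graph.\<close>

definition lip :: "('a + 'b \<Rightarrow> int) \<Rightarrow> bool" where
  "lip \<phi> \<longleftrightarrow> (\<forall>x\<in>X. \<forall>y\<in>X. R x y \<longrightarrow> \<phi> (Inl x) - \<phi> (Inl y) \<le> \<rho> x y)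
      \<and> (\<forall>x\<in>Y. \<forall>y\<in>Y. \<phi> (Inr x) - \<phi> (Inr y) \<le> \<delta> x y)
      \<and> (\<forall>x\<in>X. \<bar>\<phi> (Inl x) - \<phi> (Inr (\<pi> x))\<bar> \<le> e)"

text \<open>
  A supremum of differences satisfies the triangle inequality by construction, and restricting to
  integer-valued functions keeps the distances integral.
\<close>

definition glued :: "'a + 'b \<Rightarrow> 'a + 'b \<Rightarrow> int" where
  "glued p q = Sup {\<phi> p - \<phi> q |\<phi>. lip \<phi>}"

abbreviation "Z \<equiv> X <+> Y"

definition foot :: "'a + 'b \<Rightarrow> 'b" where
  "foot p = case_sum \<pi> (\<lambda>y. y) p"

lemma \<rho>_nonneg: "\<lbrakk>x \<in> X; y \<in> X; R x y\<rbrakk> \<Longrightarrow> 0 \<le> \<rho> x y"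
  using \<rho>_triangle[of x y x] \<rho>_sym[of x y] \<rho>_zero[of x x] R_sym[of x y] R_refl[of x] by force

lemma lip_const: "lip (\<lambda>_. 0)"
  unfolding lip_def using \<rho>_nonneg int_metric_nonneg[OF \<delta>_metric] e_pos by auto

lemma lip_uminus:
  assumes "lip \<phi>"
  shows "lip (\<lambda>p. - \<phi> p)"
proof -
  have "- \<phi> (Inl x) - - \<phi> (Inl y) \<le> \<rho> x y" if "x \<in> X" "y \<in> X" "R x y" for x y
    using assms that \<rho>_sym[OF that] R_sym[OF that] unfolding lip_def by fastforce
  moreover have "- \<phi> (Inr x) - - \<phi> (Inr y) \<le> \<delta> x y" if "x \<in> Y" "y \<in> Y" for x y
    using assms that int_metric_sym[OF \<delta>_metric that] unfolding lip_def by fastforce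
  moreover have "\<bar>- \<phi> (Inl x) - - \<phi> (Inr (\<pi> x))\<bar> \<le> e" if "x \<in> X" for x
    using assms that unfolding lip_def by fastforce
  ultimately show ?thesis
    unfolding lip_def by blast
qed

text \<open>A supremum of integers is meaningful only for a bounded set. The bound comes from
  walking over a link into \<open>Y\<close>, along \<open>\<delta>\<close>, and back over a
  link.\<close>

lemma lip_bound:
  assumes "lip \<phi>" "p \<in> Z" "q \<in> Z"
  shows "\<phi> p - \<phi> q \<le> 2 * e + \<delta> (foot p) (foot q)"
proof -
  have foot: "\<bar>\<phi> p - \<phi> (Inr (foot p))\<bar> \<le> e" "foot p \<in> Y" if "p \<in> Z" for p
    using that assms(1) \<pi>_in e_pos unfolding lip_def foot_def by auto
  have "\<phi> (Inr (foot p)) - \<phi> (Inr (foot q)) \<le> \<delta> (foot p) (foot q)"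
    using assms(1) foot(2) assms(2,3) unfolding lip_def by blast
  with foot(1)[OF assms(2)] foot(1)[OF assms(3)] show ?thesis
    by linarith
qed

lemma glued_upper:
  assumes "p \<in> Z" "q \<in> Z" "lip \<phi>"
  shows "\<phi> p - \<phi> q \<le> glued p q"
proof -
  have "bdd_above {\<phi> p - \<phi> q |\<phi>. lip \<phi>}"
    unfolding bdd_above_def using lip_bound[OF _ assms(1,2)] by blast
  with assms(3) show ?thesis
    unfolding glued_def by (intro cSup_upper) auto
qed

lemma glued_least:
  assumes "\<And>\<phi>. lip \<phi> \<Longrightarrow> \<phi> p - \<phi> q \<le> c"
  shows "glued p q \<le> c"
  unfolding glued_def
  by (rule cSup_least) (use assms lip_const in auto)

lemma glued_refl: "glued p p = 0"
proof -
  have "{\<phi> p - \<phi> p |\<phi>. lip \<phi>} = {0}"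
    using lip_const by auto
  then show ?thesis
    unfolding glued_def by simp
qed

lemma glued_sym:
  assumes "p \<in> Z" "q \<in> Z"
  shows "glued p q = glued q p"
proof -
  have "glued p q \<le> glued q p" if "p \<in> Z" "q \<in> Z" for p q
    by (rule glued_least) (use glued_upper[OF that(2,1) lip_uminus] in force)
  with assms show ?thesis
    by (simp add: antisym)
qed

lemma glued_triangle:
  assumes "p \<in> Z" "q \<in> Z" "r \<in> Z"
  shows "glued p r \<le> glued p q + glued q r"
  by (rule glued_least) (use glued_upper[OF assms(1,2)] glued_upper[OF assms(2,3)] in force)

text \<open>Precomposing with a symmetry turns an admissible potential into an admissible one. This
  gives one inequality; for a group of symmetries the inverse gives the other, which makes
  \<open>glued\<close> invariant.\<close>

lemma glued_mono:
  assumes "s ` X \<subseteq> X" "t ` Y \<subseteq> Y"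
    and "\<And>x y. \<lbrakk>x \<in> X; y \<in> X; R x y\<rbrakk> \<Longrightarrow> R (s x) (s y) \<and> \<rho> (s x) (s y) = \<rho> x y"
    and "\<And>x y. \<lbrakk>x \<in> Y; y \<in> Y\<rbrakk> \<Longrightarrow> \<delta> (t x) (t y) = \<delta> x y"
    and "\<And>x. x \<in> X \<Longrightarrow> \<pi> (s x) = t (\<pi> x)"
    and "p \<in> Z" "q \<in> Z"
  shows "glued (map_sum s t p) (map_sum s t q) \<le> glued p q"
proof (rule glued_least)
  fix \<phi> assume \<phi>: "lip \<phi>"
  have "\<phi> (Inl (s x)) - \<phi> (Inl (s y)) \<le> \<rho> x y" if "x \<in> X" "y \<in> X" "R x y" for x y
    using \<phi> assms(1) assms(3)[OF that] that unfolding lip_def by (metis image_subset_iff)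
  moreover have "\<phi> (Inr (t x)) - \<phi> (Inr (t y)) \<le> \<delta> x y" if "x \<in> Y" "y \<in> Y" for x y
    using \<phi> assms(2) assms(4)[OF that] that unfolding lip_def by (metis image_subset_iff)
  moreover have "\<bar>\<phi> (Inl (s x)) - \<phi> (Inr (t (\<pi> x)))\<bar> \<le> e" if "x \<in> X" for x
    using \<phi> assms(1) assms(5)[OF that] that unfolding lip_def by (metis image_subset_iff)
  ultimately have "lip (\<phi> \<circ> map_sum s t)"
    unfolding lip_def by auto
  from glued_upper[OF assms(6,7) this] show "\<phi> (map_sum s t p) - \<phi> (map_sum s t q) \<le> glued p q"
    by simp
qed

text \<open>McShane's extension of a Lipschitz function on \<open>Y\<close>, raised by \<open>e\<close> so that it stays within \<open>e\<close> of \<open>g \<circ> \<pi>\<close>.\<close>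

definition mcshane :: "('b \<Rightarrow> int) \<Rightarrow> 'a \<Rightarrow> int" where
  "mcshane g x = Min ((\<lambda>a. g (\<pi> a) + e + \<rho> x a) ` {a \<in> X. R x a})"

lemma mcshane_le: "\<lbrakk>x \<in> X; a \<in> X; R x a\<rbrakk> \<Longrightarrow> mcshane g x \<le> g (\<pi> a) + e + \<rho> x a"
  unfolding mcshane_def by (rule Min_le) (use finite_X in auto)

lemma mcshane_attained:
  assumes "x \<in> X"
  obtains a where "a \<in> X" "R x a" "mcshane g x = g (\<pi> a) + e + \<rho> x a"
proof -
  have "mcshane g x \<in> (\<lambda>a. g (\<pi> a) + e + \<rho> x a) ` {a \<in> X. R x a}"
    unfolding mcshane_def by (rule Min_in) (use finite_X assms R_refl in auto)
  with that show ?thesis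
    by blast
qed

lemma mcshane_lip:
  assumes "x \<in> X" "y \<in> X" "R x y"
  shows "mcshane g x - mcshane g y \<le> \<rho> x y"
proof -
  obtain a where a: "a \<in> X" "R y a" "mcshane g y = g (\<pi> a) + e + \<rho> y a"
    using mcshane_attained[OF assms(2)] .
  have "mcshane g x \<le> g (\<pi> a) + e + \<rho> x a"
    using mcshane_le assms a R_trans by blast
  with a \<rho>_triangle[OF assms(1,2) a(1) assms(3) a(2)] show ?thesis
    by linarith
qed

text \<open>The choice \<open>a = x\<close> gives the upper bound. For the lower one,
  \<open>\<rho> x a\<close> is at least the \<open>\<delta>\<close>-distance of the two images under
  \<open>\<pi>\<close> minus \<open>2 * e\<close>, and the raise by \<open>e\<close> leaves
  \<open>- e\<close>. The raise thus centres the window, which is why links of length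
  \<open>e\<close> tolerate a discrepancy of \<open>2 * e\<close>.\<close>

lemma mcshane_close:
  assumes "\<And>x y. \<lbrakk>x \<in> Y; y \<in> Y\<rbrakk> \<Longrightarrow> g x - g y \<le> \<delta> x y" "x \<in> X"
  shows "\<bar>mcshane g x - g (\<pi> x)\<bar> \<le> e"
proof -
  obtain a where a: "a \<in> X" "R x a" "mcshane g x = g (\<pi> a) + e + \<rho> x a"
    using mcshane_attained[OF assms(2)] .
  have "g (\<pi> x) - g (\<pi> a) \<le> \<delta> (\<pi> x) (\<pi> a)"
    using assms \<pi>_in a by blast
  moreover have "mcshane g x \<le> g (\<pi> x) + e"
    using mcshane_le[OF assms(2,2) R_refl[OF assms(2)]] \<rho>_zero[OF assms(2,2) R_refl[OF assms(2)]] by fastforce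
  ultimately show ?thesis
    using close[OF assms(2) a(1,2)] a(3) by linarith
qed

text \<open>The distance to \<open>y\<close> is Lipschitz on \<open>Y\<close>, and McShane's
  extension turns it into a potential on all of \<open>Z\<close> that attains the bound.\<close>

lemma glued_right:
  assumes "x \<in> Y" "y \<in> Y"
  shows "glued (Inr x) (Inr y) = \<delta> x y"
proof (rule antisym)
  show "glued (Inr x) (Inr y) \<le> \<delta> x y"
    by (rule glued_least) (use assms lip_def in blast)
  define g where "g = (\<lambda>z. \<delta> z y)"
  have g: "g a - g b \<le> \<delta> a b" if "a \<in> Y" "b \<in> Y" for a b
    using int_metric_triangle[OF \<delta>_metric that assms(2)] unfolding g_def by linarith
  have "lip (case_sum (mcshane g) g)"
    unfolding lip_def using g mcshane_lip mcshane_close[of g] by auto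
  from glued_upper[OF _ _ this, of "Inr x" "Inr y"] assms
  show "\<delta> x y \<le> glued (Inr x) (Inr y)"
    using int_metric_zero[OF \<delta>_metric, of y y] by (auto simp: g_def)
qed

text \<open>The potential is the \<open>\<rho>\<close>-distance to \<open>y\<close> on the class
  \<open>C\<close> of \<open>y\<close>. It is carried to \<open>Y\<close> by the cheapest route over
  a link, and from \<open>Y\<close> to the other classes by \<open>mcshane\<close>. Since
  \<open>lip\<close> does not compare different classes, the two prescriptions on \<open>X\<close>
  do not interfere.\<close>

lemma glued_left:
  assumes "x \<in> X" "y \<in> X" "R x y"
  shows "glued (Inl x) (Inl y) = \<rho> x y"
proof (rule antisym)
  show "glued (Inl x) (Inl y) \<le> \<rho> x y"
    by (rule glued_least) (use assms lip_def in blast)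
  define C where "C = {a \<in> X. R a y}"
  have C: "finite C" "C \<noteq> {}"
    using finite_X assms C_def by auto
  define g where "g = (\<lambda>z. Min ((\<lambda>c. \<rho> c y + e + \<delta> (\<pi> c) z) ` C))"
  have g_le: "g z \<le> \<rho> c y + e + \<delta> (\<pi> c) z" if "c \<in> C" for c z
    unfolding g_def by (rule Min_le) (use C that in auto)
  have g_att: "\<exists>c\<in>C. g z = \<rho> c y + e + \<delta> (\<pi> c) z" for z
  proof -
    have "g z \<in> (\<lambda>c. \<rho> c y + e + \<delta> (\<pi> c) z) ` C"
      unfolding g_def by (rule Min_in) (use C in auto)
    then show ?thesis
      by blast
  qed
  have g: "g a - g b \<le> \<delta> a b" if "a \<in> Y" "b \<in> Y" for a b
  proof -
    obtain c where c: "c \<in> C" "g b = \<rho> c y + e + \<delta> (\<pi> c) b"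
      using g_att by blast
    then have "\<pi> c \<in> Y"
      using \<pi>_in C_def by auto
    with int_metric_triangle[OF \<delta>_metric this that(2,1)] int_metric_sym[OF \<delta>_metric that] g_le[OF c(1), of a] c(2)
    show ?thesis
      by linarith
  qed
  have RC: "R a b" if "a \<in> C" "b \<in> C" for a b
    using that R_trans[of a y b] R_sym[of b y] assms(2) C_def by auto
  have lipC: "\<rho> a y - \<rho> b y \<le> \<rho> a b" if "a \<in> C" "b \<in> C" for a b
    using \<rho>_triangle[of a b y] RC[OF that] that assms(2) C_def by auto
  have g_close: "\<bar>\<rho> a y - g (\<pi> a)\<bar> \<le> e" if a: "a \<in> C" for a
  proof -
    obtain c where c: "c \<in> C" "g (\<pi> a) = \<rho> c y + e + \<delta> (\<pi> c) (\<pi> a)"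
      using g_att by blast
    have X: "a \<in> X" "c \<in> X"
      using a c C_def by auto
    have "\<delta> (\<pi> a) (\<pi> a) = 0"
      using int_metric_zero[OF \<delta>_metric] \<pi>_in X by blast
    moreover have "\<delta> (\<pi> a) (\<pi> c) = \<delta> (\<pi> c) (\<pi> a)"
      using int_metric_sym[OF \<delta>_metric] \<pi>_in X by blast
    ultimately show ?thesis
      using g_le[OF a, of "\<pi> a"] c lipC[OF a c(1)] close[OF X RC[OF a c(1)]] by linarith
  qed
  define \<phi> where "\<phi> = case_sum (\<lambda>a. if a \<in> C then \<rho> a y else mcshane g a) g"
  have "a \<in> C \<longleftrightarrow> b \<in> C" if "a \<in> X" "b \<in> X" "R a b" for a b
    using that R_trans[of a b y] R_trans[of b a y] R_sym assms(2) C_def by blast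
  then have "lip \<phi>"
    unfolding lip_def \<phi>_def using g mcshane_lip mcshane_close[of g] lipC g_close by auto
  from glued_upper[OF _ _ this, of "Inl x" "Inl y"] assms
  show "\<rho> x y \<le> glued (Inl x) (Inl y)"
    using \<rho>_zero[OF assms(2,2)] R_refl by (auto simp: \<phi>_def C_def)
qed

lemma glued_link: "x \<in> X \<Longrightarrow> glued (Inl x) (Inr (\<pi> x)) \<le> e"
  by (rule glued_least) (force simp: lip_def)

lemma glued_pos:
  assumes "p \<in> Z" "q \<in> Z" "p \<noteq> q"
  shows "0 < glued p q"
proof -
  have left: "0 < glued (Inl x) q" if "x \<in> X" "q \<in> Z" "Inl x \<noteq> q" for x q
  proof (cases "\<exists>y\<in>X. q = Inl y \<and> R x y")
    case True
    then obtain y where "y \<in> X" "q = Inl y" "R x y"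
      by blast
    with that show ?thesis
      using glued_left[of x y] \<rho>_zero[of x y] \<rho>_nonneg[of x y] by simp
  next
    case False
    \<comment> \<open>The indicator of the class of \<open>x\<close> is admissible: it is constant
      on classes, and along a link it changes by at most 1, which is allowed because
      \<open>1 \<le> e\<close>.\<close>
    define \<phi> :: "'a + 'b \<Rightarrow> int" where "\<phi> = case_sum (\<lambda>a. if R x a then 1 else 0) (\<lambda>_. 0)"
    have "R x a \<longleftrightarrow> R x b" if "a \<in> X" "b \<in> X" "R a b" for a b
      using that R_trans R_sym \<open>x \<in> X\<close> by blast
    then have "lip \<phi>"
      unfolding lip_def \<phi>_def using \<rho>_nonneg int_metric_nonneg[OF \<delta>_metric] e_pos by auto
    from glued_upper[OF InlI[OF \<open>x \<in> X\<close>] \<open>q \<in> Z\<close> this] that(1,2) False show ?thesis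
      using R_refl[of x] by (auto simp: \<phi>_def)
  qed
  show ?thesis
  proof (cases p; cases q)
    fix a b assume "p = Inr a" "q = Inr b"
    then show ?thesis
      using assms glued_right[of a b] int_metric_zero[OF \<delta>_metric, of a b] int_metric_nonneg[OF \<delta>_metric, of a b]
      by auto
  qed (use assms left glued_sym in auto)
qed

lemma glued_metric: "int_metric Z glued"
proof (rule int_metricI)
  show "glued p q = 0 \<longleftrightarrow> p = q" if "p \<in> Z" "q \<in> Z" for p q
    using glued_pos[OF that] glued_refl[of p] by (metis less_irrefl)
qed (fact glued_sym glued_triangle)+

end

text \<open>A free action of \<open>H\<close> with \<open>m\<close> orbits and a chosen point in
  each is left translation on \<open>m\<close> copies of \<open>H\<close>, with the pairs of the
  unit and an index as chosen points. So for \<open>0 < m\<close> these metrics, divided by a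
  positive integer, are coordinates for the members of the Fraisse class with group
  \<open>H\<close>.\<close>

definition invariant_metric ::
    "('g, 'b) monoid_scheme \<Rightarrow> 'g set \<Rightarrow> nat \<Rightarrow> ('g \<times> nat \<Rightarrow> 'g \<times> nat \<Rightarrow> int) \<Rightarrow> bool" where
  "invariant_metric G H m d \<longleftrightarrow>
     int_metric (H \<times> {..<m}) d
   \<and> (\<forall>g\<in>H. \<forall>h\<in>H. \<forall>k\<in>H. \<forall>i<m. \<forall>j<m. d (g \<otimes>\<^bsub>G\<^esub> h, i) (g \<otimes>\<^bsub>G\<^esub> k, j) = d (h, i) (k, j))"

section \<open>Injective homomorphisms of groups\<close>

lemma monD:
  assumes "\<phi> \<in> mon A B"
  shows "\<And>x. x \<in> carrier A \<Longrightarrow> \<phi> x \<in> carrier B"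
    and "\<And>x y. \<lbrakk>x \<in> carrier A; y \<in> carrier A\<rbrakk> \<Longrightarrow> \<phi> (x \<otimes>\<^bsub>A\<^esub> y) = \<phi> x \<otimes>\<^bsub>B\<^esub> \<phi> y"
    and "inj_on \<phi> (carrier A)"
  using assms by (auto simp: mon_def hom_def)

lemma monI:
  assumes "\<And>x. x \<in> carrier A \<Longrightarrow> \<phi> x \<in> carrier B"
    and "\<And>x y. \<lbrakk>x \<in> carrier A; y \<in> carrier A\<rbrakk> \<Longrightarrow> \<phi> (x \<otimes>\<^bsub>A\<^esub> y) = \<phi> x \<otimes>\<^bsub>B\<^esub> \<phi> y"
    and "inj_on \<phi> (carrier A)"
  shows "\<phi> \<in> mon A B"
  using assms by (auto simp: mon_def hom_def)

lemma mon_one: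
  assumes "\<phi> \<in> mon A B" "group A" "group B"
  shows "\<phi> \<one>\<^bsub>A\<^esub> = \<one>\<^bsub>B\<^esub>"
  using assms hom_one[of \<phi> A B] by (auto simp: mon_def)

lemma mon_compose:
  assumes \<phi>: "\<phi> \<in> mon A B" and \<psi>: "\<psi> \<in> mon B C"
  shows "\<psi> \<circ> \<phi> \<in> mon A C"
proof (rule monI)
  show "inj_on (\<psi> \<circ> \<phi>) (carrier A)"
    using monD[OF \<phi>] monD[OF \<psi>] by (simp add: inj_on_def)
qed (use monD[OF \<phi>] monD[OF \<psi>] in simp_all)

lemma mon_inv_into:
  assumes \<phi>: "\<phi> \<in> mon A B" and A: "group A"
  shows "inv_into (carrier A) \<phi> \<in> mon (B\<lparr>carrier := \<phi> ` carrier A\<rparr>) A"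
proof (rule monI)
  interpret A: group A by (rule A)
  show "inv_into (carrier A) \<phi> (x \<otimes>\<^bsub>B\<lparr>carrier := \<phi> ` carrier A\<rparr>\<^esub> y)
      = inv_into (carrier A) \<phi> x \<otimes>\<^bsub>A\<^esub> inv_into (carrier A) \<phi> y"
    if xy: "x \<in> carrier (B\<lparr>carrier := \<phi> ` carrier A\<rparr>)" "y \<in> carrier (B\<lparr>carrier := \<phi> ` carrier A\<rparr>)" for x y
  proof -
    obtain a b where ab: "a \<in> carrier A" "b \<in> carrier A" "x = \<phi> a" "y = \<phi> b"
      using xy by auto
    then have "x \<otimes>\<^bsub>B\<^esub> y = \<phi> (a \<otimes>\<^bsub>A\<^esub> b)"
      using monD(2)[OF \<phi>] by simp
    with ab show ?thesis
      using monD(3)[OF \<phi>] by simp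
  qed
  show "inv_into (carrier A) \<phi> x \<in> carrier A" if "x \<in> carrier (B\<lparr>carrier := \<phi> ` carrier A\<rparr>)" for x
    using inv_into_into[of x \<phi> "carrier A"] that by simp
  show "inj_on (inv_into (carrier A) \<phi>) (carrier (B\<lparr>carrier := \<phi> ` carrier A\<rparr>))"
    by (simp add: inj_on_inv_into)
qed

lemma mon_image_subgroup:
  assumes "\<phi> \<in> mon (G\<lparr>carrier := F\<rparr>) K" "group G" "group K" "subgroup F G"
  shows "subgroup (\<phi> ` F) K"
proof -
  interpret group_hom "G\<lparr>carrier := F\<rparr>" K \<phi>
    using assms group.subgroup_imp_group[OF assms(2,4)] by (simp add: group_hom_def group_hom_axioms_def mon_def)
  show ?thesis
    using img_is_subgroup by simp
qed

text \<open>Here \<open>\<rho>\<close> is known on copies of \<open>F\<close> only. Left translation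
  carries it to every left coset of the image of \<open>F\<close> in \<open>H\<close>, and no
  distance is given between different cosets; this is why the gluing works with a metric on the
  classes of \<open>R\<close>. The first \<open>n\<close> copies of \<open>H\<close> in the result
  carry the cosets, the last \<open>m\<close> copies carry \<open>\<delta>\<close>.\<close>

lemma (in group) invariant_gluing:
  assumes H: "subgroup H G" "finite H" and F: "subgroup F K" "finite F" "group K"
    and \<theta>: "\<theta> \<in> mon (K\<lparr>carrier := F\<rparr>) (G\<lparr>carrier := H\<rparr>)" and nm: "n \<le> m"
    and \<rho>: "invariant_metric K F n \<rho>" and \<delta>: "invariant_metric G H m \<delta>"
    and close: "\<And>f k i j. \<lbrakk>f \<in> F; k \<in> F; i < n; j < n\<rbrakk>
      \<Longrightarrow> \<bar>\<rho> (f, i) (k, j) - \<delta> (\<theta> f, i) (\<theta> k, j)\<bar> \<le> 2 * e"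
    and e: "1 \<le> e"
  obtains D where "invariant_metric G H (n + m) D"
    and "\<And>f k i j. \<lbrakk>f \<in> F; k \<in> F; i < n; j < n\<rbrakk> \<Longrightarrow> D (\<theta> f, i) (\<theta> k, j) = \<rho> (f, i) (k, j)"
    and "\<And>h k i j. \<lbrakk>h \<in> H; k \<in> H; i < m; j < m\<rbrakk> \<Longrightarrow> D (h, n + i) (k, n + j) = \<delta> (h, i) (k, j)"
    and "\<And>h i. \<lbrakk>h \<in> H; i < n\<rbrakk> \<Longrightarrow> D (h, i) (h, n + i) \<le> e"
proof -
  interpret K: group K by (rule F)
  interpret H: subgroup H G by (rule H)
  interpret F: subgroup F K by (rule F)
  have H_carrier: "h \<in> carrier G" if "h \<in> H" for h
    using that by simp
  have \<theta>_in: "\<theta> f \<in> H" if "f \<in> F" for f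
    using monD(1)[OF \<theta>] that by simp
  have \<theta>_mult: "\<theta> (f \<otimes>\<^bsub>K\<^esub> g) = \<theta> f \<otimes> \<theta> g" if "f \<in> F" "g \<in> F" for f g
    using monD(2)[OF \<theta>] that by simp
  have \<theta>_inj: "inj_on \<theta> F"
    using monD(3)[OF \<theta>] by simp
  have \<theta>_one: "\<theta> \<one>\<^bsub>K\<^esub> = \<one>"
    using mon_one[OF \<theta>] H(1) F(1) by (simp add: K.subgroup_imp_group subgroup_imp_group)
  have \<theta>_inv: "\<theta> (inv\<^bsub>K\<^esub> f) = inv (\<theta> f)" if "f \<in> F" for f
  proof -
    have "\<theta> (inv\<^bsub>K\<^esub> f) \<otimes> \<theta> f = \<one>"
      using \<theta>_mult[of "inv\<^bsub>K\<^esub> f" f] that \<theta>_one by simp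
    then show ?thesis
      using that \<theta>_in by (metis F.m_inv_closed H.mem_carrier inv_equality)
  qed
  define \<tau> where "\<tau> = inv_into F \<theta>"
  have \<tau>[simp]: "\<tau> (\<theta> f) = f" if "f \<in> F" for f
    using \<theta>_inj that by (simp add: \<tau>_def)
  have \<rho>_metric: "int_metric (F \<times> {..<n}) \<rho>"
    and \<rho>_inv: "\<And>g h k i j. \<lbrakk>g \<in> F; h \<in> F; k \<in> F; i < n; j < n\<rbrakk>
      \<Longrightarrow> \<rho> (g \<otimes>\<^bsub>K\<^esub> h, i) (g \<otimes>\<^bsub>K\<^esub> k, j) = \<rho> (h, i) (k, j)"
    using \<rho> by (auto simp: invariant_metric_def)
  have \<delta>_metric: "int_metric (H \<times> {..<m}) \<delta>"
    and \<delta>_inv: "\<And>g h k i j. \<lbrakk>g \<in> H; h \<in> H; k \<in> H; i < m; j < m\<rbrakk>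
      \<Longrightarrow> \<delta> (g \<otimes> h, i) (g \<otimes> k, j) = \<delta> (h, i) (k, j)"
    using \<delta> by (auto simp: invariant_metric_def)
  define X where "X = H \<times> {..<n}"
  define Y where "Y = H \<times> {..<m}"
  \<comment> \<open>Being related means lying over the same left coset of the image of
    \<open>F\<close>; \<open>\<rho>'\<close> translates \<open>x\<close> to the unit and reads off
    \<open>\<rho>\<close> there. Both depend only on the indices and on the inverse of the first
    group element times the second, so they are invariant under left translation.\<close>
  define R where "R = (\<lambda>(x :: 'a \<times> nat) (y :: 'a \<times> nat). inv (fst x) \<otimes> fst y \<in> \<theta> ` F)"
  define \<rho>' where "\<rho>' = (\<lambda>x y. \<rho> (\<one>\<^bsub>K\<^esub>, snd x) (\<tau> (inv (fst x) \<otimes> fst y), snd y))"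
  have obt: "\<exists>f\<in>F. fst y = fst x \<otimes> \<theta> f" if xy: "x \<in> X" "y \<in> X" "R x y" for x y
  proof -
    have "fst x \<in> carrier G" "fst y \<in> carrier G"
      using xy H_carrier by (auto simp: X_def)
    then have "fst x \<otimes> (inv (fst x) \<otimes> fst y) = fst y"
      by (simp add: m_assoc[symmetric])
    moreover obtain f where "f \<in> F" "inv (fst x) \<otimes> fst y = \<theta> f"
      using xy by (auto simp: R_def)
    ultimately show ?thesis
      by metis
  qed
  have rel: "R (h, i) (h \<otimes> \<theta> f, j)" "\<rho>' (h, i) (h \<otimes> \<theta> f, j) = \<rho> (\<one>\<^bsub>K\<^esub>, i) (f, j)"
    if "h \<in> H" "f \<in> F" for h f i j
  proof -
    have "h \<in> carrier G" "\<theta> f \<in> carrier G"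
      using that \<theta>_in H_carrier by auto
    then have "inv h \<otimes> (h \<otimes> \<theta> f) = \<theta> f"
      by (simp add: m_assoc[symmetric])
    then show "R (h, i) (h \<otimes> \<theta> f, j)" "\<rho>' (h, i) (h \<otimes> \<theta> f, j) = \<rho> (\<one>\<^bsub>K\<^esub>, i) (f, j)"
      using that by (auto simp: R_def \<rho>'_def)
  qed
  have cancel: "h \<otimes> \<theta> f \<otimes> inv (\<theta> f) = h" "h \<otimes> \<theta> f \<otimes> \<theta> g = h \<otimes> \<theta> (f \<otimes>\<^bsub>K\<^esub> g)" "h \<otimes> \<theta> f \<in> H"
    "h \<otimes> \<theta> f = h \<longleftrightarrow> f = \<one>\<^bsub>K\<^esub>"
    if "h \<in> H" "f \<in> F" "g \<in> F" for h f g
  proof -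
    have *: "h \<in> carrier G" "\<theta> f \<in> carrier G" "\<theta> g \<in> carrier G"
      using that \<theta>_in H_carrier by auto
    then show "h \<otimes> \<theta> f \<otimes> inv (\<theta> f) = h" "h \<otimes> \<theta> f \<otimes> \<theta> g = h \<otimes> \<theta> (f \<otimes>\<^bsub>K\<^esub> g)"
      using that \<theta>_mult by (simp_all add: m_assoc)
    show "h \<otimes> \<theta> f \<in> H"
      using that \<theta>_in by simp
    have "h \<otimes> \<theta> f = h \<longleftrightarrow> \<theta> f = \<theta> \<one>\<^bsub>K\<^esub>"
      using * \<theta>_one by simp
    then show "h \<otimes> \<theta> f = h \<longleftrightarrow> f = \<one>\<^bsub>K\<^esub>"
      using \<theta>_inj that by (metis F.one_closed inj_on_eq_iff)
  qed
  have \<rho>'_eq: "\<rho>' x y = \<rho> (\<one>\<^bsub>K\<^esub>, snd x) (f, snd y)" if "x \<in> X" "f \<in> F" "fst y = fst x \<otimes> \<theta> f" for x y f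
    using rel(2)[of "fst x" f "snd x" "snd y"] that by (cases x; cases y) (auto simp: X_def)
  interpret gluing X R \<rho>' Y \<delta> "\<lambda>x. x" e
  proof
    show "finite X"
      using H by (simp add: X_def)
    show "R x x" if "x \<in> X" for x
      using rel(1)[of "fst x" "\<one>\<^bsub>K\<^esub>" "snd x" "snd x"] that \<theta>_one H_carrier by (auto simp: X_def)
    show "R y x" if xy: "x \<in> X" "y \<in> X" "R x y" for x y
    proof -
      obtain f where f: "f \<in> F" "fst y = fst x \<otimes> \<theta> f"
        using obt[OF xy] by blast
      then show ?thesis
        using rel(1)[of "fst y" "inv\<^bsub>K\<^esub> f" "snd y" "snd x"] xy cancel(1)[of "fst x" f f] \<theta>_inv[of f]
        by (auto simp: X_def)
    qed
    show "R x z" if xyz: "x \<in> X" "y \<in> X" "z \<in> X" "R x y" "R y z" for x y z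
    proof -
      obtain f g where f: "f \<in> F" "fst y = fst x \<otimes> \<theta> f" and g: "g \<in> F" "fst z = fst y \<otimes> \<theta> g"
        using obt[OF xyz(1,2,4)] obt[OF xyz(2,3,5)] by blast
      then show ?thesis
        using rel(1)[of "fst x" "f \<otimes>\<^bsub>K\<^esub> g" "snd x" "snd z"] xyz cancel(2)[of "fst x" f g]
        by (auto simp: X_def)
    qed
    show "\<rho>' x y = 0 \<longleftrightarrow> x = y" if xy: "x \<in> X" "y \<in> X" "R x y" for x y
    proof -
      obtain f where f: "f \<in> F" "fst y = fst x \<otimes> \<theta> f"
        using obt[OF xy] by blast
      have "\<rho>' x y = \<rho> (\<one>\<^bsub>K\<^esub>, snd x) (f, snd y)"
        using \<rho>'_eq f xy by blast
      then have "\<rho>' x y = 0 \<longleftrightarrow> (\<one>\<^bsub>K\<^esub>, snd x) = (f, snd y)"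
        using int_metric_zero[OF \<rho>_metric, of "(\<one>\<^bsub>K\<^esub>, snd x)" "(f, snd y)"] f xy by (auto simp: X_def)
      then show ?thesis
        using cancel(4)[of "fst x" f f] f xy by (auto simp: X_def prod_eq_iff)
    qed
    show "\<rho>' x y = \<rho>' y x" if xy: "x \<in> X" "y \<in> X" "R x y" for x y
    proof -
      obtain f where f: "f \<in> F" "fst y = fst x \<otimes> \<theta> f"
        using obt[OF xy] by blast
      have "\<rho>' x y = \<rho> (\<one>\<^bsub>K\<^esub>, snd x) (f, snd y)"
        using \<rho>'_eq f xy by blast
      also have "\<dots> = \<rho> (inv\<^bsub>K\<^esub> f \<otimes>\<^bsub>K\<^esub> \<one>\<^bsub>K\<^esub>, snd x) (inv\<^bsub>K\<^esub> f \<otimes>\<^bsub>K\<^esub> f, snd y)"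
        using \<rho>_inv[of "inv\<^bsub>K\<^esub> f" "\<one>\<^bsub>K\<^esub>" f "snd x" "snd y"] f xy by (auto simp: X_def)
      also have "\<dots> = \<rho> (\<one>\<^bsub>K\<^esub>, snd y) (inv\<^bsub>K\<^esub> f, snd x)"
        using int_metric_sym[OF \<rho>_metric, of "(inv\<^bsub>K\<^esub> f, snd x)" "(\<one>\<^bsub>K\<^esub>, snd y)"] f xy
        by (auto simp: X_def)
      also have "\<dots> = \<rho>' y x"
        using rel(2)[of "fst y" "inv\<^bsub>K\<^esub> f" "snd y" "snd x"] f xy cancel(1)[of "fst x" f f] \<theta>_inv[of f]
        by (cases x; cases y) (auto simp: X_def)
      finally show ?thesis .
    qed
    show "\<rho>' x z \<le> \<rho>' x y + \<rho>' y z" if xyz: "x \<in> X" "y \<in> X" "z \<in> X" "R x y" "R y z" for x y z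
    proof -
      obtain f g where f: "f \<in> F" "fst y = fst x \<otimes> \<theta> f" and g: "g \<in> F" "fst z = fst y \<otimes> \<theta> g"
        using obt[OF xyz(1,2,4)] obt[OF xyz(2,3,5)] by blast
      have "\<rho>' x y = \<rho> (\<one>\<^bsub>K\<^esub>, snd x) (f, snd y)"
        using \<rho>'_eq f xyz by blast
      moreover have "\<rho>' y z = \<rho> (\<one>\<^bsub>K\<^esub>, snd y) (g, snd z)"
        using \<rho>'_eq g xyz by blast
      moreover have "\<dots> = \<rho> (f, snd y) (f \<otimes>\<^bsub>K\<^esub> g, snd z)"
        using \<rho>_inv[of f "\<one>\<^bsub>K\<^esub>" g "snd y" "snd z"] f g xyz by (auto simp: X_def)
      moreover have "\<rho>' x z = \<rho> (\<one>\<^bsub>K\<^esub>, snd x) (f \<otimes>\<^bsub>K\<^esub> g, snd z)"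
        using rel(2)[of "fst x" "f \<otimes>\<^bsub>K\<^esub> g" "snd x" "snd z"] f g xyz cancel(2)[of "fst x" f g]
        by (cases x; cases z) (auto simp: X_def)
      ultimately show ?thesis
        using int_metric_triangle[OF \<rho>_metric, of "(\<one>\<^bsub>K\<^esub>, snd x)" "(f, snd y)" "(f \<otimes>\<^bsub>K\<^esub> g, snd z)"] f g xyz
        by (auto simp: X_def)
    qed
    show "int_metric Y \<delta>"
      using \<delta>_metric by (simp add: Y_def)
    show "x \<in> Y" if "x \<in> X" for x
      using that nm by (auto simp: X_def Y_def)
    show "\<bar>\<rho>' x y - \<delta> x y\<bar> \<le> 2 * e" if xy: "x \<in> X" "y \<in> X" "R x y" for x y
    proof -
      obtain f where f: "f \<in> F" "fst y = fst x \<otimes> \<theta> f"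
        using obt[OF xy] by blast
      have "\<rho>' x y = \<rho> (\<one>\<^bsub>K\<^esub>, snd x) (f, snd y)"
        using \<rho>'_eq f xy by blast
      moreover have "\<delta> x y = \<delta> (\<theta> \<one>\<^bsub>K\<^esub>, snd x) (\<theta> f, snd y)"
        using \<delta>_inv[of "fst x" \<one> "\<theta> f" "snd x" "snd y"] f xy nm \<theta>_one \<theta>_in H_carrier
        by (cases x; cases y) (auto simp: X_def)
      ultimately show ?thesis
        using close[of "\<one>\<^bsub>K\<^esub>" f "snd x" "snd y"] f xy by (auto simp: X_def)
    qed
    show "1 \<le> e" by (rule e)
  qed
  define J where "J = (\<lambda>(h :: 'a, i). if i < n then Inl (h, i) else Inr (h, i - n))"
  define D where "D = (\<lambda>p q. glued (J p) (J q))"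
  have J_in: "J ` (H \<times> {..<n + m}) \<subseteq> Z"
    by (auto simp: J_def X_def Y_def)
  have "inj_on J (H \<times> {..<n + m})"
    by (rule inj_onI) (auto simp: J_def split: if_splits)
  then have D_metric: "int_metric (H \<times> {..<n + m}) D"
    unfolding D_def using J_in by (intro int_metric_vimage[OF glued_metric])
  have D_le: "D (g \<otimes> h, i) (g \<otimes> k, j) \<le> D (h, i) (k, j)"
    if that': "g \<in> H" "h \<in> H" "k \<in> H" "i < n + m" "j < n + m" for g h k i j
  proof -
    define s where "s = map_prod (\<lambda>h. g \<otimes> h) (\<lambda>i :: nat. i)"
    have J_s: "J (g \<otimes> h, i) = map_sum s s (J (h, i))" for h i
      by (simp add: J_def s_def)
    have s_inv: "inv (fst (s x)) \<otimes> fst (s y) = inv (fst x) \<otimes> fst y" "snd (s x) = snd x"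
      if "x \<in> X" "y \<in> X" for x y
    proof -
      have *: "g \<in> carrier G" "fst x \<in> carrier G" "fst y \<in> carrier G"
        using that that' H_carrier by (auto simp: X_def)
      then have "inv (g \<otimes> fst x) \<otimes> (g \<otimes> fst y) = inv (fst x) \<otimes> (inv g \<otimes> (g \<otimes> fst y))"
        by (simp add: inv_mult_group m_assoc)
      also have "inv g \<otimes> (g \<otimes> fst y) = fst y"
        using * by (simp add: m_assoc[symmetric])
      finally show "inv (fst (s x)) \<otimes> fst (s y) = inv (fst x) \<otimes> fst y"
        by (simp add: s_def)
    qed (simp add: s_def)
    have "glued (map_sum s s (J (h, i))) (map_sum s s (J (k, j))) \<le> glued (J (h, i)) (J (k, j))"
    proof (rule glued_mono)
      show "s ` X \<subseteq> X" "s ` Y \<subseteq> Y"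
        using that by (auto simp: s_def X_def Y_def)
      show "R (s x) (s y) \<and> \<rho>' (s x) (s y) = \<rho>' x y" if "x \<in> X" "y \<in> X" "R x y" for x y
        using that s_inv by (simp add: R_def \<rho>'_def s_def)
      show "\<delta> (s x) (s y) = \<delta> x y" if "x \<in> Y" "y \<in> Y" for x y
        using that that' \<delta>_inv by (auto simp: s_def Y_def)
      show "J (h, i) \<in> Z" "J (k, j) \<in> Z"
        using J_in that by auto
    qed simp
    then show ?thesis
      by (simp add: D_def J_s)
  qed
  have "D (g \<otimes> h, i) (g \<otimes> k, j) = D (h, i) (k, j)"
    if ghk: "g \<in> H" "h \<in> H" "k \<in> H" "i < n + m" "j < n + m" for g h k i j
  proof (rule antisym[OF D_le[OF ghk]])
    have *: "g \<in> carrier G" "h \<in> carrier G" "k \<in> carrier G"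
      using ghk H_carrier by auto
    then have "inv g \<otimes> (g \<otimes> h) = h" "inv g \<otimes> (g \<otimes> k) = k"
      by (simp_all add: m_assoc[symmetric])
    then show "D (h, i) (k, j) \<le> D (g \<otimes> h, i) (g \<otimes> k, j)"
      using D_le[of "inv g" "g \<otimes> h" "g \<otimes> k" i j] ghk by simp
  qed
  with D_metric have inv: "invariant_metric G H (n + m) D"
    by (auto simp: invariant_metric_def)
  show thesis
  proof (rule that[OF inv])
    show "D (\<theta> f, i) (\<theta> k, j) = \<rho> (f, i) (k, j)" if "f \<in> F" "k \<in> F" "i < n" "j < n" for f k i j
    proof -
      define g where "g = inv\<^bsub>K\<^esub> f \<otimes>\<^bsub>K\<^esub> k"
      have "f \<in> carrier K" "k \<in> carrier K"
        using that F.subset by auto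
      then have g: "g \<in> F" "k = f \<otimes>\<^bsub>K\<^esub> g"
        using that by (simp_all add: g_def K.m_assoc[symmetric])
      have k: "\<theta> k = \<theta> f \<otimes> \<theta> g"
        using \<theta>_mult g that by simp
      have "D (\<theta> f, i) (\<theta> k, j) = glued (Inl (\<theta> f, i)) (Inl (\<theta> k, j))"
        using that by (simp add: D_def J_def)
      also have "\<dots> = \<rho>' (\<theta> f, i) (\<theta> k, j)"
        by (rule glued_left) (use that \<theta>_in \<open>g \<in> F\<close> rel(1)[of "\<theta> f" g i j] in \<open>simp_all add: X_def k[symmetric]\<close>)
      also have "\<dots> = \<rho> (\<one>\<^bsub>K\<^esub>, i) (g, j)"
        using that \<theta>_in g rel(2)[of "\<theta> f" g i j] k by simp
      also have "\<dots> = \<rho> (f, i) (k, j)"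
        using \<rho>_inv[of f "\<one>\<^bsub>K\<^esub>" g i j] that g F.subset by auto
      finally show ?thesis .
    qed
    show "D (h, n + i) (k, n + j) = \<delta> (h, i) (k, j)" if "h \<in> H" "k \<in> H" "i < m" "j < m" for h k i j
      using that glued_right[of "(h, i)" "(k, j)"] by (simp add: D_def J_def Y_def)
    show "D (h, i) (h, n + i) \<le> e" if "h \<in> H" "i < n" for h i
      using that glued_link[of "(h, i)"] by (simp add: D_def J_def X_def)
  qed
qed

section \<open>Pointed free actions\<close>

lemma group_actionI:
  assumes G: "group G"
    and ext: "\<And>g. g \<in> carrier G \<Longrightarrow> a g \<in> extensional E"
    and closed: "\<And>g x. \<lbrakk>g \<in> carrier G; x \<in> E\<rbrakk> \<Longrightarrow> a g x \<in> E"
    and one: "\<And>x. x \<in> E \<Longrightarrow> a \<one>\<^bsub>G\<^esub> x = x"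
    and mult: "\<And>g h x. \<lbrakk>g \<in> carrier G; h \<in> carrier G; x \<in> E\<rbrakk> \<Longrightarrow> a (g \<otimes>\<^bsub>G\<^esub> h) x = a g (a h x)"
  shows "group_action G E a"
proof -
  interpret G: group G by (rule G)
  have bij: "a g \<in> Bij E" if g: "g \<in> carrier G" for g
  proof -
    have "bij_betw (a g) E E"
    proof (rule bij_betw_byWitness[where f' = "a (inv\<^bsub>G\<^esub> g)"])
      show "\<forall>x\<in>E. a (inv\<^bsub>G\<^esub> g) (a g x) = x"
        using mult[of "inv\<^bsub>G\<^esub> g" g] one g by simp
      show "\<forall>x\<in>E. a g (a (inv\<^bsub>G\<^esub> g) x) = x"
        using mult[of g "inv\<^bsub>G\<^esub> g"] one g by simp
    qed (use closed g in auto)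
    with ext[OF g] show ?thesis
      by (simp add: Bij_def)
  qed
  have "a (g \<otimes>\<^bsub>G\<^esub> h) = compose E (a g) (a h)" if "g \<in> carrier G" "h \<in> carrier G" for g h
  proof (rule extensionalityI)
    show "a (g \<otimes>\<^bsub>G\<^esub> h) \<in> extensional E"
      using ext that by simp
  qed (use mult that in \<open>simp_all add: compose_eq\<close>)
  then have "a \<in> hom G (BijGroup E)"
    using bij by (auto simp: hom_def BijGroup_def)
  then show ?thesis
    by (simp add: group_action_def group_hom_def group_hom_axioms_def G group_BijGroup)
qed

text \<open>The standard model of a pointed free action, with points coded as numbers because the
  class is quantified over members carried by \<open>nat\<close>. The distance is 0 off the points
  because \<open>Metric_space\<close> asks for nonnegativity and symmetry everywhere, and the action
  is restricted because \<open>group_action\<close> works with extensional maps.\<close>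

definition translation_action ::
    "nat monoid \<Rightarrow> nat \<Rightarrow> (nat \<times> nat \<Rightarrow> nat \<times> nat \<Rightarrow> int) \<Rightarrow> nat \<Rightarrow> (nat, nat) pointed_action" where
  "translation_action K n d N =
     \<lparr>grp = K,
      pts = prod_encode ` (carrier K \<times> {..<n}),
      met = (\<lambda>x y. if x \<in> prod_encode ` (carrier K \<times> {..<n}) \<and> y \<in> prod_encode ` (carrier K \<times> {..<n})
               then of_int (d (prod_decode x) (prod_decode y)) / of_nat N else 0),
      act = (\<lambda>g. \<lambda>x\<in>prod_encode ` (carrier K \<times> {..<n}).
               case prod_decode x of (h, i) \<Rightarrow> prod_encode (g \<otimes>\<^bsub>K\<^esub> h, i)),
      base = (\<lambda>i. prod_encode (\<one>\<^bsub>K\<^esub>, i)) ` {..<n}\<rparr>"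

lemma prod_encode_mem [simp]: "prod_encode p \<in> prod_encode ` S \<longleftrightarrow> p \<in> S"
  by (rule inj_image_mem_iff[OF inj_prod_encode])

lemma translation_action_simps [simp]:
  "grp (translation_action K n d N) = K"
  "pts (translation_action K n d N) = prod_encode ` (carrier K \<times> {..<n})"
  "base (translation_action K n d N) = (\<lambda>i. prod_encode (\<one>\<^bsub>K\<^esub>, i)) ` {..<n}"
  "\<lbrakk>h \<in> carrier K; k \<in> carrier K; i < n; j < n\<rbrakk>
    \<Longrightarrow> met (translation_action K n d N) (prod_encode (h, i)) (prod_encode (k, j)) = d (h, i) (k, j) / N"
  "\<lbrakk>h \<in> carrier K; i < n\<rbrakk>
    \<Longrightarrow> act (translation_action K n d N) g (prod_encode (h, i)) = prod_encode (g \<otimes>\<^bsub>K\<^esub> h, i)"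
  by (simp_all add: translation_action_def)

lemma translation_action_ptsE:
  assumes "x \<in> pts (translation_action K n d N)"
  obtains h i where "h \<in> carrier K" "i < n" "x = prod_encode (h, i)"
  using assms unfolding translation_action_simps(2) by blast

lemma translation_action_finite_rational:
  assumes K: "group K" "finite (carrier K)" and nN: "0 < n" "0 < N"
    and d: "invariant_metric K (carrier K) n d"
  shows "finite_rational_action (translation_action K n d N)"
proof -
  interpret K: group K by (rule K)
  let ?A = "translation_action K n d N"
  let ?P = "carrier K \<times> {..<n}"
  have d_metric: "int_metric ?P d"
    and d_inv: "\<And>g h k i j. \<lbrakk>g \<in> carrier K; h \<in> carrier K; k \<in> carrier K; i < n; j < n\<rbrakk>
      \<Longrightarrow> d (g \<otimes>\<^bsub>K\<^esub> h, i) (g \<otimes>\<^bsub>K\<^esub> k, j) = d (h, i) (k, j)"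
    using d by (auto simp: invariant_metric_def)
  have met: "met ?A (prod_encode p) (prod_encode q) = d p q / N" if "p \<in> ?P" "q \<in> ?P" for p q
    using that by (cases p; cases q) simp
  have metric: "Metric_space (pts ?A) (met ?A)"
  proof
    show "0 \<le> met ?A x y" "met ?A x y = met ?A y x" for x y
    proof -
      have "0 \<le> met ?A x y \<and> met ?A x y = met ?A y x"
      proof (cases "x \<in> pts ?A \<and> y \<in> pts ?A")
        case True
        then obtain p q where "p \<in> ?P" "q \<in> ?P" "x = prod_encode p" "y = prod_encode q"
          unfolding translation_action_simps(2) by blast
        then show ?thesis
          using met int_metric_nonneg[OF d_metric, of p q] int_metric_sym[OF d_metric, of p q] by simp
      next
        case False
        then show ?thesis
          unfolding translation_action_def by auto
      qed
      then show "0 \<le> met ?A x y" "met ?A x y = met ?A y x"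
        by blast+
    qed
    show "met ?A x y = 0 \<longleftrightarrow> x = y" if "x \<in> pts ?A" "y \<in> pts ?A" for x y
    proof -
      obtain p q where "p \<in> ?P" "q \<in> ?P" "x = prod_encode p" "y = prod_encode q"
        using \<open>x \<in> pts ?A\<close> \<open>y \<in> pts ?A\<close> unfolding translation_action_simps(2) by blast
      then show ?thesis
        using met int_metric_zero[OF d_metric, of p q] nN by simp
    qed
    show "met ?A x z \<le> met ?A x y + met ?A y z" if "x \<in> pts ?A" "y \<in> pts ?A" "z \<in> pts ?A" for x y z
    proof -
      obtain p q r where pqr: "p \<in> ?P" "q \<in> ?P" "r \<in> ?P"
        "x = prod_encode p" "y = prod_encode q" "z = prod_encode r"
        using \<open>x \<in> pts ?A\<close> \<open>y \<in> pts ?A\<close> \<open>z \<in> pts ?A\<close> unfolding translation_action_simps(2) by blast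
      then have "d p r / N \<le> (d p q + d q r) / N"
        using int_metric_triangle[OF d_metric, of p q r] by (intro divide_right_mono) auto
      with pqr met show ?thesis
        by (simp add: add_divide_distrib)
    qed
  qed
  have act: "group_action K (pts ?A) (act ?A)"
  proof (rule group_actionI[OF K(1)])
    show "act ?A g \<in> extensional (pts ?A)" for g
      by (simp add: translation_action_def)
    show "act ?A g x \<in> pts ?A" if "g \<in> carrier K" "x \<in> pts ?A" for g x
      using that by (elim translation_action_ptsE) simp
    show "act ?A \<one>\<^bsub>K\<^esub> x = x" if "x \<in> pts ?A" for x
      using that by (elim translation_action_ptsE) simp
    show "act ?A (g \<otimes>\<^bsub>K\<^esub> h) x = act ?A g (act ?A h x)"
      if "g \<in> carrier K" "h \<in> carrier K" "x \<in> pts ?A" for g h x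
      using that by (elim translation_action_ptsE) (simp add: K.m_assoc)
  qed
  have base_unique: "\<exists>!p. p \<in> base ?A \<and> p \<in> orbit (grp ?A) (act ?A) x" if x: "x \<in> pts ?A" for x
  proof -
    obtain h i where hi: "h \<in> carrier K" "i < n" "x = prod_encode (h, i)"
      using x unfolding translation_action_simps(2) by blast
    show ?thesis
    proof (rule ex1I[of _ "prod_encode (\<one>\<^bsub>K\<^esub>, i)"])
      show "prod_encode (\<one>\<^bsub>K\<^esub>, i) \<in> base ?A \<and> prod_encode (\<one>\<^bsub>K\<^esub>, i) \<in> orbit (grp ?A) (act ?A) x"
      proof
        have "prod_encode (\<one>\<^bsub>K\<^esub>, i) = act ?A (inv\<^bsub>K\<^esub> h) x"
          using hi by simp
        then show "prod_encode (\<one>\<^bsub>K\<^esub>, i) \<in> orbit (grp ?A) (act ?A) x"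
          using hi unfolding orbit_def translation_action_simps(1) by blast
      qed (use hi in simp)
      show "p = prod_encode (\<one>\<^bsub>K\<^esub>, i)" if "p \<in> base ?A \<and> p \<in> orbit (grp ?A) (act ?A) x" for p
      proof -
        obtain g j where "g \<in> carrier K" "p = act ?A g x" "p = prod_encode (\<one>\<^bsub>K\<^esub>, j)"
          using \<open>p \<in> base ?A \<and> p \<in> orbit (grp ?A) (act ?A) x\<close>
          unfolding orbit_def translation_action_simps(1,3) by blast
        with hi show ?thesis
          by simp
      qed
    qed
  qed
  have isometric: "met ?A (act ?A g x) (act ?A g y) = met ?A x y"
    if "g \<in> carrier K" "x \<in> pts ?A" "y \<in> pts ?A" for g x y
    using that d_inv by (elim translation_action_ptsE) simp
  have free: "g = \<one>\<^bsub>K\<^esub>" if "g \<in> carrier K" "x \<in> pts ?A" "act ?A g x = x" for g x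
    using that by (elim translation_action_ptsE) simp
  have base: "base ?A \<subseteq> pts ?A"
    by auto
  have "pointed_free_action ?A"
    unfolding pointed_free_action_def translation_action_simps(1)
    by (intro conjI ballI impI metric act base isometric free base_unique[unfolded translation_action_simps(1)])
  moreover have "finite_rational_metric (pts ?A) (met ?A)"
    unfolding finite_rational_metric_def
  proof (intro conjI ballI metric)
    show "met ?A x y \<in> \<rat>" for x y
      unfolding translation_action_def by simp
    show "finite (pts ?A)"
      using K by simp
  qed
  moreover have "pts ?A \<noteq> {}"
    using nN by auto
  ultimately show ?thesis
    using K(2) by (simp add: finite_rational_action_def)
qed

text \<open>This makes finite subgroups of an arbitrary group available to the extension property,
  which speaks of groups on \<open>nat\<close>.\<close>

lemma finite_group_nat_copy:
  assumes "group H" "finite (carrier H)"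
  obtains K :: "nat monoid" and c where "group K" "finite (carrier K)" "c \<in> mon H K" "c ` carrier H = carrier K"
proof -
  interpret H: group H by (rule assms)
  define c where "c = to_nat_on (carrier H)"
  define ci where "ci = from_nat_into (carrier H)"
  have cnt: "countable (carrier H)"
    using assms(2) by (rule countable_finite)
  have ci: "ci (c x) = x" if "x \<in> carrier H" for x
    using that cnt by (simp add: c_def ci_def)
  define K :: "nat monoid" where
    "K = \<lparr>carrier = c ` carrier H, mult = (\<lambda>x y. c (ci x \<otimes>\<^bsub>H\<^esub> ci y)), one = c \<one>\<^bsub>H\<^esub>\<rparr>"
  have "group K"
  proof (rule groupI)
    show "\<exists>y\<in>carrier K. y \<otimes>\<^bsub>K\<^esub> x = \<one>\<^bsub>K\<^esub>" if "x \<in> carrier K" for x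
    proof -
      obtain a where a: "a \<in> carrier H" "x = c a"
        using \<open>x \<in> carrier K\<close> by (auto simp: K_def)
      then have "c (inv\<^bsub>H\<^esub> a) \<in> carrier K" "c (inv\<^bsub>H\<^esub> a) \<otimes>\<^bsub>K\<^esub> x = \<one>\<^bsub>K\<^esub>"
        by (auto simp: K_def ci)
      then show ?thesis
        by blast
    qed
  qed (auto simp: K_def ci H.m_assoc)
  moreover have "finite (carrier K)" "c ` carrier H = carrier K"
    using assms(2) by (simp_all add: K_def)
  moreover have "c \<in> mon H K"
  proof (rule monI)
    show "inj_on c (carrier H)"
      using ci by (rule inj_on_inverseI)
  qed (simp_all add: K_def ci)
  ultimately show thesis
    by (intro that)
qed

text \<open>This is the extension property of \<open>L\<close> in coordinates. The hypothesis
  \<open>dist\<close> says that \<open>\<eta>\<close> and \<open>b\<close> embed into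
  \<open>L\<close> the metric that \<open>D\<close> induces, via \<open>\<theta>\<close>, on
  \<open>n\<close> copies of \<open>F\<close>; the same small action embeds into the action of
  \<open>H\<close> with metric \<open>D\<close>, which is therefore realized over it. Members of the
  class have a point, hence \<open>0 < n\<close>.\<close>

lemma fraisse_extension:
  fixes L :: "('h, 'x) pointed_action" and G :: "('g, 'b) monoid_scheme"
  assumes L: "action_fraisse_limit L" and G: "group G"
    and H: "subgroup H G" "finite H" and F: "subgroup F G" "finite F"
    and \<theta>: "\<theta> \<in> mon (G\<lparr>carrier := F\<rparr>) (G\<lparr>carrier := H\<rparr>)"
    and \<eta>: "\<eta> \<in> mon (G\<lparr>carrier := F\<rparr>) (grp L)"
    and nr: "0 < n" "n \<le> r" and N: "0 < N" and D: "invariant_metric G H r D"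
    and b: "\<And>i. i < n \<Longrightarrow> b i \<in> base L"
    and dist: "\<And>f k i j. \<lbrakk>f \<in> F; k \<in> F; i < n; j < n\<rbrakk>
      \<Longrightarrow> met L (act L (\<eta> f) (b i)) (act L (\<eta> k) (b j)) = D (\<theta> f, i) (\<theta> k, j) / real N"
  obtains \<phi> b' where "\<phi> \<in> mon (G\<lparr>carrier := H\<rparr>) (grp L)"
    and "\<And>f. f \<in> F \<Longrightarrow> \<phi> (\<theta> f) = \<eta> f" "\<And>i. i < n \<Longrightarrow> b' i = b i"
    and "\<And>i. i < r \<Longrightarrow> b' i \<in> base L" "inj_on b' {..<r}"
    and "\<And>h k i j. \<lbrakk>h \<in> H; k \<in> H; i < r; j < r\<rbrakk>
      \<Longrightarrow> met L (act L (\<phi> h) (b' i)) (act L (\<phi> k) (b' j)) = D (h, i) (k, j) / real N"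
proof -
  interpret G: group G by (rule G)
  interpret H: subgroup H G by (rule H)
  interpret F: subgroup F G by (rule F)
  have L_free: "pointed_free_action L"
    using L unfolding action_fraisse_limit_def by blast
  interpret L: group_action "grp L" "pts L" "act L"
    using L_free unfolding pointed_free_action_def by blast
  have L_group: "group (grp L)"
    using L.group_hom by (simp add: group_hom_def)
  have base_pts: "x \<in> pts L" if "x \<in> base L" for x
    using L_free that unfolding pointed_free_action_def by blast
  have grpH: "group (G\<lparr>carrier := H\<rparr>)" and grpF: "group (G\<lparr>carrier := F\<rparr>)"
    using H F by (simp_all add: G.subgroup_imp_group)
  obtain KF :: "nat monoid" and cF where KF: "group KF" "finite (carrier KF)"
    and cF: "cF \<in> mon (G\<lparr>carrier := F\<rparr>) KF" "cF ` F = carrier KF"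
    using F(2) by (rule finite_group_nat_copy[OF grpF, simplified])
  obtain KH :: "nat monoid" and cH where KH: "group KH" "finite (carrier KH)"
    and cH: "cH \<in> mon (G\<lparr>carrier := H\<rparr>) KH" "cH ` H = carrier KH"
    using H(2) by (rule finite_group_nat_copy[OF grpH, simplified])
  define dF where "dF = inv_into F cF"
  define dH where "dH = inv_into H cH"
  have dF: "dF \<in> mon KF (G\<lparr>carrier := F\<rparr>)"
    using mon_inv_into[OF cF(1) grpF] cF(2) by (simp add: dF_def)
  have dH: "dH \<in> mon KH (G\<lparr>carrier := H\<rparr>)"
    using mon_inv_into[OF cH(1) grpH] cH(2) by (simp add: dH_def)
  have dF_cF: "dF (cF f) = f" if "f \<in> F" for f
    using monD(3)[OF cF(1)] that by (simp add: dF_def)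
  have dH_cH: "dH (cH h) = h" if "h \<in> H" for h
    using monD(3)[OF cH(1)] that by (simp add: dH_def)
  have dF_in: "dF a \<in> F" "cF (dF a) = a" if "a \<in> carrier KF" for a
    using monD(1)[OF dF] that cF(2) f_inv_into_f[of a cF F] by (simp_all add: dF_def)
  have dH_in: "dH a \<in> H" "cH (dH a) = a" if "a \<in> carrier KH" for a
    using monD(1)[OF dH] that cH(2) f_inv_into_f[of a cH H] by (simp_all add: dH_def)
  define \<theta>K where "\<theta>K = cH \<circ> (\<theta> \<circ> dF)"
  define \<eta>K where "\<eta>K = \<eta> \<circ> dF"
  have \<theta>K: "\<theta>K \<in> mon KF KH" and \<eta>K: "\<eta>K \<in> mon KF (grp L)"
    unfolding \<theta>K_def \<eta>K_def by (intro mon_compose[OF mon_compose[OF dF \<theta>] cH(1)] mon_compose[OF dF \<eta>])+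
  have dH_\<theta>K: "dH (\<theta>K a) = \<theta> (dF a)" if "a \<in> carrier KF" for a
    using dH_cH monD(1)[OF \<theta>] dF_in that by (simp add: \<theta>K_def)
  define DH where "DH = (\<lambda>p q. D (map_prod dH (\<lambda>i :: nat. i) p) (map_prod dH (\<lambda>i. i) q))"
  have DH: "invariant_metric KH (carrier KH) r DH"
    unfolding invariant_metric_def
  proof (intro conjI ballI allI impI)
    show "int_metric (carrier KH \<times> {..<r}) DH"
      unfolding DH_def
    proof (rule int_metric_vimage)
      show "int_metric (H \<times> {..<r}) D"
        using D by (simp add: invariant_metric_def)
      show "map_prod dH (\<lambda>i. i) ` (carrier KH \<times> {..<r}) \<subseteq> H \<times> {..<r}"
        using dH_in(1) by (auto simp: map_prod_def)
      show "inj_on (map_prod dH (\<lambda>i. i)) (carrier KH \<times> {..<r})"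
        using monD(3)[OF dH] by (intro map_prod_inj_on) simp_all
    qed
    show "DH (g \<otimes>\<^bsub>KH\<^esub> h, i) (g \<otimes>\<^bsub>KH\<^esub> k, j) = DH (h, i) (k, j)"
      if "g \<in> carrier KH" "h \<in> carrier KH" "k \<in> carrier KH" "i < r" "j < r" for g h k i j
      using D that dH_in monD(2)[OF dH] by (simp add: DH_def invariant_metric_def)
  qed
  \<comment> \<open>\<open>DF\<close> is pulled back along \<open>\<theta>K\<close>, so that
    \<open>\<psi>B\<close> is isometric by construction; that \<open>\<psi>L\<close> is isometric is
    the hypothesis \<open>dist\<close>.\<close>
  define DF where "DF = (\<lambda>p q. DH (map_prod \<theta>K (\<lambda>i :: nat. i) p) (map_prod \<theta>K (\<lambda>i. i) q))"
  have DF: "invariant_metric KF (carrier KF) n DF"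
    unfolding invariant_metric_def
  proof (intro conjI ballI allI impI)
    show "int_metric (carrier KF \<times> {..<n}) DF"
      unfolding DF_def
    proof (rule int_metric_vimage)
      show "int_metric (carrier KH \<times> {..<r}) DH"
        using DH by (simp add: invariant_metric_def)
      show "map_prod \<theta>K (\<lambda>i. i) ` (carrier KF \<times> {..<n}) \<subseteq> carrier KH \<times> {..<r}"
        using monD(1)[OF \<theta>K] nr by auto
      show "inj_on (map_prod \<theta>K (\<lambda>i. i)) (carrier KF \<times> {..<n})"
        using monD(3)[OF \<theta>K] by (intro map_prod_inj_on) simp_all
    qed
    show "DF (g \<otimes>\<^bsub>KF\<^esub> h, i) (g \<otimes>\<^bsub>KF\<^esub> k, j) = DF (h, i) (k, j)"
      if "g \<in> carrier KF" "h \<in> carrier KF" "k \<in> carrier KF" "i < n" "j < n" for g h k i j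
      using DH that nr monD(1,2)[OF \<theta>K] by (simp add: DF_def invariant_metric_def)
  qed
  define A where "A = translation_action KF n DF N"
  define B where "B = translation_action KH r DH N"
  have A: "finite_rational_action A" and B: "finite_rational_action B"
    unfolding A_def B_def
    using translation_action_finite_rational[OF KF _ N DF] translation_action_finite_rational[OF KH _ N DH] nr
    by simp_all
  define \<psi>L where "\<psi>L = (\<lambda>x. case prod_decode x of (a, i) \<Rightarrow> act L (\<eta>K a) (b i))"
  define \<psi>B where "\<psi>B = (\<lambda>x. case prod_decode x of (a, i) \<Rightarrow> prod_encode (\<theta>K a, i))"
  have L_one: "act L \<one>\<^bsub>grp L\<^esub> x = x" if "x \<in> pts L" for x
    using that fun_cong[OF L.id_eq_one, of x] by simp
  let ?A = "translation_action KF n DF N" and ?B = "translation_action KH r DH N"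
  have AL: "action_embedding A L \<eta>K \<psi>L"
    unfolding action_embedding_def isometric_embedding_def A_def
  proof (intro conjI ballI)
    show "\<eta>K \<in> mon (grp ?A) (grp L)"
      using \<eta>K by simp
    show "\<psi>L ` pts ?A \<subseteq> pts L"
    proof (intro image_subsetI, elim translation_action_ptsE)
      fix x h i assume "h \<in> carrier KF" "i < n" "x = prod_encode (h, i)"
      then show "\<psi>L x \<in> pts L"
        using L.element_image[OF monD(1)[OF \<eta>K] base_pts[OF b] refl] by (simp add: \<psi>L_def)
    qed
    show "\<psi>L ` base ?A \<subseteq> base L"
      using mon_one[OF \<eta>K KF(1) L_group] base_pts b L_one by (auto simp: \<psi>L_def)
    show "met L (\<psi>L x) (\<psi>L y) = met ?A x y"
      if "x \<in> pts ?A" "y \<in> pts ?A" for x y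
      using that by (elim translation_action_ptsE)
        (use dist dF_in dH_\<theta>K in \<open>simp add: \<psi>L_def \<eta>K_def DF_def DH_def\<close>)
    show "\<psi>L (act ?A f x) = act L (\<eta>K f) (\<psi>L x)"
      if "f \<in> carrier (grp ?A)" "x \<in> pts ?A" for f x
      using that by (elim translation_action_ptsE)
        (use monD(1,2)[OF \<eta>K] base_pts b in \<open>simp add: \<psi>L_def L.composition_rule\<close>)
  qed
  have AB: "action_embedding A B \<theta>K \<psi>B"
    unfolding action_embedding_def isometric_embedding_def A_def B_def
  proof (intro conjI ballI)
    show "\<theta>K \<in> mon (grp ?A) (grp ?B)"
      using \<theta>K by simp
    show "\<psi>B ` pts ?A \<subseteq> pts ?B"
    proof (intro image_subsetI, elim translation_action_ptsE)
      fix x h i assume "h \<in> carrier KF" "i < n" "x = prod_encode (h, i)"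
      then show "\<psi>B x \<in> pts ?B"
        using monD(1)[OF \<theta>K] nr by (simp add: \<psi>B_def)
    qed
    show "\<psi>B ` base ?A \<subseteq> base ?B"
      using mon_one[OF \<theta>K KF(1) KH(1)] nr by (auto simp: \<psi>B_def)
    show "met ?B (\<psi>B x) (\<psi>B y) = met ?A x y"
      if "x \<in> pts ?A" "y \<in> pts ?A" for x y
      using that by (elim translation_action_ptsE)
        (use monD(1)[OF \<theta>K] nr in \<open>simp add: \<psi>B_def DF_def\<close>)
    show "\<psi>B (act ?A f x) = act ?B (\<theta>K f) (\<psi>B x)"
      if "f \<in> carrier (grp ?A)" "x \<in> pts ?A" for f x
      using that by (elim translation_action_ptsE)
        (use monD(1,2)[OF \<theta>K] nr in \<open>simp add: \<psi>B_def\<close>)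
  qed
  obtain \<phi>' \<psi>' where BL: "action_embedding B L \<phi>' \<psi>'"
    and \<phi>': "\<And>f. f \<in> carrier (grp A) \<Longrightarrow> \<eta>K f = \<phi>' (\<theta>K f)"
    and \<psi>': "\<And>y. y \<in> pts A \<Longrightarrow> \<psi>L y = \<psi>' (\<psi>B y)"
    using L[unfolded action_fraisse_limit_def, THEN conjunct2, THEN conjunct2, THEN conjunct2, rule_format,
        OF conjI[OF A conjI[OF B conjI[OF AL AB]]]] by blast
  have \<phi>'_mon: "\<phi>' \<in> mon KH (grp L)"
    and \<psi>'_met: "\<And>x y. \<lbrakk>x \<in> pts B; y \<in> pts B\<rbrakk> \<Longrightarrow> met L (\<psi>' x) (\<psi>' y) = met B x y"
    and \<psi>'_base: "\<And>x. x \<in> base B \<Longrightarrow> \<psi>' x \<in> base L"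
    and \<psi>'_act: "\<And>f x. \<lbrakk>f \<in> carrier KH; x \<in> pts B\<rbrakk> \<Longrightarrow> \<psi>' (act B f x) = act L (\<phi>' f) (\<psi>' x)"
    using BL unfolding action_embedding_def isometric_embedding_def by (auto simp: B_def)
  interpret KH: group KH by (rule KH)
  interpret KF: group KF by (rule KF)
  define \<phi> where "\<phi> = \<phi>' \<circ> cH"
  define b' where "b' = (\<lambda>i. \<psi>' (prod_encode (\<one>\<^bsub>KH\<^esub>, i)))"
  have \<phi>_mon: "\<phi> \<in> mon (G\<lparr>carrier := H\<rparr>) (grp L)"
    unfolding \<phi>_def using mon_compose cH(1) \<phi>'_mon by blast
  have b'_base: "b' i \<in> base L" if "i < r" for i
    using \<psi>'_base that by (auto simp: b'_def B_def)
  have met: "met L (act L (\<phi> h) (b' i)) (act L (\<phi> k) (b' j)) = D (h, i) (k, j) / real N"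
    if that': "h \<in> H" "k \<in> H" "i < r" "j < r" for h k i j
  proof -
    have "act L (\<phi> h) (b' i) = \<psi>' (prod_encode (cH h, i))" if "h \<in> H" "i < r" for h i
      using \<psi>'_act[of "cH h" "prod_encode (\<one>\<^bsub>KH\<^esub>, i)"] monD(1)[OF cH(1)] that
      by (simp add: b'_def \<phi>_def B_def)
    with that' show ?thesis
      using \<psi>'_met[of "prod_encode (cH h, i)" "prod_encode (cH k, j)"] monD(1)[OF cH(1)]
      by (simp add: B_def DH_def dH_cH)
  qed
  have inj: "inj_on b' {..<r}"
  proof (rule inj_onI)
    fix i j assume ij: "i \<in> {..<r}" "j \<in> {..<r}" "b' i = b' j"
    have "Metric_space (pts L) (met L)"
      using L_free unfolding pointed_free_action_def by blast
    then have "met L (b' i) (b' j) = 0"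
      using ij b'_base base_pts by (simp add: Metric_space.zero)
    moreover have "\<phi> \<one>\<^bsub>G\<^esub> = \<one>\<^bsub>grp L\<^esub>"
      using mon_one[OF \<phi>_mon grpH L_group] by simp
    ultimately have "D (\<one>\<^bsub>G\<^esub>, i) (\<one>\<^bsub>G\<^esub>, j) = 0"
      using met[of "\<one>\<^bsub>G\<^esub>" "\<one>\<^bsub>G\<^esub>" i j] ij b'_base base_pts L_one N by simp
    then show "i = j"
      using D int_metric_zero[of "H \<times> {..<r}" D "(\<one>\<^bsub>G\<^esub>, i)" "(\<one>\<^bsub>G\<^esub>, j)"] ij
      by (auto simp: invariant_metric_def)
  qed
  show thesis
  proof (rule that[OF \<phi>_mon _ _ b'_base inj met])
    show "\<phi> (\<theta> f) = \<eta> f" if "f \<in> F" for f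
      using \<phi>'[of "cF f"] monD(1)[OF cF(1)] that by (simp add: A_def \<theta>K_def \<eta>K_def \<phi>_def dF_cF)
    show "b' i = b i" if "i < n" for i
    proof -
      have "\<psi>L (prod_encode (\<one>\<^bsub>KF\<^esub>, i)) = b' i"
        using \<psi>'[of "prod_encode (\<one>\<^bsub>KF\<^esub>, i)"] that mon_one[OF \<theta>K KF(1) KH(1)]
        by (simp add: A_def \<psi>B_def b'_def)
      then show ?thesis
        using mon_one[OF \<eta>K KF(1) L_group] b[OF that] base_pts L_one by (simp add: \<psi>L_def)
    qed
  qed
qed

section \<open>Rational distances and rounding\<close>

lemma common_denominator:
  assumes "finite S" "S \<subseteq> \<rat>"
  obtains s :: nat where "0 < s" "\<And>q :: real. q \<in> S \<Longrightarrow> of_nat s * q \<in> \<int>"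
proof -
  have "\<exists>s :: nat. 0 < s \<and> (\<forall>q\<in>S. of_nat s * q \<in> \<int>)"
    using assms
  proof (induction S rule: finite_induct)
    case empty
    then show ?case by auto
  next
    case (insert q S)
    then obtain s :: nat where s: "0 < s" "\<forall>q\<in>S. of_nat s * q \<in> \<int>"
      by auto
    from insert obtain a b :: int where q: "q = of_int a / of_int b" "0 < b"
      by (auto elim: Rats_cases')
    define t where "t = s * nat b"
    have t: "of_nat t = of_nat s * (of_int b :: real)"
      using q by (simp add: t_def)
    then have "of_nat t * q = of_int (int s * a)"
      using q by simp
    moreover have "of_nat t * q' \<in> \<int>" if "q' \<in> S" for q'
      using s(2) that unfolding t by (metis Ints_mult Ints_of_int mult.assoc mult.commute)
    ultimately have "\<forall>q'\<in>insert q S. of_nat t * q' \<in> \<int>"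
      by (metis Ints_of_int insert_iff)
    moreover have "0 < t"
      using s q by (simp add: t_def)
    ultimately show ?case
      by blast
  qed
  with that show thesis
    by blast
qed

text \<open>\<open>p\<close> may vanish off the diagonal, as happens for distances along the orbits
  of a non-free action or of a tuple with repetitions. Scaling by \<open>N\<close> and applying
  \<open>int_metric_ceiling\<close> changes a value by at most 2, whence the choice of
  \<open>N\<close> above \<open>2 / \<epsilon>\<close>. Invariance survives since the rounding is
  done value by value.\<close>

lemma (in group) approx_invariant_metric:
  assumes "subgroup H G"
    and nonneg: "\<And>x y. \<lbrakk>x \<in> H \<times> {..<m}; y \<in> H \<times> {..<m}\<rbrakk> \<Longrightarrow> 0 \<le> p x y"
    and sym: "\<And>x y. \<lbrakk>x \<in> H \<times> {..<m}; y \<in> H \<times> {..<m}\<rbrakk> \<Longrightarrow> p x y = p y x"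
    and zero: "\<And>x. x \<in> H \<times> {..<m} \<Longrightarrow> p x x = 0"
    and triangle: "\<And>x y z. \<lbrakk>x \<in> H \<times> {..<m}; y \<in> H \<times> {..<m}; z \<in> H \<times> {..<m}\<rbrakk> \<Longrightarrow> p x z \<le> p x y + p y z"
    and inv: "\<And>g h k i j. \<lbrakk>g \<in> H; h \<in> H; k \<in> H; i < m; j < m\<rbrakk>
      \<Longrightarrow> p (g \<otimes> h, i) (g \<otimes> k, j) = p (h, i) (k, j)"
    and "(0 :: real) < \<epsilon>"
  obtains N d where "0 < N" "invariant_metric G H m d"
    and "\<And>x y. \<lbrakk>x \<in> H \<times> {..<m}; y \<in> H \<times> {..<m}\<rbrakk> \<Longrightarrow> \<bar>d x y / real N - p x y\<bar> \<le> \<epsilon>"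
proof -
  interpret H: subgroup H G by (rule assms)
  obtain N :: nat where N: "2 / \<epsilon> < real N"
    using reals_Archimedean2 by blast
  with \<open>0 < \<epsilon>\<close> have N0: "0 < N"
    by (cases "N = 0") auto
  define d where "d = (\<lambda>x y. if x = y then 0 else \<lceil>real N * p x y\<rceil> + 1)"
  have "int_metric (H \<times> {..<m}) d"
    unfolding d_def
  proof (rule int_metric_ceiling)
    show "real N * p x z \<le> real N * p x y + real N * p y z"
      if "x \<in> H \<times> {..<m}" "y \<in> H \<times> {..<m}" "z \<in> H \<times> {..<m}" for x y z
      using mult_left_mono[OF triangle[OF that], of "real N"] by (simp add: distrib_left)
    show "real N * p x y = real N * p y x" if "x \<in> H \<times> {..<m}" "y \<in> H \<times> {..<m}" for x y
      using sym[OF that] by simp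
  qed (use nonneg in simp)
  moreover have "d (g \<otimes> h, i) (g \<otimes> k, j) = d (h, i) (k, j)"
    if "g \<in> H" "h \<in> H" "k \<in> H" "i < m" "j < m" for g h k i j
    using inv[OF that] that by (simp add: d_def)
  ultimately have "invariant_metric G H m d"
    by (simp add: invariant_metric_def)
  moreover have "\<bar>d x y / real N - p x y\<bar> \<le> \<epsilon>" if xy: "x \<in> H \<times> {..<m}" "y \<in> H \<times> {..<m}" for x y
  proof -
    have "\<bar>d x y - real N * p x y\<bar> \<le> 2"
    proof (cases "x = y")
      case False
      then have "real_of_int (d x y) = of_int \<lceil>real N * p x y\<rceil> + 1"
        by (simp add: d_def)
      then show ?thesis
        using ceiling_correct[of "real N * p x y"] by linarith
    qed (use zero[OF xy(1)] in \<open>simp add: d_def\<close>)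
    moreover have "d x y / real N - p x y = (d x y - real N * p x y) / real N"
      using N0 by (simp add: field_simps)
    ultimately have "\<bar>d x y / real N - p x y\<bar> \<le> 2 / real N"
      by (simp add: abs_divide divide_right_mono)
    also have "\<dots> \<le> \<epsilon>"
      using N N0 \<open>0 < \<epsilon>\<close> by (simp add: field_simps)
    finally show ?thesis .
  qed
  ultimately show thesis
    using that N0 by blast
qed

section \<open>Orbits, distances and local finiteness in the limit\<close>

locale pointed_action_space =
  fixes L :: "('h, 'x) pointed_action"
  assumes free_action: "pointed_free_action L"
begin

sublocale Metric_space "pts L" "met L"
  using free_action unfolding pointed_free_action_def by (rule conjunct1)

sublocale group_action "grp L" "pts L" "act L"
  using free_action[unfolded pointed_free_action_def] by (elim conjE)

sublocale group "grp L"
  using group_hom by (simp add: group_hom_def)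

lemma act_isometric:
  "\<lbrakk>g \<in> carrier (grp L); x \<in> pts L; y \<in> pts L\<rbrakk> \<Longrightarrow> met L (act L g x) (act L g y) = met L x y"
  using free_action[unfolded pointed_free_action_def, THEN conjunct2, THEN conjunct2, THEN conjunct1] by blast

lemma act_free: "\<lbrakk>g \<in> carrier (grp L); x \<in> pts L; act L g x = x\<rbrakk> \<Longrightarrow> g = \<one>\<^bsub>grp L\<^esub>"
  using free_action[unfolded pointed_free_action_def, THEN conjunct2, THEN conjunct2, THEN conjunct2, THEN conjunct1]
  by blast

lemma base_pts: "b \<in> base L \<Longrightarrow> b \<in> pts L"
  using free_action[unfolded pointed_free_action_def, THEN conjunct2, THEN conjunct2, THEN conjunct2, THEN conjunct2,
      THEN conjunct1] by blast

lemma base_unique: "x \<in> pts L \<Longrightarrow> \<exists>!b. b \<in> base L \<and> b \<in> orbit (grp L) (act L) x"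
  using free_action[unfolded pointed_free_action_def, THEN conjunct2, THEN conjunct2, THEN conjunct2, THEN conjunct2,
      THEN conjunct2] by blast

lemma act_closed: "\<lbrakk>g \<in> carrier (grp L); x \<in> pts L\<rbrakk> \<Longrightarrow> act L g x \<in> pts L"
  using element_image by blast

lemma act_one: "x \<in> pts L \<Longrightarrow> act L \<one>\<^bsub>grp L\<^esub> x = x"
  using fun_cong[OF id_eq_one, of x] by simp

lemma act_inv: "\<lbrakk>g \<in> carrier (grp L); x \<in> pts L\<rbrakk> \<Longrightarrow> act L (inv\<^bsub>grp L\<^esub> g) (act L g x) = x"
  using orbit_sym_aux by blast

lemma base_orbit:
  assumes "x \<in> pts L"
  obtains g b where "g \<in> carrier (grp L)" "b \<in> base L" "x = act L g b"
proof -
  obtain b where b: "b \<in> base L" "b \<in> orbit (grp L) (act L) x"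
    using base_unique[OF assms] by blast
  then have "x \<in> orbit (grp L) (act L) b"
    using orbit_sym assms base_pts by blast
  with b that show thesis
    by (auto simp: orbit_def)
qed

text \<open>The base meets every orbit once and the action is free, so a point has only one pair of
  coordinates. In \<open>base_extension\<close> this makes the distances along orbits of distinct
  base points a metric and not just a pseudometric.\<close>

lemma base_eqD:
  assumes g: "g \<in> carrier (grp L)" and k: "k \<in> carrier (grp L)"
    and b: "b \<in> base L" and b': "b' \<in> base L" and eq: "act L g b = act L k b'"
  shows "g = k \<and> b = b'"
proof -
  have orbit: "c \<in> orbit (grp L) (act L) (act L k c)" if "k \<in> carrier (grp L)" "c \<in> base L" for k c
    using act_inv[OF that(1) base_pts[OF that(2)], symmetric] inv_closed[OF that(1)]
    unfolding orbit_def by blast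
  have "b \<in> orbit (grp L) (act L) (act L g b)" "b' \<in> orbit (grp L) (act L) (act L g b)"
    using orbit[OF g b] orbit[OF k b'] eq by simp_all
  then have "b = b'"
    using base_unique[OF act_closed[OF g base_pts[OF b]]] b b' by blast
  have "act L (inv\<^bsub>grp L\<^esub> k \<otimes>\<^bsub>grp L\<^esub> g) b = b"
    using act_inv[OF k base_pts[OF b']] eq \<open>b = b'\<close> g k base_pts[OF b] by (simp add: composition_rule)
  then have "inv\<^bsub>grp L\<^esub> k \<otimes>\<^bsub>grp L\<^esub> g = \<one>\<^bsub>grp L\<^esub>"
    using act_free g k base_pts[OF b] by blast
  then have "inv\<^bsub>grp L\<^esub> g = inv\<^bsub>grp L\<^esub> k"
    using inv_equality g k by simp
  from arg_cong[OF this, of "m_inv (grp L)"] have "g = k"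
    unfolding inv_inv[OF g] inv_inv[OF k] .
  with \<open>b = b'\<close> show ?thesis
    by blast
qed

end

locale fraisse_limit =
  fixes L :: "('h, 'x) pointed_action"
  assumes fraisse: "action_fraisse_limit L"
begin

sublocale pointed_action_space L
  using fraisse unfolding action_fraisse_limit_def by unfold_locales (rule conjunct1)

lemma exhaustion:
  obtains A :: "nat \<Rightarrow> (nat, nat) pointed_action" and \<phi> \<psi>
  where "\<And>n. finite_rational_action (A n)" "\<And>n. action_embedding (A n) L (\<phi> n) (\<psi> n)"
    and "incseq (\<lambda>n. \<phi> n ` carrier (grp (A n)))" "incseq (\<lambda>n. \<psi> n ` pts (A n))"
    and "carrier (grp L) = (\<Union>n. \<phi> n ` carrier (grp (A n)))" "pts L = (\<Union>n. \<psi> n ` pts (A n))"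
proof -
  obtain A :: "nat \<Rightarrow> (nat, nat) pointed_action" and f g \<phi> \<psi> where
    A: "\<forall>n. finite_rational_action (A n)
           \<and> action_embedding (A n) (A (Suc n)) (f n) (g n)
           \<and> action_embedding (A n) L (\<phi> n) (\<psi> n)
           \<and> (\<forall>a\<in>carrier (grp (A n)). \<phi> (Suc n) (f n a) = \<phi> n a)
           \<and> (\<forall>y\<in>pts (A n). \<psi> (Suc n) (g n y) = \<psi> n y)"
    and un: "carrier (grp L) = (\<Union>n. \<phi> n ` carrier (grp (A n)))" "pts L = (\<Union>n. \<psi> n ` pts (A n))"
    using fraisse[unfolded action_fraisse_limit_def, THEN conjunct2, THEN conjunct1]
    by (elim exE conjE) (rule that)
  have step: "f n \<in> mon (grp (A n)) (grp (A (Suc n)))" "g n ` pts (A n) \<subseteq> pts (A (Suc n))" for n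
    using A[rule_format, of n, THEN conjunct2, THEN conjunct1]
    unfolding action_embedding_def isometric_embedding_def by simp_all
  show thesis
  proof (rule that[of A \<phi> \<psi>])
    show "incseq (\<lambda>n. \<phi> n ` carrier (grp (A n)))"
    proof (intro incseq_SucI image_subsetI)
      fix n a assume a: "a \<in> carrier (grp (A n))"
      then have "\<phi> n a = \<phi> (Suc n) (f n a)"
        using A by simp
      with monD(1)[OF step(1) a] show "\<phi> n a \<in> \<phi> (Suc n) ` carrier (grp (A (Suc n)))"
        by simp
    qed
    show "incseq (\<lambda>n. \<psi> n ` pts (A n))"
    proof (intro incseq_SucI image_subsetI)
      fix n y assume y: "y \<in> pts (A n)"
      then have "\<psi> n y = \<psi> (Suc n) (g n y)"
        using A by simp
      with step(2) y show "\<psi> n y \<in> \<psi> (Suc n) ` pts (A (Suc n))"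
        by auto
    qed
  qed (use A un in \<open>simp_all\<close>)
qed

lemma countable_grp: "countable (carrier (grp L))" and countable_pts: "countable (pts L)"
proof -
  obtain A :: "nat \<Rightarrow> (nat, nat) pointed_action" and \<phi> :: "nat \<Rightarrow> nat \<Rightarrow> 'h" and \<psi> :: "nat \<Rightarrow> nat \<Rightarrow> 'x" where
    "carrier (grp L) = (\<Union>n. \<phi> n ` carrier (grp (A n)))" "pts L = (\<Union>n. \<psi> n ` pts (A n))"
    by (rule exhaustion) (rule that)
  then show "countable (carrier (grp L))" "countable (pts L)"
    by simp_all
qed

lemma met_rational: "met L x y \<in> \<rat>" if xy: "x \<in> pts L" "y \<in> pts L"
proof -
  obtain A :: "nat \<Rightarrow> (nat, nat) pointed_action" and \<phi> \<psi> where
    A: "\<And>n. finite_rational_action (A n)" "\<And>n. action_embedding (A n) L (\<phi> n) (\<psi> n)"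
    and mono: "incseq (\<lambda>n. \<psi> n ` pts (A n))" and un: "pts L = (\<Union>n. \<psi> n ` pts (A n))"
    by (rule exhaustion) (rule that)
  obtain k l where kl: "x \<in> \<psi> k ` pts (A k)" "y \<in> \<psi> l ` pts (A l)"
    using xy unfolding un by blast
  define n where "n = max k l"
  have "\<psi> k ` pts (A k) \<subseteq> \<psi> n ` pts (A n)" "\<psi> l ` pts (A l) \<subseteq> \<psi> n ` pts (A n)"
    using mono by (simp_all add: incseq_def n_def)
  with kl obtain a b where "a \<in> pts (A n)" "b \<in> pts (A n)" "x = \<psi> n a" "y = \<psi> n b"
    by blast
  then have "met L x y = met (A n) a b"
    using A(2)[of n] unfolding action_embedding_def isometric_embedding_def by simp
  moreover have "met (A n) a b \<in> \<rat>"
    using A(1)[of n] \<open>a \<in> pts (A n)\<close> \<open>b \<in> pts (A n)\<close>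
    unfolding finite_rational_action_def finite_rational_metric_def by blast
  ultimately show ?thesis
    by simp
qed

lemma locally_finite:
  assumes "finite S" "S \<subseteq> carrier (grp L)"
  obtains F where "subgroup F (grp L)" "finite F" "S \<subseteq> F"
proof -
  obtain A :: "nat \<Rightarrow> (nat, nat) pointed_action" and \<phi> \<psi> where
    A: "\<And>n. finite_rational_action (A n)" "\<And>n. action_embedding (A n) L (\<phi> n) (\<psi> n)"
    and mono: "incseq (\<lambda>n. \<phi> n ` carrier (grp (A n)))"
    and un: "carrier (grp L) = (\<Union>n. \<phi> n ` carrier (grp (A n)))"
    by (rule exhaustion) (rule that)
  have "\<exists>n. S \<subseteq> \<phi> n ` carrier (grp (A n))"
    using assms
  proof (induction S rule: finite_induct)
    case empty
    then show ?case by simp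
  next
    case (insert x S)
    then obtain k l where kl: "x \<in> \<phi> k ` carrier (grp (A k))" "S \<subseteq> \<phi> l ` carrier (grp (A l))"
      unfolding un by blast
    have "\<phi> k ` carrier (grp (A k)) \<subseteq> \<phi> (max k l) ` carrier (grp (A (max k l)))"
      "\<phi> l ` carrier (grp (A l)) \<subseteq> \<phi> (max k l) ` carrier (grp (A (max k l)))"
      using mono by (simp_all add: incseq_def)
    with kl show ?case
      by blast
  qed
  then obtain n where n: "S \<subseteq> \<phi> n ` carrier (grp (A n))"
    by blast
  interpret A: pointed_action_space "A n"
    using A(1)[of n] by unfold_locales (simp add: finite_rational_action_def)
  have "\<phi> n \<in> mon (grp (A n)) (grp L)"
    using A(2)[of n] by (simp add: action_embedding_def)
  then have "subgroup (\<phi> n ` carrier (grp (A n))) (grp L)"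
    using mon_image_subgroup[of "\<phi> n" "carrier (grp (A n))" "grp (A n)" "grp L"] A.is_group is_group
      A.subgroup_self by simp
  moreover have "finite (\<phi> n ` carrier (grp (A n)))"
    using A(1)[of n] by (simp add: finite_rational_action_def)
  ultimately show thesis
    using n that by blast
qed

end

section \<open>Extending actions in the Fraisse limit\<close>

context fraisse_limit
begin

text \<open>The metric \<open>d\<close> need not agree with the distances already present at
  \<open>b\<close>, so \<open>b\<close> itself cannot be kept. \<open>invariant_gluing\<close> puts
  the exact metric of the old orbits and \<open>d\<close> into one metric on \<open>n + m\<close>
  copies of \<open>H\<close>, \<open>fraisse_extension\<close> realizes it over \<open>b\<close>,
  and the last \<open>m\<close> base points are \<open>b'\<close>. That they differ from the old
  ones lets \<open>base_dense\<close> avoid a finite set.\<close>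

lemma base_extension:
  fixes G :: "('g, 'b) monoid_scheme"
  assumes G: "group G" and H: "subgroup H G" "finite H" and F: "subgroup F G" "finite F"
    and \<theta>: "\<theta> \<in> mon (G\<lparr>carrier := F\<rparr>) (G\<lparr>carrier := H\<rparr>)"
    and \<eta>: "\<eta> \<in> mon (G\<lparr>carrier := F\<rparr>) (grp L)"
    and nm: "0 < n" "n \<le> m" and N: "0 < N" and d: "invariant_metric G H m d"
    and b: "\<And>i. i < n \<Longrightarrow> b i \<in> base L" "inj_on b {..<n}" and \<epsilon>: "0 < \<epsilon>"
    and close: "\<And>f k i j. \<lbrakk>f \<in> F; k \<in> F; i < n; j < n\<rbrakk>
      \<Longrightarrow> \<bar>d (\<theta> f, i) (\<theta> k, j) / real N - met L (act L (\<eta> f) (b i)) (act L (\<eta> k) (b j))\<bar> \<le> \<epsilon>"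
  obtains \<phi> b' where "\<phi> \<in> mon (G\<lparr>carrier := H\<rparr>) (grp L)" "\<And>f. f \<in> F \<Longrightarrow> \<phi> (\<theta> f) = \<eta> f"
    and "\<And>i. i < m \<Longrightarrow> b' i \<in> base L" "\<And>i. i < m \<Longrightarrow> b' i \<notin> b ` {..<n}"
    and "\<And>i. i < n \<Longrightarrow> met L (b i) (b' i) \<le> 2 * \<epsilon>"
    and "\<And>h k i j. \<lbrakk>h \<in> H; k \<in> H; i < m; j < m\<rbrakk>
      \<Longrightarrow> met L (act L (\<phi> h) (b' i)) (act L (\<phi> k) (b' j)) = d (h, i) (k, j) / real N"
proof -
  interpret G: group G by (rule G)
  interpret H: subgroup H G by (rule H)
  interpret F: subgroup F G by (rule F)
  define p where "p = (\<lambda>x y. met L (act L (\<eta> (fst x)) (b (snd x))) (act L (\<eta> (fst y)) (b (snd y))))"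
  have \<eta>_in: "\<eta> f \<in> carrier (grp L)" if "f \<in> F" for f
    using monD(1)[OF \<eta>] that by simp
  have pt: "act L (\<eta> f) (b i) \<in> pts L" if "f \<in> F" "i < n" for f i
    using act_closed[OF \<eta>_in[OF that(1)] base_pts[OF b(1)[OF that(2)]]] .
  define S where "S = (\<lambda>(x, y). p x y) ` ((F \<times> {..<n}) \<times> (F \<times> {..<n}))"
  have "finite S"
    using F by (simp add: S_def)
  moreover have "S \<subseteq> \<rat>"
    using met_rational pt by (auto simp: S_def p_def)
  ultimately obtain s :: nat where s: "0 < s" "\<And>q. q \<in> S \<Longrightarrow> of_nat s * q \<in> \<int>"
    using common_denominator by blast
  obtain K :: nat where K: "1 / \<epsilon> < real K"
    using reals_Archimedean2 by blast
  with \<epsilon> have K0: "0 < K"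
    by (cases "K = 0") auto
  \<comment> \<open>Over the denominator \<open>M\<close> everything is integral: \<open>s\<close>
    clears the denominators of the distances in \<open>S\<close>, and \<open>N\<close> those of
    \<open>d\<close>. The factor \<open>K\<close> makes \<open>M * \<epsilon>\<close> at least 1, so
    that rounding it up to the link length \<open>e\<close> at most doubles it. This is the 2 in the
    displacement \<open>2 * \<epsilon>\<close>.\<close>
  define t where "t = s * K"
  define M where "M = N * t"
  have pos: "0 < t" "0 < M" "0 < real M"
    using s K0 N by (simp_all add: t_def M_def)
  have "1 * K \<le> N * s * K"
    using s N by (intro mult_right_mono) simp_all
  then have "real K \<le> real M"
    unfolding M_def t_def mult.assoc of_nat_le_iff by simp
  with K have "1 / \<epsilon> < real M"
    by linarith
  then have M\<epsilon>: "1 \<le> real M * \<epsilon>"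
    using \<epsilon> by (simp add: pos_divide_less_eq)
  have Mp: "real M * p x y \<in> \<int>" if "x \<in> F \<times> {..<n}" "y \<in> F \<times> {..<n}" for x y
  proof -
    have "p x y \<in> S"
      using that by (force simp: S_def)
    from Ints_mult[OF Ints_of_nat[of "N * K"] s(2)[OF this]] show ?thesis
      by (simp add: M_def t_def mult_ac)
  qed
  define \<rho> where "\<rho> = (\<lambda>x y. \<lfloor>real M * p x y\<rfloor>)"
  have \<rho>: "real_of_int (\<rho> x y) = real M * p x y" if "x \<in> F \<times> {..<n}" "y \<in> F \<times> {..<n}" for x y
    using Mp[OF that] by (auto simp: \<rho>_def elim: Ints_cases)
  have \<rho>_inv: "invariant_metric G F n \<rho>"
    unfolding invariant_metric_def
  proof (intro conjI int_metricI ballI allI impI)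
    fix x y assume xy: "x \<in> F \<times> {..<n}" "y \<in> F \<times> {..<n}"
    have "\<rho> x y = 0 \<longleftrightarrow> real_of_int (\<rho> x y) = 0"
      by simp
    also have "\<dots> \<longleftrightarrow> p x y = 0"
      using pos unfolding \<rho>[OF xy] by simp
    also have "\<dots> \<longleftrightarrow> act L (\<eta> (fst x)) (b (snd x)) = act L (\<eta> (fst y)) (b (snd y))"
      using pt xy by (simp add: p_def mem_Times_iff)
    also have "\<dots> \<longleftrightarrow> x = y"
    proof
      assume "act L (\<eta> (fst x)) (b (snd x)) = act L (\<eta> (fst y)) (b (snd y))"
      from base_eqD[OF \<eta>_in \<eta>_in b(1) b(1) this] have "\<eta> (fst x) = \<eta> (fst y)" "b (snd x) = b (snd y)"
        using xy by (simp_all add: mem_Times_iff)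
      with inj_onD[OF monD(3)[OF \<eta>]] inj_onD[OF b(2)] show "x = y"
        using xy by (simp add: mem_Times_iff prod_eq_iff)
    qed simp
    finally show "\<rho> x y = 0 \<longleftrightarrow> x = y" .
    show "\<rho> x y = \<rho> y x"
      by (simp add: \<rho>_def p_def commute)
    fix z assume z: "z \<in> F \<times> {..<n}"
    have "p x z \<le> p x y + p y z"
      unfolding p_def using pt xy z by (intro triangle) (simp_all add: mem_Times_iff)
    then have "real M * p x z \<le> real M * p x y + real M * p y z"
      using mult_left_mono[of "p x z" "p x y + p y z" "real M"] by (simp add: distrib_left)
    then show "\<rho> x z \<le> \<rho> x y + \<rho> y z"
      using \<rho>[OF xy] \<rho>[OF xy(1) z] \<rho>[OF xy(2) z] by linarith
  next
    fix g h k i j assume that: "g \<in> F" "h \<in> F" "k \<in> F" "i < n" "j < n"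
    have "act L (\<eta> (g \<otimes>\<^bsub>G\<^esub> h)) (b i) = act L (\<eta> g) (act L (\<eta> h) (b i))" if "g \<in> F" "h \<in> F" "i < n" for g h i
      using monD(2)[OF \<eta>] that composition_rule[OF base_pts[OF b(1)] \<eta>_in \<eta>_in] by simp
    then show "\<rho> (g \<otimes>\<^bsub>G\<^esub> h, i) (g \<otimes>\<^bsub>G\<^esub> k, j) = \<rho> (h, i) (k, j)"
      using that act_isometric[OF \<eta>_in pt pt] by (simp add: \<rho>_def p_def)
  qed
  define d' where "d' = (\<lambda>x y. int t * d x y)"
  have d': "invariant_metric G H m d'"
    unfolding invariant_metric_def
  proof (intro conjI int_metricI ballI allI impI)
    have dm: "int_metric (H \<times> {..<m}) d"
      using d by (simp add: invariant_metric_def)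
    fix x y assume xy: "x \<in> H \<times> {..<m}" "y \<in> H \<times> {..<m}"
    show "d' x y = 0 \<longleftrightarrow> x = y" "d' x y = d' y x"
      using int_metric_zero[OF dm xy] int_metric_sym[OF dm xy] pos by (simp_all add: d'_def)
    fix z assume "z \<in> H \<times> {..<m}"
    from int_metric_triangle[OF dm xy this] show "d' x z \<le> d' x y + d' y z"
      using mult_left_mono[of "d x z" "d x y + d y z" "int t"] by (simp add: d'_def distrib_left)
  qed (use d in \<open>simp add: invariant_metric_def d'_def\<close>)
  define e where "e = \<lceil>real M * \<epsilon>\<rceil>"
  have "real_of_int e - 1 < real M * \<epsilon>" and e_ge: "real M * \<epsilon> \<le> real_of_int e"
    unfolding e_def using ceiling_correct by blast+
  with M\<epsilon> have e: "1 \<le> e" "real_of_int e \<le> 2 * (real M * \<epsilon>)"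
    by linarith+
  have d'M: "real_of_int (d' x y) / real M = d x y / real N" for x y
    using pos N by (simp add: d'_def M_def)
  have close': "\<bar>\<rho> (f, i) (k, j) - d' (\<theta> f, i) (\<theta> k, j)\<bar> \<le> 2 * e"
    if fk: "f \<in> F" "k \<in> F" "i < n" "j < n" for f k i j
  proof -
    have "real_of_int (d' (\<theta> f, i) (\<theta> k, j)) = real M * (d (\<theta> f, i) (\<theta> k, j) / real N)"
      using d'M[of "(\<theta> f, i)" "(\<theta> k, j)"] pos by (simp add: field_simps)
    moreover have "real_of_int (\<rho> (f, i) (k, j)) = real M * p (f, i) (k, j)"
      using \<rho> fk by simp
    ultimately have "real_of_int (d' (\<theta> f, i) (\<theta> k, j)) - \<rho> (f, i) (k, j)
        = real M * (d (\<theta> f, i) (\<theta> k, j) / real N - p (f, i) (k, j))"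
      by (simp only: right_diff_distrib)
    then have "\<bar>real_of_int (d' (\<theta> f, i) (\<theta> k, j)) - \<rho> (f, i) (k, j)\<bar>
        = real M * \<bar>d (\<theta> f, i) (\<theta> k, j) / real N - p (f, i) (k, j)\<bar>"
      by (simp add: abs_mult)
    also have "\<dots> \<le> real M * \<epsilon>"
      using close[OF fk] pos by (intro mult_left_mono) (simp_all add: p_def)
    finally show ?thesis
      using e_ge e(1) by linarith
  qed
  obtain D where D: "invariant_metric G H (n + m) D"
    and D\<rho>: "\<And>f k i j. \<lbrakk>f \<in> F; k \<in> F; i < n; j < n\<rbrakk> \<Longrightarrow> D (\<theta> f, i) (\<theta> k, j) = \<rho> (f, i) (k, j)"
    and Dd: "\<And>h k i j. \<lbrakk>h \<in> H; k \<in> H; i < m; j < m\<rbrakk> \<Longrightarrow> D (h, n + i) (k, n + j) = d' (h, i) (k, j)"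
    and De: "\<And>h i. \<lbrakk>h \<in> H; i < n\<rbrakk> \<Longrightarrow> D (h, i) (h, n + i) \<le> e"
    by (rule G.invariant_gluing[OF H F G \<theta> nm(2) \<rho>_inv d' close' e(1)]) (assumption | rule that)+
  have D_dist: "met L (act L (\<eta> f) (b i)) (act L (\<eta> k) (b j)) = D (\<theta> f, i) (\<theta> k, j) / real M"
    if "f \<in> F" "k \<in> F" "i < n" "j < n" for f k i j
    using D\<rho>[OF that] \<rho>[of "(f, i)" "(k, j)"] that pos by (simp add: p_def)
  obtain \<phi> c where \<phi>: "\<phi> \<in> mon (G\<lparr>carrier := H\<rparr>) (grp L)" "\<And>f. f \<in> F \<Longrightarrow> \<phi> (\<theta> f) = \<eta> f"
    and c: "\<And>i. i < n \<Longrightarrow> c i = b i" "\<And>i. i < n + m \<Longrightarrow> c i \<in> base L" "inj_on c {..<n + m}"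
    and c_dist: "\<And>h k i j. \<lbrakk>h \<in> H; k \<in> H; i < n + m; j < n + m\<rbrakk>
      \<Longrightarrow> met L (act L (\<phi> h) (c i)) (act L (\<phi> k) (c j)) = D (h, i) (k, j) / real M"
    by (rule fraisse_extension[OF fraisse G H F \<theta> \<eta> nm(1) le_add1 pos(2) D b(1) D_dist]) (assumption | rule that)+
  show thesis
  proof (rule that[OF \<phi>, of "\<lambda>i. c (n + i)"])
    show "c (n + i) \<in> base L" if "i < m" for i
      using c(2) that by simp
    show "c (n + i) \<notin> b ` {..<n}" if "i < m" for i
    proof
      assume "c (n + i) \<in> b ` {..<n}"
      then obtain j where "j < n" "c (n + i) = c j"
        using c(1) by auto
      with c(3) that show False
        using inj_onD[OF c(3), of "n + i" j] by simp
    qed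
    show "met L (b i) (c (n + i)) \<le> 2 * \<epsilon>" if "i < n" for i
    proof -
      have "\<phi> \<one>\<^bsub>G\<^esub> = \<one>\<^bsub>grp L\<^esub>"
        using mon_one[OF \<phi>(1) G.subgroup_imp_group[OF H(1)]] is_group by simp
      then have "met L (b i) (c (n + i)) = D (\<one>\<^bsub>G\<^esub>, i) (\<one>\<^bsub>G\<^esub>, n + i) / real M"
        using c_dist[of "\<one>\<^bsub>G\<^esub>" "\<one>\<^bsub>G\<^esub>" i "n + i"] that nm c(1) act_one[OF base_pts[OF c(2)]] act_one[OF base_pts[OF b(1)]]
        by simp
      also have "\<dots> \<le> real_of_int e / real M"
        using De[OF _ that] pos by (intro divide_right_mono) auto
      also have "\<dots> \<le> 2 * \<epsilon>"
        using e pos by (simp add: field_simps)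
      finally show ?thesis .
    qed
    show "met L (act L (\<phi> h) (c (n + i))) (act L (\<phi> k) (c (n + j))) = d (h, i) (k, j) / real N"
      if "h \<in> H" "k \<in> H" "i < m" "j < m" for h k i j
      using c_dist[of h k "n + i" "n + j"] Dd[OF that] d'M that by simp
  qed
qed

text \<open>
  A point \<open>x = g b\<^sub>0\<close> outside the base is approximated by realizing a copy of \<open>x\<close> as an additional base
  point, since \<open>base_extension\<close> prescribes the metric only.
\<close>

lemma base_dense:
  assumes x: "x \<in> pts L" and S: "finite S" "S \<subseteq> base L" and \<epsilon>: "0 < \<epsilon>"
  obtains b where "b \<in> base L - S" "met L x b \<le> \<epsilon>"
proof -
  obtain g b0 where g: "g \<in> carrier (grp L)" and b0: "b0 \<in> base L" and x_eq: "x = act L g b0"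
    using base_orbit[OF x] .
  obtain F where F: "subgroup F (grp L)" "finite F" "g \<in> F"
    using locally_finite[of "{g}"] g by auto
  interpret F: subgroup F "grp L" by (rule F)
  define n where "n = card (insert b0 S)"
  obtain b where bij: "bij_betw b {..<n} (insert b0 S)"
    using ex_bij_betw_nat_finite[of "insert b0 S"] S by (auto simp: n_def atLeast0LessThan)
  have b: "b i \<in> base L" if "i < n" for i
    using bij_betwE[OF bij] that b0 S by auto
  obtain i0 where i0: "i0 < n" "b i0 = b0"
    using bij by (auto simp: bij_betw_def image_iff) (metis imageE insertI1 lessThan_iff)
  \<comment> \<open>The new entry lies in the orbit of \<open>b0\<close>, so the distances
    \<open>p\<close> along these orbits form only a pseudometric, and rounding separates the two
    descriptions of \<open>x\<close>.\<close>
  define w where "w = b(n := x)"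
  have w: "w i \<in> pts L" if "i < Suc n" for i
    using that b base_pts x by (auto simp: w_def less_Suc_eq)
  define p where "p = (\<lambda>y z. met L (act L (fst y) (w (snd y))) (act L (fst z) (w (snd z))))"
  have pt: "act L f (w i) \<in> pts L" if "f \<in> F" "i < Suc n" for f i
    using act_closed that w by simp
  obtain N d where N: "0 < N" and d: "invariant_metric (grp L) F (Suc n) d"
    and dp: "\<And>y z. \<lbrakk>y \<in> F \<times> {..<Suc n}; z \<in> F \<times> {..<Suc n}\<rbrakk> \<Longrightarrow> \<bar>d y z / real N - p y z\<bar> \<le> \<epsilon> / 3"
  proof (rule approx_invariant_metric[of F "Suc n" p "\<epsilon> / 3"])
    show "p x z \<le> p x y + p y z"
      if "x \<in> F \<times> {..<Suc n}" "y \<in> F \<times> {..<Suc n}" "z \<in> F \<times> {..<Suc n}" for x y z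
      unfolding p_def using pt that by (intro triangle) (simp_all add: mem_Times_iff)
    show "p x x = 0" if "x \<in> F \<times> {..<Suc n}" for x
      using pt that by (simp add: p_def mem_Times_iff)
    show "p (g \<otimes>\<^bsub>grp L\<^esub> h, i) (g \<otimes>\<^bsub>grp L\<^esub> k, j) = p (h, i) (k, j)"
      if "g \<in> F" "h \<in> F" "k \<in> F" "i < Suc n" "j < Suc n" for g h k i j
      using that act_isometric[OF _ pt pt] composition_rule[OF w] by (simp add: p_def)
  qed (use F \<epsilon> in \<open>simp_all add: p_def commute\<close>)
  have id_mon: "(\<lambda>f. f) \<in> mon (grp L\<lparr>carrier := F\<rparr>) (grp L)"
    "(\<lambda>f. f) \<in> mon (grp L\<lparr>carrier := F\<rparr>) (grp L\<lparr>carrier := F\<rparr>)"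
    by (rule monI; simp add: inj_on_def)+
  have pre: "0 < n" "n \<le> Suc n" "inj_on b {..<n}" "0 < \<epsilon> / 3"
    using i0 bij \<epsilon> by (simp_all add: bij_betw_def)
  have close: "\<bar>d (f, i) (k, j) / real N - met L (act L f (b i)) (act L k (b j))\<bar> \<le> \<epsilon> / 3"
    if "f \<in> F" "k \<in> F" "i < n" "j < n" for f k i j
    using dp[of "(f, i)" "(k, j)"] that by (simp add: p_def w_def)
  obtain \<phi> b' where "\<phi> \<in> mon (grp L\<lparr>carrier := F\<rparr>) (grp L)"
    and \<phi>: "\<And>f. f \<in> F \<Longrightarrow> \<phi> f = f"
    and b': "\<And>i. i < Suc n \<Longrightarrow> b' i \<in> base L" "\<And>i. i < Suc n \<Longrightarrow> b' i \<notin> b ` {..<n}"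
    and near: "\<And>i. i < n \<Longrightarrow> met L (b i) (b' i) \<le> 2 * (\<epsilon> / 3)"
    and dist: "\<And>h k i j. \<lbrakk>h \<in> F; k \<in> F; i < Suc n; j < Suc n\<rbrakk>
      \<Longrightarrow> met L (act L (\<phi> h) (b' i)) (act L (\<phi> k) (b' j)) = d (h, i) (k, j) / real N"
    by (rule base_extension[OF is_group F(1,2) F(1,2) id_mon(2,1) pre(1,2) N d b pre(3,4) close])
      (assumption | rule that)+
  show thesis
  proof (rule that[of "b' n"])
    show "b' n \<in> base L - S"
      using b'[of n] bij by (auto simp: bij_betw_def)
    \<comment> \<open>The two descriptions of \<open>x\<close>, as the translate of
      \<open>b0\<close> by \<open>g\<close> and as entry \<open>n\<close> of \<open>w\<close>, are
      prescribed to be nearly equal. So \<open>b' n\<close> is within \<open>\<epsilon> / 3\<close>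
      of the translate of \<open>b' i0\<close> by \<open>g\<close>, which is within two thirds of
      \<epsilon> of \<open>x\<close>.\<close>
    have "p (g, i0) (\<one>\<^bsub>grp L\<^esub>, n) = 0"
      using i0 x act_one by (simp add: p_def w_def x_eq)
    moreover have "met L (act L g (b' i0)) (b' n) = d (g, i0) (\<one>\<^bsub>grp L\<^esub>, n) / real N"
      using dist[of g "\<one>\<^bsub>grp L\<^esub>" i0 n] F(3) i0 \<phi> b' act_one base_pts by simp
    moreover have "\<bar>d (g, i0) (\<one>\<^bsub>grp L\<^esub>, n) / real N - p (g, i0) (\<one>\<^bsub>grp L\<^esub>, n)\<bar> \<le> \<epsilon> / 3"
      using dp[of "(g, i0)" "(\<one>\<^bsub>grp L\<^esub>, n)"] F(3) i0 by simp
    ultimately have "met L (act L g (b' i0)) (b' n) \<le> \<epsilon> / 3"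
      by linarith
    moreover have "met L x (act L g (b' i0)) = met L (b i0) (b' i0)"
      using act_isometric[OF g] base_pts b0 b' i0 by (simp add: x_eq)
    moreover have "met L x (b' n) \<le> met L x (act L g (b' i0)) + met L (act L g (b' i0)) (b' n)"
      using x b' base_pts act_closed g i0 by (intro triangle) simp_all
    ultimately show "met L x (b' n) \<le> \<epsilon>"
      using near[OF i0(1)] by linarith
  qed
qed

end

section \<open>Extensive actions\<close>

lemma isometriesD:
  assumes "f \<in> isometries"
  shows "dist (f x) (f y) = dist x y" "surj f" "inj f"
proof -
  show iso: "dist (f x) (f y) = dist x y" "surj f" for x y
    using assms by (simp_all add: isometries_def)
  show "inj f"
    by (rule injI) (metis iso(1) dist_eq_0_iff)
qed

lemma isometries_inv:
  assumes f: "f \<in> isometries"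
  shows "inv_into UNIV f \<in> isometries" "inv_into UNIV f (f x) = x" "f (inv_into UNIV f x) = x"
proof -
  note iso = isometriesD[OF f]
  show inv: "inv_into UNIV f (f x) = x" "f (inv_into UNIV f x) = x" for x
    using iso(2,3) by (simp_all add: surj_f_inv_f)
  have "dist (inv_into UNIV f x) (inv_into UNIV f y) = dist x y" for x y
    using iso(1)[of "inv_into UNIV f x" "inv_into UNIV f y"] inv(2) by simp
  moreover have "surj (inv_into UNIV f)"
    using inv(1) by (rule surjI)
  ultimately show "inv_into UNIV f \<in> isometries"
    by (simp add: isometries_def)
qed

lemma isometries_comp: "\<lbrakk>f \<in> isometries; g \<in> isometries\<rbrakk> \<Longrightarrow> f \<circ> g \<in> isometries"
  using comp_surj[of g f] by (simp add: isometries_def)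

locale isometric_action = group G for G :: "'g monoid" (structure) +
  fixes \<beta> :: "'g \<Rightarrow> 'u::metric_space \<Rightarrow> 'u"
  assumes Hom: "\<beta> \<in> Hom_Iso G"
begin

lemma isometry: "g \<in> carrier G \<Longrightarrow> \<beta> g \<in> isometries"
  using Hom by (auto simp: Hom_Iso_def hom_def Iso_group_def)

lemma dist_act [simp]: "g \<in> carrier G \<Longrightarrow> dist (\<beta> g x) (\<beta> g y) = dist x y"
  using isometriesD(1)[OF isometry] .

lemma act_mult: "\<lbrakk>g \<in> carrier G; h \<in> carrier G\<rbrakk> \<Longrightarrow> \<beta> (g \<otimes> h) x = \<beta> g (\<beta> h x)"
  using Hom by (simp add: Hom_Iso_def hom_def Iso_group_def)

lemma act_one [simp]: "\<beta> \<one> x = x"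
proof -
  have "\<beta> \<one> (\<beta> \<one> x) = \<beta> \<one> x"
    using act_mult[OF one_closed one_closed, of x] by simp
  then show ?thesis
    using dist_act[OF one_closed, of "\<beta> \<one> x" x] by simp
qed

lemma dist_approx_metric:
  fixes u :: "nat \<Rightarrow> 'u"
  assumes H: "subgroup H G" and "0 < \<epsilon>"
  obtains N d where "0 < N" "invariant_metric G H m d"
    and "\<And>h k i j. \<lbrakk>h \<in> H; k \<in> H; i < m; j < m\<rbrakk>
      \<Longrightarrow> \<bar>d (h, i) (k, j) / real N - dist (\<beta> h (u i)) (\<beta> k (u j))\<bar> \<le> \<epsilon>"
proof -
  interpret H: subgroup H G by (rule H)
  define p where "p = (\<lambda>x y. dist (\<beta> (fst x) (u (snd x))) (\<beta> (fst y) (u (snd y))))"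
  obtain N d where N: "0 < N" "invariant_metric G H m d"
    and d: "\<And>x y. \<lbrakk>x \<in> H \<times> {..<m}; y \<in> H \<times> {..<m}\<rbrakk> \<Longrightarrow> \<bar>d x y / real N - p x y\<bar> \<le> \<epsilon>"
  proof (rule approx_invariant_metric[OF H, of m p \<epsilon>])
    show "p x z \<le> p x y + p y z" for x y z
      unfolding p_def by (rule dist_triangle)
    show "p (g \<otimes> h, i) (g \<otimes> k, j) = p (h, i) (k, j)" if "g \<in> H" "h \<in> H" "k \<in> H" for g h k i j
      using that by (simp add: p_def act_mult)
  qed (use \<open>0 < \<epsilon>\<close> in \<open>simp_all add: p_def dist_commute\<close>)
  have "\<bar>d (h, i) (k, j) / real N - dist (\<beta> h (u i)) (\<beta> k (u j))\<bar> \<le> \<epsilon>"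
    if "h \<in> H" "k \<in> H" "i < m" "j < m" for h k i j
    using d[of "(h, i)" "(k, j)"] that by (simp add: p_def)
  with N show thesis
    by (rule that)
qed

end

text \<open>The condition \<open>0 < m\<close> leaves room to raise \<open>n\<close> from 0 to 1,
  which is how the case of no prescribed points is reduced to that of one.\<close>

definition extension_data ::
    "'g monoid \<Rightarrow> 'g set \<Rightarrow> 'g set \<Rightarrow> ('g \<Rightarrow> 'g) \<Rightarrow> nat \<Rightarrow> nat \<Rightarrow> ('g \<times> nat \<Rightarrow> 'g \<times> nat \<Rightarrow> int) \<Rightarrow> nat \<Rightarrow> bool"
  where
  "extension_data G F H \<theta> n m d N \<longleftrightarrow>
     subgroup F G \<and> finite F \<and> subgroup H G \<and> finite H
   \<and> \<theta> \<in> mon (G\<lparr>carrier := F\<rparr>) (G\<lparr>carrier := H\<rparr>)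
   \<and> n \<le> m \<and> 0 < m \<and> 0 < N \<and> invariant_metric G H m d"

text \<open>
  The premise is a closed and the conclusion an open condition on \<open>\<beta>\<close>, hence the instance as a
  whole is an open condition.
\<close>

definition extension_instance ::
    "'g monoid \<Rightarrow> real \<Rightarrow> 'g set \<Rightarrow> 'g set \<Rightarrow> ('g \<Rightarrow> 'g) \<Rightarrow> nat \<Rightarrow> nat \<Rightarrow> ('g \<times> nat \<Rightarrow> 'g \<times> nat \<Rightarrow> int) \<Rightarrow> nat
      \<Rightarrow> (nat \<Rightarrow> 'u) \<Rightarrow> real \<Rightarrow> real \<Rightarrow> ('g \<Rightarrow> 'u::metric_space \<Rightarrow> 'u) \<Rightarrow> bool" where
  "extension_instance G c F H \<theta> n m d N u \<epsilon> \<epsilon>' \<beta> \<longleftrightarrow>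
     (\<forall>f\<in>F. \<forall>k\<in>F. \<forall>i<n. \<forall>j<n. \<bar>d (\<theta> f, i) (\<theta> k, j) / N - dist (\<beta> f (u i)) (\<beta> k (u j))\<bar> \<le> \<epsilon>)
     \<longrightarrow> (\<exists>\<phi> v. \<phi> \<in> mon (G\<lparr>carrier := H\<rparr>) G \<and> (\<forall>f\<in>F. \<phi> (\<theta> f) = f) \<and> (\<forall>i<n. dist (u i) (v i) \<le> c * \<epsilon>)
          \<and> (\<forall>h\<in>H. \<forall>k\<in>H. \<forall>i<m. \<forall>j<m.
                \<bar>d (h, i) (k, j) / N - dist (\<beta> (\<phi> h) (v i)) (\<beta> (\<phi> k) (v j))\<bar> < \<epsilon>'))"

text \<open>The displacement is bounded by a fixed multiple of the error \<epsilon>, however small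
  the precision \<open>\<epsilon>'\<close> demanded; iterating with halved errors therefore moves
  points by a convergent series. The factor is a parameter because the reduction to countably many
  instances enlarges it.\<close>

definition extensive :: "'g monoid \<Rightarrow> real \<Rightarrow> ('g \<Rightarrow> 'u::metric_space \<Rightarrow> 'u) \<Rightarrow> bool" where
  "extensive G c \<beta> \<longleftrightarrow>
     (\<forall>F H \<theta> n m d N u \<epsilon> \<epsilon>'. extension_data G F H \<theta> n m d N \<longrightarrow> 0 < \<epsilon> \<longrightarrow> 0 < \<epsilon>'
        \<longrightarrow> extension_instance G c F H \<theta> n m d N u \<epsilon> \<epsilon>' \<beta>)"

lemma extensiveD:
  assumes "extensive G c \<beta>" "extension_data G F H \<theta> n m d N" "0 < \<epsilon>" "0 < \<epsilon>'"
    and "\<And>f k i j. \<lbrakk>f \<in> F; k \<in> F; i < n; j < n\<rbrakk>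
      \<Longrightarrow> \<bar>d (\<theta> f, i) (\<theta> k, j) / real N - dist (\<beta> f (u i)) (\<beta> k (u j))\<bar> \<le> \<epsilon>"
  obtains \<phi> v where "\<phi> \<in> mon (G\<lparr>carrier := H\<rparr>) G" "\<And>f. f \<in> F \<Longrightarrow> \<phi> (\<theta> f) = f"
    and "\<And>i. i < n \<Longrightarrow> dist (u i) (v i) \<le> c * \<epsilon>"
    and "\<And>h k i j. \<lbrakk>h \<in> H; k \<in> H; i < m; j < m\<rbrakk>
      \<Longrightarrow> \<bar>d (h, i) (k, j) / real N - dist (\<beta> (\<phi> h) (v i)) (\<beta> (\<phi> k) (v j))\<bar> < \<epsilon>'"
proof -
  have "extension_instance G c F H \<theta> n m d N u \<epsilon> \<epsilon>' \<beta>"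
    using assms(1-4) unfolding extensive_def by blast
  moreover have "\<forall>f\<in>F. \<forall>k\<in>F. \<forall>i<n. \<forall>j<n.
      \<bar>d (\<theta> f, i) (\<theta> k, j) / real N - dist (\<beta> f (u i)) (\<beta> k (u j))\<bar> \<le> \<epsilon>"
    using assms(5) by blast
  ultimately have "\<exists>\<phi> v. \<phi> \<in> mon (G\<lparr>carrier := H\<rparr>) G \<and> (\<forall>f\<in>F. \<phi> (\<theta> f) = f)
      \<and> (\<forall>i<n. dist (u i) (v i) \<le> c * \<epsilon>) \<and> (\<forall>h\<in>H. \<forall>k\<in>H. \<forall>i<m. \<forall>j<m.
          \<bar>d (h, i) (k, j) / N - dist (\<beta> (\<phi> h) (v i)) (\<beta> (\<phi> k) (v j))\<bar> < \<epsilon>')"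
    unfolding extension_instance_def by (rule mp)
  then show thesis
    by (elim exE conjE, intro that) (assumption | blast)+
qed

lemma extension_instance_mono:
  assumes "extension_instance G c F H \<theta> n m d N u \<epsilon> \<epsilon>' \<beta>" "c \<le> c'" "0 < \<epsilon>"
  shows "extension_instance G c' F H \<theta> n m d N u \<epsilon> \<epsilon>' \<beta>"
proof -
  have "c * \<epsilon> \<le> c' * \<epsilon>"
    using assms by simp
  then have weaken: "\<forall>i<n. dist (u i) (v i) \<le> c' * \<epsilon>" if "\<forall>i<n. dist (u i) (v i) \<le> c * \<epsilon>" for v
    using that by (meson order_trans)
  show ?thesis
    using assms(1) unfolding extension_instance_def
    by (elim imp_forward ex_forward conj_forward) (assumption | erule weaken)+
qed

lemma extensive_mono: "\<lbrakk>extensive G c \<beta>; c \<le> c'\<rbrakk> \<Longrightarrow> extensive G c' \<beta>"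
  unfolding extensive_def by (intro allI impI, rule extension_instance_mono[where c = c]) simp_all

section \<open>The universal action is extensive\<close>

locale completed_fraisse_limit = fraisse_limit L + G: group G
  for L :: "('h, 'x) pointed_action" and G :: "'g monoid" +
  fixes \<alpha> :: "'g \<Rightarrow> 'u::complete_space \<Rightarrow> 'u" and h :: "'h \<Rightarrow> 'g" and j :: "'x \<Rightarrow> 'u"
  assumes Hom: "\<alpha> \<in> Hom_Iso G"
    and h: "h \<in> iso (grp L) G"
    and j: "isometric_embedding (pts L) (met L) UNIV dist j" "closure (j ` pts L) = UNIV"
    and extends: "\<And>g x. \<lbrakk>g \<in> carrier (grp L); x \<in> pts L\<rbrakk> \<Longrightarrow> \<alpha> (h g) (j x) = j (act L g x)"
begin

sublocale \<alpha>: isometric_action G \<alpha>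
  by unfold_locales (rule Hom)

definition \<eta> where "\<eta> = inv_into (carrier (grp L)) h"

lemma h_bij: "bij_betw h (carrier (grp L)) (carrier G)" and h_mon: "h \<in> mon (grp L) G"
  using h by (auto simp: iso_def mon_def bij_betw_def)

lemma \<eta>_mon: "\<eta> \<in> mon G (grp L)"
  using mon_inv_into[OF h_mon is_group] h_bij by (simp add: \<eta>_def bij_betw_def)

lemma h_\<eta> [simp]: "g \<in> carrier G \<Longrightarrow> h (\<eta> g) = g"
  using h_bij by (simp add: \<eta>_def bij_betw_inv_into_right)

lemma dist_j: "\<lbrakk>x \<in> pts L; y \<in> pts L\<rbrakk> \<Longrightarrow> dist (j x) (j y) = met L x y"
  using j by (simp add: isometric_embedding_def)

lemma dist_act_j:
  assumes f: "f \<in> carrier (grp L)" "k \<in> carrier (grp L)" and x: "x \<in> pts L" "y \<in> pts L"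
  shows "dist (\<alpha> (h f) (j x)) (\<alpha> (h k) (j y)) = met L (act L f x) (act L k y)"
  unfolding extends[OF f(1) x(1)] extends[OF f(2) x(2)]
  by (rule dist_j[OF act_closed[OF f(1) x(1)] act_closed[OF f(2) x(2)]])

text \<open>\<open>base_extension\<close> asks for distinct base points although \<open>u\<close>
  may repeat, so each new one is chosen by \<open>base_dense\<close> outside the earlier
  ones.\<close>

lemma base_approx:
  fixes u :: "nat \<Rightarrow> 'u"
  assumes "0 < \<epsilon>"
  shows "\<exists>b. inj_on b {..<n} \<and> (\<forall>i<n. b i \<in> base L \<and> dist (u i) (j (b i)) \<le> \<epsilon>)"
proof (induction n)
  case 0
  then show ?case by simp
next
  case (Suc n)
  then obtain b where b: "inj_on b {..<n}" "\<forall>i<n. b i \<in> base L \<and> dist (u i) (j (b i)) \<le> \<epsilon>"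
    by blast
  have "u n \<in> closure (j ` pts L)"
    using j by simp
  then obtain x where x: "x \<in> pts L" "dist (j x) (u n) < \<epsilon> / 2"
    unfolding closure_approachable using \<open>0 < \<epsilon>\<close> half_gt_zero by blast
  obtain c where c: "c \<in> base L - b ` {..<n}" "met L x c \<le> \<epsilon> / 2"
  proof (rule base_dense[OF x(1), of "b ` {..<n}" "\<epsilon> / 2"])
    show "b ` {..<n} \<subseteq> base L"
      using b by auto
  qed (use \<open>0 < \<epsilon>\<close> in simp_all)
  have "dist (u n) (j c) \<le> \<epsilon>"
    using dist_triangle[of "u n" "j c" "j x"] x c dist_j[of x c] base_pts by (simp add: dist_commute)
  moreover have "inj_on (b(n := c)) {..<Suc n}"
    using b(1) c by (auto simp: lessThan_Suc inj_on_def)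
  moreover have "\<forall>i<Suc n. (b(n := c)) i \<in> base L \<and> dist (u i) (j ((b(n := c)) i)) \<le> \<epsilon>"
    using b(2) c \<open>dist (u n) (j c) \<le> \<epsilon>\<close> by (simp add: less_Suc_eq)
  ultimately show ?case
    by blast
qed

text \<open>The points \<open>u\<close> are replaced by base points within
  \<open>\<epsilon> / 5\<close>. This raises the error to \<open>7 / 5 * \<epsilon>\<close>, and
  \<open>base_extension\<close> moves by twice that; in multiples of \<epsilon> the total is
  \<open>1 / 5 + 14 / 5 = 3\<close>. The realization found there is exact, so every precision
  \<open>\<epsilon>'\<close> is met.\<close>

lemma extension_instance_pos:
  assumes data: "extension_data G F H \<theta> n m d N" and "0 < n" "0 < \<epsilon>" "0 < \<epsilon>'"
  shows "extension_instance G 3 F H \<theta> n m d N u \<epsilon> \<epsilon>' \<alpha>"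
  unfolding extension_instance_def
proof
  assume close: "\<forall>f\<in>F. \<forall>k\<in>F. \<forall>i<n. \<forall>j<n.
    \<bar>d (\<theta> f, i) (\<theta> k, j) / real N - dist (\<alpha> f (u i)) (\<alpha> k (u j))\<bar> \<le> \<epsilon>"
  have F: "subgroup F G" "finite F" and H: "subgroup H G" "finite H"
    and \<theta>: "\<theta> \<in> mon (G\<lparr>carrier := F\<rparr>) (G\<lparr>carrier := H\<rparr>)"
    and nm: "n \<le> m" and N: "0 < N" and d: "invariant_metric G H m d"
    using data by (simp_all add: extension_data_def)
  have F_carrier: "f \<in> carrier G" if "f \<in> F" for f
    using subgroup.mem_carrier[OF F(1) that] .
  obtain b where b: "inj_on b {..<n}" "\<And>i. i < n \<Longrightarrow> b i \<in> base L"
    and ub: "\<And>i. i < n \<Longrightarrow> dist (u i) (j (b i)) \<le> \<epsilon> / 5"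
    using base_approx[of "\<epsilon> / 5" n u] \<open>0 < \<epsilon>\<close> by auto
  have \<eta>_in: "\<eta> g \<in> carrier (grp L)" if "g \<in> carrier G" for g
    using monD(1)[OF \<eta>_mon that] .
  have \<eta>F: "\<eta> \<in> mon (G\<lparr>carrier := F\<rparr>) (grp L)"
  proof (rule monI)
    show "inj_on \<eta> (carrier (G\<lparr>carrier := F\<rparr>))"
      using monD(3)[OF \<eta>_mon] F_carrier by (auto simp: inj_on_def)
  qed (use monD(2)[OF \<eta>_mon] F_carrier \<eta>_in in simp_all)
  have close': "\<bar>d (\<theta> f, i) (\<theta> k, l) / real N - met L (act L (\<eta> f) (b i)) (act L (\<eta> k) (b l))\<bar>
      \<le> \<epsilon> + 2 * (\<epsilon> / 5)" if fk: "f \<in> F" "k \<in> F" "i < n" "l < n" for f k i l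
  proof -
    have "met L (act L (\<eta> f) (b i)) (act L (\<eta> k) (b l)) = dist (\<alpha> f (j (b i))) (\<alpha> k (j (b l)))"
      using dist_act_j[of "\<eta> f" "\<eta> k" "b i" "b l"] fk F_carrier \<eta>_in base_pts b by simp
    moreover have "\<bar>dist (\<alpha> f (j (b i))) (\<alpha> k (j (b l))) - dist (\<alpha> f (u i)) (\<alpha> k (u l))\<bar>
        \<le> dist (\<alpha> f (u i)) (\<alpha> f (j (b i))) + dist (\<alpha> k (u l)) (\<alpha> k (j (b l)))"
      by (smt (verit) dist_commute dist_triangle)
    moreover have "dist (\<alpha> f (u i)) (\<alpha> f (j (b i))) \<le> \<epsilon> / 5" "dist (\<alpha> k (u l)) (\<alpha> k (j (b l))) \<le> \<epsilon> / 5"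
      using ub fk F_carrier by simp_all
    moreover have "\<bar>d (\<theta> f, i) (\<theta> k, l) / real N - dist (\<alpha> f (u i)) (\<alpha> k (u l))\<bar> \<le> \<epsilon>"
      using close fk by blast
    ultimately show ?thesis
      by linarith
  qed
  have "0 < \<epsilon> + 2 * (\<epsilon> / 5)"
    using \<open>0 < \<epsilon>\<close> by simp
  obtain \<phi> b' where \<phi>: "\<phi> \<in> mon (G\<lparr>carrier := H\<rparr>) (grp L)" "\<And>f. f \<in> F \<Longrightarrow> \<phi> (\<theta> f) = \<eta> f"
    and b': "\<And>i. i < m \<Longrightarrow> b' i \<in> base L" "\<And>i. i < m \<Longrightarrow> b' i \<notin> b ` {..<n}"
    and near: "\<And>i. i < n \<Longrightarrow> met L (b i) (b' i) \<le> 2 * (\<epsilon> + 2 * (\<epsilon> / 5))"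
    and dist: "\<And>h k i j. \<lbrakk>h \<in> H; k \<in> H; i < m; j < m\<rbrakk>
      \<Longrightarrow> met L (act L (\<phi> h) (b' i)) (act L (\<phi> k) (b' j)) = d (h, i) (k, j) / real N"
    by (rule base_extension[OF G.is_group H F \<theta> \<eta>F \<open>0 < n\<close> nm N d b(2,1) \<open>0 < \<epsilon> + 2 * (\<epsilon> / 5)\<close> close'])
      (assumption | rule that)+
  have \<phi>_in: "\<phi> g \<in> carrier (grp L)" if "g \<in> H" for g
    using monD(1)[OF \<phi>(1)] that by simp
  show "\<exists>\<phi> v. \<phi> \<in> mon (G\<lparr>carrier := H\<rparr>) G \<and> (\<forall>f\<in>F. \<phi> (\<theta> f) = f) \<and> (\<forall>i<n. dist (u i) (v i) \<le> 3 * \<epsilon>)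
      \<and> (\<forall>h\<in>H. \<forall>k\<in>H. \<forall>i<m. \<forall>j<m.
            \<bar>d (h, i) (k, j) / real N - dist (\<alpha> (\<phi> h) (v i)) (\<alpha> (\<phi> k) (v j))\<bar> < \<epsilon>')"
  proof (intro exI[of _ "h \<circ> \<phi>"] exI[of _ "j \<circ> b'"] conjI ballI allI impI)
    show "h \<circ> \<phi> \<in> mon (G\<lparr>carrier := H\<rparr>) G"
      using \<phi>(1) h_mon by (rule mon_compose)
    show "(h \<circ> \<phi>) (\<theta> f) = f" if "f \<in> F" for f
      using \<phi>(2) that F_carrier by simp
    show "dist (u i) ((j \<circ> b') i) \<le> 3 * \<epsilon>" if i: "i < n" for i
    proof -
      have "dist (j (b i)) (j (b' i)) = met L (b i) (b' i)"
        using dist_j base_pts b b' i nm by simp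
      then show ?thesis
        using dist_triangle[of "u i" "j (b' i)" "j (b i)"] ub[OF i] near[OF i] by simp
    qed
    show "\<bar>d (g, i) (k, l) / real N - dist (\<alpha> ((h \<circ> \<phi>) g) ((j \<circ> b') i)) (\<alpha> ((h \<circ> \<phi>) k) ((j \<circ> b') l))\<bar> < \<epsilon>'"
      if gk: "g \<in> H" "k \<in> H" "i < m" "l < m" for g k i l
    proof -
      have "dist (\<alpha> (h (\<phi> g)) (j (b' i))) (\<alpha> (h (\<phi> k)) (j (b' l))) = d (g, i) (k, l) / real N"
        unfolding dist_act_j[OF \<phi>_in[OF gk(1)] \<phi>_in[OF gk(2)] base_pts[OF b'(1)[OF gk(3)]] base_pts[OF b'(1)[OF gk(4)]]]
        by (rule dist[OF gk])
      then show ?thesis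
        using \<open>0 < \<epsilon>'\<close> by simp
    qed
  qed
qed

lemma extensive: "extensive G 3 \<alpha>"
  unfolding extensive_def
proof (intro allI impI)
  fix F H \<theta> n m d N and u :: "nat \<Rightarrow> 'u" and \<epsilon> \<epsilon>' :: real
  assume data: "extension_data G F H \<theta> n m d N" and pos: "0 < \<epsilon>" "0 < \<epsilon>'"
  show "extension_instance G 3 F H \<theta> n m d N u \<epsilon> \<epsilon>' \<alpha>"
  proof (cases "n = 0")
    case False
    then show ?thesis
      using extension_instance_pos[OF data _ pos] by simp
  next
    case True
    \<comment> \<open>With no points prescribed, take an arbitrary one and no precision.\<close>
    define q where "q = (\<lambda>(f, k). \<bar>d (\<theta> f, 0) (\<theta> k, 0) / real N - dist (\<alpha> f (u 0)) (\<alpha> k (u 0))\<bar>)"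
    define K where "K = sum q (F \<times> F) + 1"
    have "finite F"
      using data by (simp add: extension_data_def)
    have q: "0 \<le> q x" for x
      by (cases x) (simp add: q_def)
    have K: "q x \<le> K" if "x \<in> F \<times> F" for x
      using member_le_sum[OF that, of q] q \<open>finite F\<close> unfolding K_def by fastforce
    have "0 \<le> sum q (F \<times> F)"
      using q by (rule sum_nonneg)
    then have "0 < K"
      by (simp add: K_def)
    moreover have "extension_data G F H \<theta> 1 m d N"
      using data by (simp add: extension_data_def)
    ultimately have "extension_instance G 3 F H \<theta> 1 m d N u K \<epsilon>' \<alpha>"
      using extension_instance_pos[of F H \<theta> 1 m d N K \<epsilon>' u] pos by simp
    moreover have "\<forall>f\<in>F. \<forall>k\<in>F. \<forall>i<1. \<forall>j<1.
        \<bar>d (\<theta> f, i) (\<theta> k, j) / real N - dist (\<alpha> f (u i)) (\<alpha> k (u j))\<bar> \<le> K"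
      using K[of "(_, _)"] by (simp add: q_def)
    ultimately show ?thesis
      using True unfolding extension_instance_def by auto
  qed
qed

end

section \<open>Back and forth\<close>

lemma geometric_limit:
  fixes x :: "nat \<Rightarrow> 'u::complete_space"
  assumes "\<And>l. k \<le> l \<Longrightarrow> dist (x l) (x (Suc l)) \<le> C / 2 ^ l"
  obtains z where "x \<longlonglongrightarrow> z" "\<And>l. k \<le> l \<Longrightarrow> dist (x l) z \<le> 2 * C / 2 ^ l"
proof -
  have step: "dist (x l) (x (l + m)) \<le> 2 * C / 2 ^ l * (1 - 1 / 2 ^ m)" if "k \<le> l" for l m
  proof (induction m)
    case 0
    then show ?case by simp
  next
    case (Suc m)
    have "dist (x l) (x (l + Suc m)) \<le> dist (x l) (x (l + m)) + dist (x (l + m)) (x (Suc (l + m)))"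
      using dist_triangle by simp
    also have "\<dots> \<le> 2 * C / 2 ^ l * (1 - 1 / 2 ^ m) + C / 2 ^ (l + m)"
      using Suc assms[of "l + m"] that by (intro add_mono) simp_all
    also have "\<dots> = 2 * C / 2 ^ l * (1 - 1 / 2 ^ Suc m)"
      by (simp add: power_add field_simps)
    finally show ?case .
  qed
  have "0 \<le> C / 2 ^ k"
    using assms[of k] zero_le_dist[of "x k" "x (Suc k)"] by linarith
  from mult_nonneg_nonneg[OF this, of "2 ^ k"] have "0 \<le> C"
    by simp
  have bound: "dist (x l) (x m) \<le> 2 * C / 2 ^ l" if "k \<le> l" "l \<le> m" for l m
  proof -
    have "2 * C / 2 ^ l * (1 - 1 / 2 ^ (m - l)) \<le> 2 * C / 2 ^ l * 1"
      using \<open>0 \<le> C\<close> by (intro mult_left_mono) simp_all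
    then show ?thesis
      using step[OF that(1), of "m - l"] that(2) by simp
  qed
  have "(\<lambda>l. 2 * C * (1 / 2) ^ l) \<longlonglongrightarrow> 2 * C * 0"
    by (intro tendsto_intros) simp_all
  then have lim0: "(\<lambda>l. 2 * C / 2 ^ l) \<longlonglongrightarrow> 0"
    by (simp add: power_one_over)
  have "Cauchy x"
    unfolding Cauchy_altdef
  proof (intro allI impI)
    fix e :: real assume "0 < e"
    with lim0 have "eventually (\<lambda>l. 2 * C / 2 ^ l < e) sequentially"
      by (rule order_tendstoD)
    then obtain L where L: "\<And>l. L \<le> l \<Longrightarrow> 2 * C / 2 ^ l < e"
      by (auto simp: eventually_sequentially)
    have "dist (x m) (x n) < e" if "max k L \<le> m" "m < n" for m n
      using bound[of m n] L[of m] that by simp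
    then show "\<exists>M. \<forall>m\<ge>M. \<forall>n>m. dist (x m) (x n) < e"
      by blast
  qed
  then obtain z where z: "x \<longlonglongrightarrow> z"
    using Cauchy_convergent convergentD by blast
  have "dist (x l) z \<le> 2 * C / 2 ^ l" if "k \<le> l" for l
  proof (rule LIMSEQ_le_const2)
    show "(\<lambda>m. dist (x l) (x m)) \<longlonglongrightarrow> dist (x l) z"
      by (intro tendsto_intros z)
    show "\<exists>N. \<forall>m\<ge>N. dist (x l) (x m) \<le> 2 * C / 2 ^ l"
      using bound that by blast
  qed
  with z that show thesis
    by blast
qed

lemma dist_dense_eqD:
  fixes y z :: "'u::metric_space"
  assumes dense: "\<And>x e :: real. 0 < e \<Longrightarrow> \<exists>i\<in>I. dist (b i) x < e"
    and "\<And>i. i \<in> I \<Longrightarrow> dist y (b i) = dist z (b i)"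
  shows "y = z"
proof (rule ccontr)
  assume "y \<noteq> z"
  then obtain i where i: "i \<in> I" "dist (b i) y < dist y z / 2"
    using dense[of "dist y z / 2" y] by auto
  then have "dist z (b i) < dist y z / 2"
    using assms(2)[of i] by (simp add: dist_commute)
  with i show False
    using dist_triangle[of y z "b i"] by (simp add: dist_commute)
qed

text \<open>Indexed families are used because the points may repeat. \<open>\<Phi> x\<close> is
  obtained as the limit of \<open>b\<close> along indices at which \<open>a\<close> converges to
  \<open>x\<close>. The conclusion describes it by its distances to the dense points
  \<open>b i\<close>, the form in which \<open>dist_dense_eqD\<close> identifies points.\<close>

lemma isometry_extension:
  fixes a b :: "'i \<Rightarrow> 'u::complete_space"
  assumes iso: "\<And>i j. \<lbrakk>i \<in> I; j \<in> I\<rbrakk> \<Longrightarrow> dist (a i) (a j) = dist (b i) (b j)"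
    and dense_a: "\<And>x e :: real. 0 < e \<Longrightarrow> \<exists>i\<in>I. dist (a i) x < e"
    and dense_b: "\<And>x e :: real. 0 < e \<Longrightarrow> \<exists>i\<in>I. dist (b i) x < e"
  obtains \<Phi> where "\<Phi> \<in> isometries" "\<And>x i. i \<in> I \<Longrightarrow> dist (\<Phi> x) (b i) = dist x (a i)"
proof -
  \<comment> \<open>Proved for arbitrary families, so that exchanging them yields the inverse
    map.\<close>
  have ex: "\<exists>y. \<forall>i\<in>I. dist y (b i) = dist x (a i)"
    if iso: "\<And>i j. \<lbrakk>i \<in> I; j \<in> I\<rbrakk> \<Longrightarrow> dist (a i) (a j) = dist (b i) (b j)"
      and dense: "\<And>x e :: real. 0 < e \<Longrightarrow> \<exists>i\<in>I. dist (a i) x < e" for a b :: "'i \<Rightarrow> 'u" and x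
  proof -
    have "\<forall>n. \<exists>i\<in>I. dist (a i) x < 1 / 2 ^ n"
      using dense by simp
    then obtain s where s: "\<And>n. s n \<in> I" "\<And>n. dist (a (s n)) x < 1 / 2 ^ n"
      by metis
    have step: "dist (b (s l)) (b (s (Suc l))) \<le> 2 / 2 ^ l" for l
    proof -
      have "dist (b (s l)) (b (s (Suc l))) = dist (a (s l)) (a (s (Suc l)))"
        using iso s(1) by simp
      also have "\<dots> \<le> dist (a (s l)) x + dist (a (s (Suc l))) x"
        by (rule dist_triangle2)
      also have "\<dots> \<le> 1 / 2 ^ l + 1 / 2 ^ Suc l"
        using s(2)[of l] s(2)[of "Suc l"] by linarith
      also have "\<dots> \<le> 2 / 2 ^ l"
        by (simp add: field_simps)
      finally show ?thesis .
    qed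
    obtain y where y: "(\<lambda>n. b (s n)) \<longlonglongrightarrow> y"
      by (rule geometric_limit[of 0 "\<lambda>n. b (s n)" 2, OF step]) (rule that)
    have "(\<lambda>n. dist (a (s n)) x) \<longlonglongrightarrow> 0"
    proof (rule real_tendsto_sandwich[of "\<lambda>_. 0" _ _ "\<lambda>n. (1 / 2) ^ n"])
      show "(\<lambda>n. (1 / 2 :: real) ^ n) \<longlonglongrightarrow> 0"
        by (rule LIMSEQ_power_zero) simp
      show "eventually (\<lambda>n. dist (a (s n)) x \<le> (1 / 2) ^ n) sequentially"
        using s(2) by (intro always_eventually allI less_imp_le) (simp add: power_one_over)
    qed simp_all
    then have x: "(\<lambda>n. a (s n)) \<longlonglongrightarrow> x"
      by (rule iffD2[OF tendsto_dist_iff])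
    have "dist y (b i) = dist x (a i)" if "i \<in> I" for i
    proof (rule LIMSEQ_unique)
      show "(\<lambda>n. dist (b (s n)) (b i)) \<longlonglongrightarrow> dist y (b i)"
        by (intro tendsto_intros y)
      have "(\<lambda>n. dist (a (s n)) (a i)) \<longlonglongrightarrow> dist x (a i)"
        by (intro tendsto_intros x)
      then show "(\<lambda>n. dist (b (s n)) (b i)) \<longlonglongrightarrow> dist x (a i)"
        using iso s(1) that by simp
    qed
    then show ?thesis
      by blast
  qed
  obtain \<Phi> where \<Phi>: "\<And>x i. i \<in> I \<Longrightarrow> dist (\<Phi> x) (b i) = dist x (a i)"
    using ex[OF iso dense_a] by metis
  obtain \<Phi>' where \<Phi>': "\<And>x i. i \<in> I \<Longrightarrow> dist (\<Phi>' x) (a i) = dist x (b i)"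
    using ex[OF iso[symmetric] dense_b] by metis
  have "\<Phi> (\<Phi>' y) = y" for y
    by (rule dist_dense_eqD[of I b, OF dense_b]) (simp_all add: \<Phi> \<Phi>')
  then have "surj \<Phi>"
    by (rule surjI)
  moreover have "dist (\<Phi> x) (\<Phi> y) = dist x y" for x y
  proof (rule ccontr)
    assume neq: "dist (\<Phi> x) (\<Phi> y) \<noteq> dist x y"
    define e where "e = \<bar>dist (\<Phi> x) (\<Phi> y) - dist x y\<bar> / 2"
    obtain i where i: "i \<in> I" "dist (a i) y < e"
      using dense_a[of e y] neq by (auto simp: e_def)
    have "dist (\<Phi> x) (b i) = dist x (a i)" "dist (\<Phi> y) (b i) < e"
      using \<Phi> i by (simp_all add: dist_commute)
    moreover have "\<bar>dist (\<Phi> x) (\<Phi> y) - dist (\<Phi> x) (b i)\<bar> \<le> dist (\<Phi> y) (b i)"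
      "\<bar>dist x y - dist x (a i)\<bar> \<le> dist (a i) y"
      by (metis abs_dist_diff_le dist_commute)+
    ultimately have "\<bar>dist (\<Phi> x) (\<Phi> y) - dist x y\<bar> < 2 * e"
      using i(2) by linarith
    then show False
      by (simp add: e_def)
  qed
  ultimately have "\<Phi> \<in> isometries"
    by (simp add: isometries_def)
  with \<Phi> that show thesis
    by blast
qed

section \<open>The back-and-forth construction\<close>

locale countable_locally_finite_group = group G for G :: "'g monoid" (structure) +
  assumes countable_carrier: "countable (carrier G)"
    and locally_finite: "\<And>S. \<lbrakk>finite S; S \<subseteq> carrier G\<rbrakk> \<Longrightarrow> \<exists>F. subgroup F G \<and> finite F \<and> S \<subseteq> F"

text \<open>A state of the back-and-forth: \<open>\<psi>\<close> is a finite part of the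
  automorphism, and along it the orbits of \<open>u\<close> and \<open>w\<close> are isometric up to
  \<epsilon>. The error is measured on whole \<open>F\<close>-orbits because the premise of
  \<open>extension_instance\<close> is.\<close>

definition matched ::
    "'g monoid \<Rightarrow> ('g \<Rightarrow> 'u::metric_space \<Rightarrow> 'u) \<Rightarrow> ('g \<Rightarrow> 'u \<Rightarrow> 'u)
      \<Rightarrow> 'g set \<Rightarrow> ('g \<Rightarrow> 'g) \<Rightarrow> nat \<Rightarrow> (nat \<Rightarrow> 'u) \<Rightarrow> (nat \<Rightarrow> 'u) \<Rightarrow> real \<Rightarrow> bool" where
  "matched G \<beta> \<gamma> F \<psi> n u w \<epsilon> \<longleftrightarrow>
     subgroup F G \<and> finite F \<and> \<psi> \<in> mon (G\<lparr>carrier := F\<rparr>) G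
   \<and> (\<forall>f\<in>F. \<forall>k\<in>F. \<forall>i<n. \<forall>j<n.
        \<bar>dist (\<beta> f (u i)) (\<beta> k (u j)) - dist (\<gamma> (\<psi> f) (w i)) (\<gamma> (\<psi> k) (w j))\<bar> \<le> \<epsilon>)"

text \<open>Exchanging the two actions turns a back step into a forth step.\<close>

lemma matched_swap:
  assumes "group G" "matched G \<beta> \<gamma> F \<psi> n u w \<epsilon>"
  shows "matched G \<gamma> \<beta> (\<psi> ` F) (inv_into F \<psi>) n w u \<epsilon>"
proof -
  have F: "subgroup F G" "finite F" and \<psi>: "\<psi> \<in> mon (G\<lparr>carrier := F\<rparr>) G"
    and close: "\<And>f k i j. \<lbrakk>f \<in> F; k \<in> F; i < n; j < n\<rbrakk>
      \<Longrightarrow> \<bar>dist (\<beta> f (u i)) (\<beta> k (u j)) - dist (\<gamma> (\<psi> f) (w i)) (\<gamma> (\<psi> k) (w j))\<bar> \<le> \<epsilon>"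
    using assms(2) by (simp_all add: matched_def)
  have inj: "inj_on \<psi> F"
    using monD(3)[OF \<psi>] by simp
  have grpF: "group (G\<lparr>carrier := F\<rparr>)"
    using assms(1) F(1) by (rule group.subgroup_imp_group)
  have inv: "inv_into F \<psi> \<in> mon (G\<lparr>carrier := \<psi> ` F\<rparr>) (G\<lparr>carrier := F\<rparr>)"
    using mon_inv_into[OF \<psi> grpF] by simp
  have "inv_into F \<psi> \<in> mon (G\<lparr>carrier := \<psi> ` F\<rparr>) G"
  proof (rule monI)
    show "inv_into F \<psi> x \<in> carrier G" if "x \<in> carrier (G\<lparr>carrier := \<psi> ` F\<rparr>)" for x
      using monD(1)[OF inv that] subgroup.mem_carrier[OF F(1)] by simp
  qed (use monD(2,3)[OF inv] in simp_all)
  moreover have "subgroup (\<psi> ` F) G"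
    using mon_image_subgroup[OF \<psi> assms(1,1) F(1)] .
  ultimately show ?thesis
    unfolding matched_def using F(2) inj close by (simp add: abs_minus_commute)
qed

context countable_locally_finite_group
begin

text \<open>The distances of \<beta> on the orbits of \<open>u'\<close> under a larger finite group
  \<open>H\<close> are rounded and prescribed to \<gamma>, with the image of \<open>F\<close> under
  \<open>\<psi>\<close> as the old subgroup and the inverse of \<open>\<psi>\<close> as its
  embedding into \<open>H\<close>. Matching and rounding each contribute at most \<epsilon> to the
  error, so extensiveness with constant 5 moves \<open>w\<close> by at most
  \<open>10 * \<epsilon>\<close>, while the old entries of \<open>u\<close> stay. Half of the new
  error \<open>\<epsilon>'\<close> is left to the rounding and half to the realization.\<close>

lemma forth:
  fixes \<beta> \<gamma> :: "'g \<Rightarrow> 'u::complete_space \<Rightarrow> 'u"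
  assumes \<beta>: "isometric_action G \<beta>" and \<gamma>: "extensive G 5 \<gamma>"
    and matched: "matched G \<beta> \<gamma> F \<psi> n u w \<epsilon>" and pos: "0 < \<epsilon>" "0 < \<epsilon>'" and g: "g \<in> carrier G"
  obtains F' \<psi>' u' w' where "matched G \<beta> \<gamma> F' \<psi>' (Suc n) u' w' \<epsilon>'" "F \<subseteq> F'" "g \<in> F'"
    and "\<And>f. f \<in> F \<Longrightarrow> \<psi>' f = \<psi> f"
    and "\<And>i. i < n \<Longrightarrow> u' i = u i" "u' n = p" "\<And>i. i < n \<Longrightarrow> dist (w i) (w' i) \<le> 10 * \<epsilon>"
proof -
  interpret \<beta>: isometric_action G \<beta> by (rule \<beta>)
  have F: "subgroup F G" "finite F" and \<psi>: "\<psi> \<in> mon (G\<lparr>carrier := F\<rparr>) G"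
    and close: "\<And>f k i j. \<lbrakk>f \<in> F; k \<in> F; i < n; j < n\<rbrakk>
      \<Longrightarrow> \<bar>dist (\<beta> f (u i)) (\<beta> k (u j)) - dist (\<gamma> (\<psi> f) (w i)) (\<gamma> (\<psi> k) (w j))\<bar> \<le> \<epsilon>"
    using matched by (simp_all add: matched_def)
  obtain H where H: "subgroup H G" "finite H" "insert g F \<subseteq> H"
    using locally_finite[of "insert g F"] F g subgroup.subset by blast
  define u' where "u' = u(n := p)"
  have min_pos: "0 < min \<epsilon> (\<epsilon>' / 2)"
    using pos by simp
  obtain N d where N: "0 < N" "invariant_metric G H (Suc n) d"
    and d: "\<And>h k i j. \<lbrakk>h \<in> H; k \<in> H; i < Suc n; j < Suc n\<rbrakk>
      \<Longrightarrow> \<bar>d (h, i) (k, j) / real N - dist (\<beta> h (u' i)) (\<beta> k (u' j))\<bar> \<le> min \<epsilon> (\<epsilon>' / 2)"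
    by (rule \<beta>.dist_approx_metric[OF H(1) min_pos, of "Suc n" u']) (assumption | rule that)+
  define \<theta> where "\<theta> = inv_into F \<psi>"
  have \<theta>\<psi>: "\<theta> (\<psi> f) = f" if "f \<in> F" for f
    using monD(3)[OF \<psi>] that by (simp add: \<theta>_def)
  have swap: "matched G \<gamma> \<beta> (\<psi> ` F) \<theta> n w u \<epsilon>"
    unfolding \<theta>_def using is_group matched by (rule matched_swap)
  have \<theta>: "\<theta> \<in> mon (G\<lparr>carrier := \<psi> ` F\<rparr>) (G\<lparr>carrier := H\<rparr>)"
  proof (rule monI)
    have \<theta>_mon: "\<theta> \<in> mon (G\<lparr>carrier := \<psi> ` F\<rparr>) G"
      using swap by (simp add: matched_def)
    show "\<theta> x \<in> carrier (G\<lparr>carrier := H\<rparr>)" if "x \<in> carrier (G\<lparr>carrier := \<psi> ` F\<rparr>)" for x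
      using that H(3) \<theta>\<psi> by auto
    show "\<theta> (x \<otimes>\<^bsub>G\<lparr>carrier := \<psi> ` F\<rparr>\<^esub> y) = \<theta> x \<otimes>\<^bsub>G\<lparr>carrier := H\<rparr>\<^esub> \<theta> y"
      if "x \<in> carrier (G\<lparr>carrier := \<psi> ` F\<rparr>)" "y \<in> carrier (G\<lparr>carrier := \<psi> ` F\<rparr>)" for x y
      using monD(2)[OF \<theta>_mon that] by simp
    show "inj_on \<theta> (carrier (G\<lparr>carrier := \<psi> ` F\<rparr>))"
      using monD(3)[OF \<theta>_mon] .
  qed
  have data: "extension_data G (\<psi> ` F) H \<theta> n (Suc n) d N"
    using swap H \<theta> N by (simp add: extension_data_def matched_def)
  have close': "\<bar>d (\<theta> f, i) (\<theta> k, j) / real N - dist (\<gamma> f (w i)) (\<gamma> k (w j))\<bar> \<le> 2 * \<epsilon>"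
    if fk: "f \<in> \<psi> ` F" "k \<in> \<psi> ` F" "i < n" "j < n" for f k i j
  proof -
    obtain f' k' where f': "f' \<in> F" "f = \<psi> f'" and k': "k' \<in> F" "k = \<psi> k'"
      using fk by blast
    have "\<bar>d (f', i) (k', j) / real N - dist (\<beta> f' (u i)) (\<beta> k' (u j))\<bar> \<le> \<epsilon>"
      using d[of f' k' i j] f' k' fk H(3) by (auto simp: u'_def)
    then show ?thesis
      using close[OF f'(1) k'(1) fk(3,4)] f' k' \<theta>\<psi> by simp
  qed
  have pos': "0 < 2 * \<epsilon>" "0 < \<epsilon>' / 2"
    using pos by simp_all
  obtain \<phi> v where \<phi>: "\<phi> \<in> mon (G\<lparr>carrier := H\<rparr>) G" "\<And>f. f \<in> \<psi> ` F \<Longrightarrow> \<phi> (\<theta> f) = f"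
    and v: "\<And>i. i < n \<Longrightarrow> dist (w i) (v i) \<le> 5 * (2 * \<epsilon>)"
    and dist: "\<And>h k i j. \<lbrakk>h \<in> H; k \<in> H; i < Suc n; j < Suc n\<rbrakk>
      \<Longrightarrow> \<bar>d (h, i) (k, j) / real N - dist (\<gamma> (\<phi> h) (v i)) (\<gamma> (\<phi> k) (v j))\<bar> < \<epsilon>' / 2"
    by (rule extensiveD[OF \<gamma> data pos' close']) (assumption | rule that)+
  show thesis
  proof (rule that[of H \<phi> u' v])
    show "matched G \<beta> \<gamma> H \<phi> (Suc n) u' v \<epsilon>'"
      unfolding matched_def
    proof (intro conjI ballI allI impI H \<phi>(1))
      fix f k i j assume "f \<in> H" "k \<in> H" "i < Suc n" "j < Suc n"
      from d[OF this] dist[OF this]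
      show "\<bar>dist (\<beta> f (u' i)) (\<beta> k (u' j)) - dist (\<gamma> (\<phi> f) (v i)) (\<gamma> (\<phi> k) (v j))\<bar> \<le> \<epsilon>'"
        by linarith
    qed
    show "\<phi> f = \<psi> f" if "f \<in> F" for f
      using \<phi>(2)[of "\<psi> f"] that \<theta>\<psi> by simp
  qed (use H v in \<open>simp_all add: u'_def\<close>)
qed

text \<open>The forth step lowers the error to \<open>\<epsilon>'\<close> and moves
  \<open>w\<close>; the back step starts from that error and moves \<open>u\<close> by at most
  \<open>10 * \<epsilon>'\<close>. It also moves the copy of \<open>p\<close> that the forth step
  added to \<open>u\<close>, whereas the copy that it adds to \<open>w\<close> itself is exact. This
  explains the asymmetry of the last two conclusions.\<close>

lemma back_and_forth_step:
  fixes \<beta> \<gamma> :: "'g \<Rightarrow> 'u::complete_space \<Rightarrow> 'u"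
  assumes \<beta>: "isometric_action G \<beta>" "extensive G 5 \<beta>" and \<gamma>: "isometric_action G \<gamma>" "extensive G 5 \<gamma>"
    and matched: "matched G \<beta> \<gamma> F \<psi> n u w \<epsilon>" and pos: "0 < \<epsilon>'" "\<epsilon>' \<le> \<epsilon>" and g: "g \<in> carrier G"
  obtains F' \<psi>' u' w' where "matched G \<beta> \<gamma> F' \<psi>' (Suc (Suc n)) u' w' \<epsilon>'" "F \<subseteq> F'"
    and "g \<in> F'" "g \<in> \<psi>' ` F'" "\<And>f. f \<in> F \<Longrightarrow> \<psi>' f = \<psi> f"
    and "\<And>i. i < n \<Longrightarrow> dist (u i) (u' i) \<le> 10 * \<epsilon>" "\<And>i. i < n \<Longrightarrow> dist (w i) (w' i) \<le> 10 * \<epsilon>"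
    and "dist (u' n) p \<le> 10 * \<epsilon>'" "w' (Suc n) = p"
proof -
  have "0 < \<epsilon>"
    using pos by simp
  obtain F1 \<psi>1 u1 w1 where m1: "matched G \<beta> \<gamma> F1 \<psi>1 (Suc n) u1 w1 \<epsilon>'" and F1: "F \<subseteq> F1" "g \<in> F1"
    and \<psi>1: "\<And>f. f \<in> F \<Longrightarrow> \<psi>1 f = \<psi> f"
    and u1: "\<And>i. i < n \<Longrightarrow> u1 i = u i" "u1 n = p" and w1: "\<And>i. i < n \<Longrightarrow> dist (w i) (w1 i) \<le> 10 * \<epsilon>"
    by (rule forth[OF \<beta>(1) \<gamma>(2) matched \<open>0 < \<epsilon>\<close> pos(1) g, of p]) (assumption | rule that)+
  define \<chi>1 where "\<chi>1 = inv_into F1 \<psi>1"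
  have m1': "matched G \<gamma> \<beta> (\<psi>1 ` F1) \<chi>1 (Suc n) w1 u1 \<epsilon>'"
    unfolding \<chi>1_def using is_group m1 by (rule matched_swap)
  obtain F2 \<chi>2 w2 u2 where m2: "matched G \<gamma> \<beta> F2 \<chi>2 (Suc (Suc n)) w2 u2 \<epsilon>'"
    and F2: "\<psi>1 ` F1 \<subseteq> F2" "g \<in> F2" and \<chi>2: "\<And>f. f \<in> \<psi>1 ` F1 \<Longrightarrow> \<chi>2 f = \<chi>1 f"
    and w2: "\<And>i. i < Suc n \<Longrightarrow> w2 i = w1 i" "w2 (Suc n) = p"
    and u2: "\<And>i. i < Suc n \<Longrightarrow> dist (u1 i) (u2 i) \<le> 10 * \<epsilon>'"
    by (rule forth[OF \<gamma>(1) \<beta>(2) m1' pos(1,1) g, of p]) (assumption | rule that)+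
  define \<psi>2 where "\<psi>2 = inv_into F2 \<chi>2"
  have m3: "matched G \<beta> \<gamma> (\<chi>2 ` F2) \<psi>2 (Suc (Suc n)) u2 w2 \<epsilon>'"
    unfolding \<psi>2_def using is_group m2 by (rule matched_swap)
  have "\<psi>1 \<in> mon (G\<lparr>carrier := F1\<rparr>) G" "\<chi>2 \<in> mon (G\<lparr>carrier := F2\<rparr>) G"
    using m1 m2 by (simp_all add: matched_def)
  then have "inj_on \<psi>1 F1" "inj_on \<chi>2 F2"
    using monD(3) by fastforce+
  then have \<chi>1\<psi>1: "\<chi>1 (\<psi>1 f) = f" if "f \<in> F1" for f
    using that by (simp add: \<chi>1_def)
  have \<psi>2\<chi>2: "\<psi>2 (\<chi>2 f) = f" if "f \<in> F2" for f
    using that \<open>inj_on \<chi>2 F2\<close> by (simp add: \<psi>2_def)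
  \<comment> \<open>The back step extends the inverse of \<open>\<psi>1\<close>. Hence the new
    domain, the image of \<open>F2\<close> under \<open>\<chi>2\<close>, contains \<open>F1\<close>,
    and \<open>\<psi>2\<close> extends \<open>\<psi>1\<close>.\<close>
  have F1_eq: "\<chi>2 (\<psi>1 f) = f" if "f \<in> F1" for f
    using \<chi>2 \<chi>1\<psi>1 that by simp
  have F1_F2: "F1 \<subseteq> \<chi>2 ` F2"
    using F1_eq F2(1) by (metis image_subset_iff rev_image_eqI subsetI)
  show thesis
  proof (rule that[OF m3])
    show "F \<subseteq> \<chi>2 ` F2" "g \<in> \<chi>2 ` F2"
      using F1 F1_F2 by blast+
    show "g \<in> \<psi>2 ` \<chi>2 ` F2"
      using \<psi>2\<chi>2 F2(2) by force
    show "\<psi>2 f = \<psi> f" if "f \<in> F" for f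
    proof -
      have "\<psi>1 f \<in> F2" "f = \<chi>2 (\<psi>1 f)"
        using that F1 F2 F1_eq by auto
      then show ?thesis
        using \<psi>2\<chi>2[of "\<psi>1 f"] \<psi>1[OF that] by simp
    qed
    show "dist (u i) (u2 i) \<le> 10 * \<epsilon>" if "i < n" for i
      using u2[of i] u1(1)[of i] that pos by simp
    show "dist (w i) (w2 i) \<le> 10 * \<epsilon>" if "i < n" for i
      using w2(1)[of i] w1[of i] that by simp
    show "dist (u2 n) p \<le> 10 * \<epsilon>'"
      using u2[of n] u1(2) by (simp add: dist_commute)
  qed (fact w2(2))
qed

text \<open>Stage \<open>k\<close> has error \<open>\<epsilon> / 2 ^ k\<close> and moves each entry
  by at most ten times that, so each tuple drifts by at most \<open>20 * \<epsilon>\<close> from its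
  initial values, and the two drifts give 40. Every element of \<open>G\<close> enters both the
  domain and the range of some stage, which makes the union of the partial maps an automorphism;
  points of \<open>D\<close> are added on both sides, which makes the limits of the entries
  dense.\<close>

lemma back_and_forth:
  fixes \<beta> \<gamma> :: "'g \<Rightarrow> 'u::complete_space \<Rightarrow> 'u"
  assumes \<beta>: "isometric_action G \<beta>" "extensive G 5 \<beta>" and \<gamma>: "isometric_action G \<gamma>" "extensive G 5 \<gamma>"
    and matched: "matched G \<beta> \<gamma> F \<psi> n u w \<epsilon>" and \<epsilon>: "0 < \<epsilon>"
    and D: "countable D" "closure D = (UNIV :: 'u set)"
  obtains \<Psi> \<Phi> where "\<Psi> \<in> iso G G" "\<Phi> \<in> isometries" "\<And>f. f \<in> F \<Longrightarrow> \<Psi> f = \<psi> f"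
    and "\<And>g x. g \<in> carrier G \<Longrightarrow> \<Phi> (\<beta> g x) = \<gamma> (\<Psi> g) (\<Phi> x)"
    and "\<And>i. i < n \<Longrightarrow> dist (\<Phi> (u i)) (w i) \<le> 40 * \<epsilon>"
proof -
  interpret \<beta>: isometric_action G \<beta> by (rule \<beta>)
  interpret \<gamma>: isometric_action G \<gamma> by (rule \<gamma>)
  have "D \<noteq> {}"
    using D(2) by auto
  \<comment> \<open>Decoding a pair lists each point of \<open>D\<close> at arbitrarily late stages.
    This matters because the entry placed near \<open>q k\<close> at stage \<open>k\<close>
    converges only to a point within \<open>30 * \<epsilon>' (Suc k)\<close> of it.\<close>
  define q where "q = (\<lambda>k. from_nat_into D (fst (prod_decode k)))"
  define e where "e = from_nat_into (carrier G)"
  have e: "e k \<in> carrier G" for k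
    unfolding e_def by (rule from_nat_into) auto
  have e_surj: "\<exists>k. e k = g" if "g \<in> carrier G" for g
    using from_nat_into_surj[OF countable_carrier that] by (simp add: e_def)
  define \<epsilon>' where "\<epsilon>' = (\<lambda>k :: nat. \<epsilon> / 2 ^ k)"
  have \<epsilon>'_pos: "0 < \<epsilon>' k" and \<epsilon>'_Suc: "\<epsilon>' (Suc k) = \<epsilon>' k / 2" for k
    using \<epsilon> by (simp_all add: \<epsilon>'_def)
  have \<epsilon>'_le: "\<epsilon>' (Suc k) \<le> \<epsilon>' k" for k
    using \<epsilon>'_pos[of k] \<epsilon>'_Suc[of k] by simp
  define N where "N = (\<lambda>k. n + 2 * k)"
  \<comment> \<open>The second conjunct fixes the initial state, about which
    \<open>dependent_nat_choice\<close> says only that it satisfies \<open>P 0\<close>.\<close>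
  define P where "P = (\<lambda>k (F', \<psi>', u', w'). matched G \<beta> \<gamma> F' \<psi>' (N k) u' w' (\<epsilon>' k)
      \<and> (k = 0 \<longrightarrow> F' = F \<and> \<psi>' = \<psi> \<and> u' = u \<and> w' = w))"
  define Q where "Q = (\<lambda>k (F0, \<psi>0, u0, w0) (F1, \<psi>1, u1, w1). F0 \<subseteq> F1
      \<and> e k \<in> F1 \<and> e k \<in> \<psi>1 ` F1 \<and> (\<forall>f\<in>F0. \<psi>1 f = \<psi>0 f)
      \<and> (\<forall>i<N k. dist (u0 i) (u1 i) \<le> 10 * \<epsilon>' k \<and> dist (w0 i) (w1 i) \<le> 10 * \<epsilon>' k)
      \<and> dist (u1 (N k)) (q k) \<le> 10 * \<epsilon>' (Suc k) \<and> w1 (Suc (N k)) = q k)"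
  have "\<exists>S. \<forall>k. P k (S k) \<and> Q k (S k) (S (Suc k))"
  proof (rule dependent_nat_choice)
    show "\<exists>S. P 0 S"
      using matched by (intro exI[of _ "(F, \<psi>, u, w)"]) (simp add: P_def N_def \<epsilon>'_def)
    fix S k assume S: "P k S"
    obtain F0 \<psi>0 u0 w0 where S_eq: "S = (F0, \<psi>0, u0, w0)"
      by (cases S)
    have m: "matched G \<beta> \<gamma> F0 \<psi>0 (N k) u0 w0 (\<epsilon>' k)"
      using S by (simp add: P_def S_eq)
    show "\<exists>T. P (Suc k) T \<and> Q k S T"
    proof (rule back_and_forth_step[OF \<beta> \<gamma> m \<epsilon>'_pos[of "Suc k"] \<epsilon>'_le e[of k], of "q k"])
      fix F1 \<psi>1 u1 w1
      assume "matched G \<beta> \<gamma> F1 \<psi>1 (Suc (Suc (N k))) u1 w1 (\<epsilon>' (Suc k))" "F0 \<subseteq> F1"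
        "e k \<in> F1" "e k \<in> \<psi>1 ` F1" "\<And>f. f \<in> F0 \<Longrightarrow> \<psi>1 f = \<psi>0 f"
        "\<And>i. i < N k \<Longrightarrow> dist (u0 i) (u1 i) \<le> 10 * \<epsilon>' k"
        "\<And>i. i < N k \<Longrightarrow> dist (w0 i) (w1 i) \<le> 10 * \<epsilon>' k"
        "dist (u1 (N k)) (q k) \<le> 10 * \<epsilon>' (Suc k)" "w1 (Suc (N k)) = q k"
      then have "P (Suc k) (F1, \<psi>1, u1, w1) \<and> Q k S (F1, \<psi>1, u1, w1)"
        by (simp add: P_def Q_def S_eq N_def)
      then show ?thesis
        by blast
    qed
  qed
  then obtain S where S: "\<And>k. P k (S k)" "\<And>k. Q k (S k) (S (Suc k))"
    by blast
  define Fs where "Fs = (\<lambda>k. fst (S k))"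
  define \<psi>s where "\<psi>s = (\<lambda>k. fst (snd (S k)))"
  define us where "us = (\<lambda>k. fst (snd (snd (S k))))"
  define ws where "ws = (\<lambda>k. snd (snd (snd (S k))))"
  have S_eq: "S k = (Fs k, \<psi>s k, us k, ws k)" for k
    by (simp add: Fs_def \<psi>s_def us_def ws_def)
  have m: "matched G \<beta> \<gamma> (Fs k) (\<psi>s k) (N k) (us k) (ws k) (\<epsilon>' k)" for k
    using S(1)[of k] by (simp add: P_def S_eq)
  have S0: "Fs 0 = F" "\<psi>s 0 = \<psi>" "us 0 = u" "ws 0 = w"
    using S(1)[of 0] by (simp_all add: P_def S_eq)
  have Fs_sub: "Fs k \<subseteq> Fs (Suc k)" and e_in: "e k \<in> Fs (Suc k)" "e k \<in> \<psi>s (Suc k) ` Fs (Suc k)"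
    and \<psi>s_Suc: "\<And>f. f \<in> Fs k \<Longrightarrow> \<psi>s (Suc k) f = \<psi>s k f"
    and us_Suc: "\<And>i. i < N k \<Longrightarrow> dist (us k i) (us (Suc k) i) \<le> 10 * \<epsilon>' k"
    and ws_Suc: "\<And>i. i < N k \<Longrightarrow> dist (ws k i) (ws (Suc k) i) \<le> 10 * \<epsilon>' k"
    and us_new: "dist (us (Suc k) (N k)) (q k) \<le> 10 * \<epsilon>' (Suc k)"
    and ws_new: "ws (Suc k) (Suc (N k)) = q k" for k
    using S(2)[of k] by (simp_all add: Q_def S_eq)
  have Fs_mono: "Fs k \<subseteq> Fs l" if "k \<le> l" for k l
    using lift_Suc_mono_le[of Fs, OF Fs_sub that] .
  have \<psi>s_mono: "\<psi>s l f = \<psi>s k f" if "k \<le> l" "f \<in> Fs k" for k l f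
    using that(1)
  proof (induction l rule: dec_induct)
    case (step l)
    then show ?case
      using \<psi>s_Suc[of f l] Fs_mono[of k l] that(2) by auto
  qed simp
  have Fs_sg: "subgroup (Fs k) G" and \<psi>s_mon: "\<psi>s k \<in> mon (G\<lparr>carrier := Fs k\<rparr>) G"
    and m_close: "\<And>f g i j. \<lbrakk>f \<in> Fs k; g \<in> Fs k; i < N k; j < N k\<rbrakk> \<Longrightarrow>
      \<bar>dist (\<beta> f (us k i)) (\<beta> g (us k j)) - dist (\<gamma> (\<psi>s k f) (ws k i)) (\<gamma> (\<psi>s k g) (ws k j))\<bar> \<le> \<epsilon>' k" for k
    using m[of k] by (simp_all add: matched_def)
  define \<Psi> where "\<Psi> = (\<lambda>g. \<psi>s (LEAST k. g \<in> Fs k) g)"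
  have \<Psi>: "\<Psi> g = \<psi>s k g" if "g \<in> Fs k" for g k
    unfolding \<Psi>_def
    by (rule \<psi>s_mono[OF Least_le[of "\<lambda>k. g \<in> Fs k", OF that] LeastI[of "\<lambda>k. g \<in> Fs k", OF that], symmetric])
  have Fs_ex: "\<exists>k. f \<in> Fs k" if f: "f \<in> carrier G" for f
  proof -
    obtain k where "e k = f"
      using e_surj[OF f] by blast
    then show ?thesis
      using e_in(1)[of k] by blast
  qed
  have Fs_ex2: "\<exists>k. f \<in> Fs k \<and> g \<in> Fs k" if fg: "f \<in> carrier G" "g \<in> carrier G" for f g
  proof -
    obtain k l where "f \<in> Fs k" "g \<in> Fs l"
      using Fs_ex fg by blast
    then show ?thesis
      using Fs_mono[of k "max k l"] Fs_mono[of l "max k l"] by (intro exI[of _ "max k l"]) auto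
  qed
  have \<Psi>_closed: "\<Psi> g \<in> carrier G" if "g \<in> carrier G" for g
    using Fs_ex[OF that] \<Psi> monD(1)[OF \<psi>s_mon] by fastforce
  have \<Psi>_mult: "\<Psi> (f \<otimes> g) = \<Psi> f \<otimes> \<Psi> g" if fg: "f \<in> carrier G" "g \<in> carrier G" for f g
  proof -
    obtain k where k: "f \<in> Fs k" "g \<in> Fs k"
      using Fs_ex2[OF fg] by blast
    then have "f \<otimes> g \<in> Fs k"
      using Fs_sg subgroup.m_closed by metis
    with k show ?thesis
      using \<Psi> monD(2)[OF \<psi>s_mon[of k], of f g] by simp
  qed
  have \<Psi>_inj: "inj_on \<Psi> (carrier G)"
  proof (rule inj_onI)
    fix f g assume fg: "f \<in> carrier G" "g \<in> carrier G" "\<Psi> f = \<Psi> g"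
    obtain k where "f \<in> Fs k" "g \<in> Fs k"
      using Fs_ex2[OF fg(1,2)] by blast
    then show "f = g"
      using \<Psi> fg(3) inj_onD[OF monD(3)[OF \<psi>s_mon[of k]], of f g] by simp
  qed
  have \<Psi>_surj: "\<exists>f\<in>carrier G. \<Psi> f = g" if g: "g \<in> carrier G" for g
  proof -
    obtain k where "e k = g"
      using e_surj[OF g] by blast
    then obtain f where "f \<in> Fs (Suc k)" "g = \<psi>s (Suc k) f"
      using e_in(2)[of k] by blast
    then show ?thesis
      using \<Psi> subgroup.mem_carrier[OF Fs_sg] by metis
  qed
  have \<Psi>_iso: "\<Psi> \<in> iso G G"
    unfolding iso_def hom_def bij_betw_def using \<Psi>_closed \<Psi>_mult \<Psi>_inj \<Psi>_surj by fast
  have N_mono: "i < N l" if "i < N k" "k \<le> l" for i k l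
    using that by (simp add: N_def)
  have lim: "\<exists>z. (\<lambda>l. x l i) \<longlonglongrightarrow> z \<and> (\<forall>k. i < N k \<longrightarrow> dist (x k i) z \<le> 20 * \<epsilon>' k)"
    if x: "\<And>k i. i < N k \<Longrightarrow> dist (x k i) (x (Suc k) i) \<le> 10 * \<epsilon>' k" for x :: "nat \<Rightarrow> nat \<Rightarrow> 'u" and i
  proof -
    \<comment> \<open>The movement of entry \<open>i\<close> is controlled only from the stage at
      which the tuples are long enough to contain it.\<close>
    define k0 where "k0 = (LEAST k. i < N k)"
    have "i < N (Suc i)"
      by (simp add: N_def)
    then have k0: "i < N k0"
      unfolding k0_def by (rule LeastI)
    have k0_le: "k0 \<le> k" if "i < N k" for k
      unfolding k0_def using that by (rule Least_le)
    have step: "dist (x l i) (x (Suc l) i) \<le> (10 * \<epsilon>) / 2 ^ l" if "k0 \<le> l" for l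
      using x[of i l] N_mono[OF k0 that] by (simp add: \<epsilon>'_def)
    obtain z where z: "(\<lambda>l. x l i) \<longlonglongrightarrow> z" "\<And>l. k0 \<le> l \<Longrightarrow> dist (x l i) z \<le> 2 * (10 * \<epsilon>) / 2 ^ l"
      by (rule geometric_limit[of k0 "\<lambda>l. x l i", OF step]) (assumption | rule that)+
    then show ?thesis
      using k0_le by (intro exI[of _ z]) (simp add: \<epsilon>'_def)
  qed
  obtain ul where ul: "\<And>i. (\<lambda>l. us l i) \<longlonglongrightarrow> ul i" "\<And>i k. i < N k \<Longrightarrow> dist (us k i) (ul i) \<le> 20 * \<epsilon>' k"
    using lim[of us, OF us_Suc] by metis
  obtain wl where wl: "\<And>i. (\<lambda>l. ws l i) \<longlonglongrightarrow> wl i" "\<And>i k. i < N k \<Longrightarrow> dist (ws k i) (wl i) \<le> 20 * \<epsilon>' k"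
    using lim[of ws, OF ws_Suc] by metis
  have \<epsilon>'_lim: "\<epsilon>' \<longlonglongrightarrow> 0"
  proof -
    have "(\<lambda>l. \<epsilon> * (1 / 2) ^ l) \<longlonglongrightarrow> \<epsilon> * 0"
      by (intro tendsto_intros) simp_all
    then show ?thesis
      by (simp add: \<epsilon>'_def power_one_over)
  qed
  have act_lim: "(\<lambda>l. \<delta> g (x l)) \<longlonglongrightarrow> \<delta> g y"
    if "isometric_action G \<delta>" "g \<in> carrier G" "x \<longlonglongrightarrow> y" for \<delta> :: "'g \<Rightarrow> 'u \<Rightarrow> 'u" and g x y
    using that(3) unfolding tendsto_dist_iff[of "\<lambda>l. \<delta> g (x l)"] tendsto_dist_iff[of x]
      isometric_action.dist_act[OF that(1,2)] .
  have dist_eq: "dist (\<beta> f (ul i)) (\<beta> g (ul j)) = dist (\<gamma> (\<Psi> f) (wl i)) (\<gamma> (\<Psi> g) (wl j))"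
    if fg: "f \<in> carrier G" "g \<in> carrier G" for f g i j
  proof -
    define A where "A = (\<lambda>l. dist (\<beta> f (us l i)) (\<beta> g (us l j)))"
    define B where "B = (\<lambda>l. dist (\<gamma> (\<Psi> f) (ws l i)) (\<gamma> (\<Psi> g) (ws l j)))"
    have A: "A \<longlonglongrightarrow> dist (\<beta> f (ul i)) (\<beta> g (ul j))"
      unfolding A_def by (rule tendsto_dist[OF act_lim[OF \<beta>(1) fg(1) ul(1)] act_lim[OF \<beta>(1) fg(2) ul(1)]])
    have B: "B \<longlonglongrightarrow> dist (\<gamma> (\<Psi> f) (wl i)) (\<gamma> (\<Psi> g) (wl j))"
      unfolding B_def by (rule tendsto_dist[OF act_lim[OF \<gamma>(1) \<Psi>_closed[OF fg(1)] wl(1)]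
            act_lim[OF \<gamma>(1) \<Psi>_closed[OF fg(2)] wl(1)]])
    obtain k where k: "f \<in> Fs k" "g \<in> Fs k"
      using Fs_ex2[OF fg] by blast
    have AB: "\<bar>A l - B l\<bar> \<le> \<epsilon>' l" if "max k (Suc (max i j)) \<le> l" for l
    proof -
      have "f \<in> Fs l" "g \<in> Fs l" "i < N l" "j < N l"
        using k Fs_mono[of k l] that by (auto simp: N_def)
      then show ?thesis
        using m_close[of f l g i j] \<Psi> by (simp add: A_def B_def)
    qed
    have "(\<lambda>l. A l - B l) \<longlonglongrightarrow> 0"
    proof (rule Lim_null_comparison[OF _ \<epsilon>'_lim])
      show "eventually (\<lambda>l. norm (A l - B l) \<le> \<epsilon>' l) sequentially"
        using AB unfolding eventually_sequentially real_norm_def by blast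
    qed
    from LIMSEQ_unique[OF tendsto_diff[OF A B] this] show ?thesis
      by simp
  qed
  have small: "\<exists>l. q l = d \<and> 30 * \<epsilon>' (Suc l) < r" if d: "d \<in> D" and r: "0 < r" for d r
  proof -
    obtain a where a: "from_nat_into D a = d"
      using from_nat_into_surj[OF D(1) d] by blast
    have "eventually (\<lambda>l. \<epsilon>' l < r / 30) sequentially"
      using r by (intro order_tendstoD(2)[OF \<epsilon>'_lim]) simp
    then obtain b where b: "\<And>l. b \<le> l \<Longrightarrow> \<epsilon>' l < r / 30"
      by (auto simp: eventually_sequentially)
    have "b \<le> prod_encode (a, b)"
      by (rule le_prod_encode_2)
    then show ?thesis
      using a b[of "Suc (prod_encode (a, b))"] by (intro exI[of _ "prod_encode (a, b)"]) (simp add: q_def)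
  qed
  have D_dense: "\<exists>d\<in>D. dist d x < r" if "0 < r" for x r
    using D(2) that closure_approachable[of x D] by simp
  have dense: "\<exists>i. dist (z i) y < r"
    if z: "\<And>i k. i < N k \<Longrightarrow> dist (x k i) (z i) \<le> 20 * \<epsilon>' k"
      and new: "\<And>k. \<exists>i<N (Suc k). dist (x (Suc k) i) (q k) \<le> 10 * \<epsilon>' (Suc k)" and "0 < r"
    for x :: "nat \<Rightarrow> nat \<Rightarrow> 'u" and z y r
  proof -
    have r: "0 < r / 2"
      using \<open>0 < r\<close> by simp
    obtain d where d: "d \<in> D" "dist d y < r / 2"
      using D_dense[OF r] by blast
    obtain l where l: "q l = d" "30 * \<epsilon>' (Suc l) < r / 2"
      using small[OF d(1) r] by blast
    obtain i where i: "i < N (Suc l)" "dist (x (Suc l) i) (q l) \<le> 10 * \<epsilon>' (Suc l)"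
      using new by blast
    have "dist (z i) y \<le> dist (x (Suc l) i) (z i) + dist (x (Suc l) i) d + dist d y"
      using dist_triangle[of "z i" y d] dist_triangle[of "z i" d "x (Suc l) i"]
      by (simp add: dist_commute)
    then have "dist (z i) y < r"
      using z[OF i(1)] i(2) l d(2) by simp
    then show ?thesis
      by blast
  qed
  have new: "\<exists>i<N (Suc k). dist (us (Suc k) i) (q k) \<le> 10 * \<epsilon>' (Suc k)"
    "\<exists>i<N (Suc k). dist (ws (Suc k) i) (q k) \<le> 10 * \<epsilon>' (Suc k)" for k
  proof -
    have "N k < N (Suc k)" "Suc (N k) < N (Suc k)" "dist (ws (Suc k) (Suc (N k))) (q k) \<le> 10 * \<epsilon>' (Suc k)"
      using ws_new[of k] \<epsilon>'_pos[of "Suc k"] by (simp_all add: N_def)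
    then show "\<exists>i<N (Suc k). dist (us (Suc k) i) (q k) \<le> 10 * \<epsilon>' (Suc k)"
      "\<exists>i<N (Suc k). dist (ws (Suc k) i) (q k) \<le> 10 * \<epsilon>' (Suc k)"
      using us_new[of k] by blast+
  qed
  have ul_dense: "\<exists>i. dist (ul i) y < r" and wl_dense: "\<exists>i. dist (wl i) y < r" if "0 < r" for y r
    by (rule dense[of us, OF ul(2) new(1) that] dense[of ws, OF wl(2) new(2) that]; assumption)+
  \<comment> \<open>The index set describes whole orbits, so translation by an element of
    \<open>G\<close> permutes it. The equivariance of \<open>\<Phi>\<close> is then read off from
    distances to the points of the family \<open>b\<close>.\<close>
  define I where "I = carrier G \<times> (UNIV :: nat set)"
  define a where "a = (\<lambda>(f, i). \<beta> f (ul i))"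
  define b where "b = (\<lambda>(f, i). \<gamma> (\<Psi> f) (wl i))"
  have ab: "dist (a x) (a y) = dist (b x) (b y)" if "x \<in> I" "y \<in> I" for x y
    using that dist_eq by (auto simp: I_def a_def b_def)
  have \<Psi>_one: "\<Psi> \<one> = \<one>"
    using \<Psi>_iso hom_one[of \<Psi> G G] is_group by (simp add: iso_def)
  have a_dense: "\<exists>x\<in>I. dist (a x) y < r" and b_dense: "\<exists>x\<in>I. dist (b x) y < r" if "0 < r" for y r
  proof -
    have "(\<one>, i) \<in> I" "a (\<one>, i) = ul i" "b (\<one>, i) = wl i" for i
      by (simp_all add: I_def a_def b_def \<Psi>_one)
    then show "\<exists>x\<in>I. dist (a x) y < r" "\<exists>x\<in>I. dist (b x) y < r"
      using ul_dense[OF that, of y] wl_dense[OF that, of y] by metis+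
  qed
  obtain \<Phi> where \<Phi>: "\<Phi> \<in> isometries" and \<Phi>_dist: "\<And>x i. i \<in> I \<Longrightarrow> dist (\<Phi> x) (b i) = dist x (a i)"
    by (rule isometry_extension[OF ab a_dense b_dense]) (assumption | rule that)+
  show thesis
  proof (rule that[OF \<Psi>_iso \<Phi>])
    show "\<Psi> f = \<psi> f" if "f \<in> F" for f
      using \<Psi>[of f 0] that S0 by simp
    show "\<Phi> (\<beta> g x) = \<gamma> (\<Psi> g) (\<Phi> x)" if g: "g \<in> carrier G" for g x
    proof (rule dist_dense_eqD[of I b, OF b_dense])
      fix p assume "p \<in> I"
      then obtain f i where p: "p = (f, i)" and f: "f \<in> carrier G"
        by (auto simp: I_def)
      define f' where "f' = inv g \<otimes> f"
      have f': "f' \<in> carrier G" "f = g \<otimes> f'"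
        using f g by (simp_all add: f'_def m_assoc[symmetric])
      have p': "(f', i) \<in> I"
        using f'(1) by (simp add: I_def)
      have "dist (\<Phi> (\<beta> g x)) (b p) = dist (\<beta> g x) (\<beta> g (\<beta> f' (ul i)))"
        using \<Phi>_dist[OF \<open>p \<in> I\<close>] g f' by (simp add: a_def p \<beta>.act_mult)
      also have "\<dots> = dist (\<Phi> x) (b (f', i))"
        using \<Phi>_dist[OF p'] g by (simp add: a_def)
      also have "\<dots> = dist (\<gamma> (\<Psi> g) (\<Phi> x)) (b p)"
        using g f' \<Psi>_closed \<Psi>_mult by (simp add: b_def p \<gamma>.act_mult)
      finally show "dist (\<Phi> (\<beta> g x)) (b p) = dist (\<gamma> (\<Psi> g) (\<Phi> x)) (b p)" .
    qed
    show "dist (\<Phi> (u i)) (w i) \<le> 40 * \<epsilon>" if "i < n" for i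
    proof -
      have "dist (\<Phi> (u i)) (wl i) = dist (u i) (ul i)"
        using \<Phi>_dist[of "(\<one>, i)" "u i"] by (simp add: I_def a_def b_def \<Psi>_one)
      moreover have "dist (u i) (ul i) \<le> 20 * \<epsilon>" "dist (w i) (wl i) \<le> 20 * \<epsilon>"
        using ul(2)[of i 0] wl(2)[of i 0] that by (simp_all add: S0 N_def \<epsilon>'_def)
      ultimately show ?thesis
        using dist_triangle[of "\<Phi> (u i)" "w i" "wl i"] by (simp add: dist_commute)
    qed
  qed
qed

end

section \<open>The space of homomorphisms\<close>

lemma topspace_Hom_topology [simp]: "topspace (Hom_topology G) = Hom_Iso G"
proof -
  have "Hom_Iso G \<subseteq> (\<Pi>\<^sub>E g\<in>carrier G. isometries)"
    by (auto simp: Hom_Iso_def hom_def Iso_group_def PiE_def)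
  then show ?thesis
    by (auto simp: Hom_topology_def Iso_topology_def)
qed

lemma continuous_map_Hom_topology_eval:
  fixes x :: "'u::metric_space"
  assumes "g \<in> carrier G"
  shows "continuous_map (Hom_topology G) euclidean (\<lambda>\<beta>. \<beta> g x)"
proof -
  have "continuous_map Iso_topology euclidean (\<lambda>f. f x)"
    unfolding Iso_topology_def
    by (intro continuous_map_from_subtopology continuous_map_product_projection) simp
  moreover have "continuous_map (Hom_topology G) Iso_topology (\<lambda>\<beta>. \<beta> g)"
    unfolding Hom_topology_def
    by (intro continuous_map_from_subtopology continuous_map_product_projection assms)
  ultimately show ?thesis
    using continuous_map_compose[of "Hom_topology G" Iso_topology "\<lambda>\<beta>. \<beta> g"] by (simp add: o_def)
qed

lemma continuous_map_Hom_topology_dist: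
  fixes x y :: "'u::metric_space"
  assumes "g \<in> carrier G" "h \<in> carrier G"
  shows "continuous_map (Hom_topology G) euclideanreal (\<lambda>\<beta>. \<bar>c - dist (\<beta> g x) (\<beta> h y)\<bar>)"
proof -
  have "continuous_map (Hom_topology G) (prod_topology euclidean euclidean) (\<lambda>\<beta>. (\<beta> g x, \<beta> h y))"
    by (intro continuous_map_pairedI continuous_map_Hom_topology_eval assms)
  then have 1: "continuous_map (Hom_topology G) euclidean (\<lambda>\<beta>. (\<beta> g x, \<beta> h y))"
    by (simp add: euclidean_product_topology)
  have 2: "continuous_map euclidean euclideanreal (\<lambda>(x :: 'u, y). \<bar>c - dist x y\<bar>)"
    unfolding continuous_map_iff_continuous2 case_prod_beta by (intro continuous_intros)
  show ?thesis
    using continuous_map_compose[OF 1 2] by (simp add: o_def)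
qed

text \<open>If the premise fails at \<beta>, one violated inequality stays violated nearby. If it
  holds, the witnesses \<open>\<phi>\<close> and \<open>v\<close> found for \<beta> serve on a whole
  neighbourhood: only the strict inequalities on them mention \<beta>, and these are finitely many
  because \<open>H\<close> is finite.\<close>

lemma openin_extension_instance:
  fixes G :: "'g monoid" and u :: "nat \<Rightarrow> 'u::metric_space"
  assumes data: "extension_data G F H \<theta> n m d N"
  shows "openin (Hom_topology G) {\<beta> \<in> Hom_Iso G. extension_instance G c F H \<theta> n m d N u \<epsilon> \<epsilon>' \<beta>}"
proof (subst openin_subopen, intro ballI)
  let ?X = "Hom_topology G :: ('g \<Rightarrow> 'u \<Rightarrow> 'u) topology"
  have F: "f \<in> carrier G" if "f \<in> F" for f
    using data that subgroup.mem_carrier by (fastforce simp: extension_data_def)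
  fix \<beta> assume "\<beta> \<in> {\<beta> \<in> Hom_Iso G. extension_instance G c F H \<theta> n m d N u \<epsilon> \<epsilon>' \<beta>}"
  then have \<beta>: "\<beta> \<in> Hom_Iso G" "extension_instance G c F H \<theta> n m d N u \<epsilon> \<epsilon>' \<beta>"
    by simp_all
  show "\<exists>T. openin ?X T \<and> \<beta> \<in> T \<and> T \<subseteq> {\<beta> \<in> Hom_Iso G. extension_instance G c F H \<theta> n m d N u \<epsilon> \<epsilon>' \<beta>}"
  proof (cases "\<forall>f\<in>F. \<forall>k\<in>F. \<forall>i<n. \<forall>j<n.
      \<bar>d (\<theta> f, i) (\<theta> k, j) / real N - dist (\<beta> f (u i)) (\<beta> k (u j))\<bar> \<le> \<epsilon>")
    case False
    then obtain f k i j where fk: "f \<in> F" "k \<in> F" "i < n" "j < n"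
      and "\<not> \<bar>d (\<theta> f, i) (\<theta> k, j) / real N - dist (\<beta> f (u i)) (\<beta> k (u j))\<bar> \<le> \<epsilon>"
      by blast
    then have gt: "\<epsilon> < \<bar>d (\<theta> f, i) (\<theta> k, j) / real N - dist (\<beta> f (u i)) (\<beta> k (u j))\<bar>"
      by linarith
    let ?T = "{\<beta> \<in> topspace ?X. \<bar>d (\<theta> f, i) (\<theta> k, j) / real N - dist (\<beta> f (u i)) (\<beta> k (u j))\<bar> \<in> {\<epsilon><..}}"
    have "openin ?X ?T"
      by (rule openin_continuous_map_preimage[OF continuous_map_Hom_topology_dist[OF F[OF fk(1)] F[OF fk(2)]]]) simp
    moreover have "\<beta> \<in> ?T"
      using \<beta>(1) gt by simp
    moreover have "extension_instance G c F H \<theta> n m d N u \<epsilon> \<epsilon>' \<beta>'" if "\<beta>' \<in> ?T" for \<beta>'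
      using that fk unfolding extension_instance_def by fastforce
    then have "?T \<subseteq> {\<beta> \<in> Hom_Iso G. extension_instance G c F H \<theta> n m d N u \<epsilon> \<epsilon>' \<beta>}"
      by auto
    ultimately show ?thesis
      by blast
  next
    case True
    from \<beta>(2)[unfolded extension_instance_def, THEN mp, OF True]
    obtain \<phi> v where \<phi>: "\<phi> \<in> mon (G\<lparr>carrier := H\<rparr>) G" "\<forall>f\<in>F. \<phi> (\<theta> f) = f"
      and v: "\<forall>i<n. dist (u i) (v i) \<le> c * \<epsilon>"
      and close: "\<forall>h\<in>H. \<forall>k\<in>H. \<forall>i<m. \<forall>j<m.
        \<bar>d (h, i) (k, j) / real N - dist (\<beta> (\<phi> h) (v i)) (\<beta> (\<phi> k) (v j))\<bar> < \<epsilon>'"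
      by (elim exE conjE) (rule that)
    let ?I = "(H \<times> {..<m}) \<times> (H \<times> {..<m})"
    let ?U = "\<lambda>((h, i), (k, j)). {\<beta> \<in> topspace ?X.
      \<bar>d (h, i) (k, j) / real N - dist (\<beta> (\<phi> h) (v i)) (\<beta> (\<phi> k) (v j))\<bar> \<in> {..<\<epsilon>'}}"
    let ?T = "(\<Inter>p\<in>?I. ?U p) \<inter> topspace ?X"
    have \<phi>_in: "\<phi> h \<in> carrier G" if "h \<in> H" for h
      using monD(1)[OF \<phi>(1)] that by simp
    have "openin ?X ?T"
    proof (rule openin_INT)
      show "finite ?I"
        using data by (simp add: extension_data_def)
      fix p assume "p \<in> ?I"
      then obtain h i k j where p: "p = ((h, i), (k, j))" "h \<in> H" "k \<in> H"
        by auto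
      show "openin ?X (?U p)"
        unfolding p(1) prod.case
        by (rule openin_continuous_map_preimage[OF
              continuous_map_Hom_topology_dist[OF \<phi>_in[OF p(2)] \<phi>_in[OF p(3)]]]) simp
    qed
    moreover have "\<beta> \<in> ?T"
      using \<beta>(1) close by auto
    moreover have "extension_instance G c F H \<theta> n m d N u \<epsilon> \<epsilon>' \<beta>'" if "\<beta>' \<in> ?T" for \<beta>'
    proof -
      have "\<forall>h\<in>H. \<forall>k\<in>H. \<forall>i<m. \<forall>j<m.
          \<bar>d (h, i) (k, j) / real N - dist (\<beta>' (\<phi> h) (v i)) (\<beta>' (\<phi> k) (v j))\<bar> < \<epsilon>'"
      proof (intro ballI allI impI)
        fix h k i j assume "h \<in> H" "k \<in> H" "i < m" "j < m"
        then have "\<beta>' \<in> ?U ((h, i), (k, j))"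
          using that by blast
        then show "\<bar>d (h, i) (k, j) / real N - dist (\<beta>' (\<phi> h) (v i)) (\<beta>' (\<phi> k) (v j))\<bar> < \<epsilon>'"
          by simp
      qed
      with \<phi> v show ?thesis
        unfolding extension_instance_def by (intro impI exI conjI)
    qed
    then have "?T \<subseteq> {\<beta> \<in> Hom_Iso G. extension_instance G c F H \<theta> n m d N u \<epsilon> \<epsilon>' \<beta>}"
      by auto
    ultimately show ?thesis
      by blast
  qed
qed

section \<open>Basic neighbourhoods of an isometry and of an action\<close>

lemma openin_Iso_topologyD:
  fixes f :: "'u::metric_space \<Rightarrow> 'u"
  assumes "openin Iso_topology U" "f \<in> U"
  obtains A \<epsilon> where "finite A" "0 < \<epsilon>" "\<And>g. \<lbrakk>g \<in> isometries; \<And>x. x \<in> A \<Longrightarrow> dist (g x) (f x) < \<epsilon>\<rbrakk> \<Longrightarrow> g \<in> U"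
proof -
  obtain T where T: "openin (product_topology (\<lambda>_ :: 'u. euclidean :: 'u topology) UNIV) T" "U = T \<inter> isometries"
    using assms(1) unfolding Iso_topology_def openin_subtopology by blast
  then obtain V where V: "finite {x. V x \<noteq> UNIV}" "\<And>x. open (V x)" "f \<in> Pi\<^sub>E UNIV V" "Pi\<^sub>E UNIV V \<subseteq> T"
    using assms(2) unfolding openin_product_topology_alt by auto
  have "eventually (\<lambda>e. \<forall>x\<in>{x. V x \<noteq> UNIV}. ball (f x) e \<subseteq> V x) (at_right 0)"
  proof (rule eventually_ball_finite[OF V(1)], intro ballI)
    fix x
    have "f x \<in> V x"
      using V(3) by auto
    then obtain e where "0 < e" "ball (f x) e \<subseteq> V x"
      using V(2) open_contains_ball by blast
    then show "eventually (\<lambda>e. ball (f x) e \<subseteq> V x) (at_right 0)"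
      unfolding eventually_at_right_field by (intro exI[of _ e]) auto
  qed
  then obtain \<epsilon> where \<epsilon>: "0 < \<epsilon>" "\<And>x. V x \<noteq> UNIV \<Longrightarrow> ball (f x) \<epsilon> \<subseteq> V x"
    unfolding eventually_at_right_field by (metis dense mem_Collect_eq)
  show thesis
  proof (rule that[OF V(1) \<epsilon>(1)])
    fix g assume g: "g \<in> isometries" "\<And>x. x \<in> {x. V x \<noteq> UNIV} \<Longrightarrow> dist (g x) (f x) < \<epsilon>"
    have "g x \<in> V x" for x
    proof (cases "V x = UNIV")
      case False
      then have "g x \<in> ball (f x) \<epsilon>"
        using g(2) by (simp add: dist_commute)
      with \<epsilon>(2)[OF False] show ?thesis
        by blast
    qed simp
    then show "g \<in> U"
      using V(4) T(2) g(1) by auto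
  qed
qed

lemma openin_Hom_topologyD:
  fixes \<beta> :: "'g \<Rightarrow> 'u::metric_space \<Rightarrow> 'u"
  assumes "openin (Hom_topology G) U" "\<beta> \<in> U"
  obtains K A \<epsilon> where "finite K" "K \<subseteq> carrier G" "finite A" "0 < \<epsilon>"
    and "\<And>\<gamma>. \<lbrakk>\<gamma> \<in> Hom_Iso G; \<And>g x. \<lbrakk>g \<in> K; x \<in> A\<rbrakk> \<Longrightarrow> dist (\<gamma> g x) (\<beta> g x) < \<epsilon>\<rbrakk> \<Longrightarrow> \<gamma> \<in> U"
proof -
  obtain T where T: "openin (product_topology (\<lambda>_. Iso_topology) (carrier G)) T" "U = T \<inter> Hom_Iso G"
    using assms(1) unfolding Hom_topology_def openin_subtopology by blast
  have "\<beta> \<in> T"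
    using T(2) assms(2) by simp
  from T(1)[unfolded openin_product_topology_alt, THEN bspec, OF this]
  obtain V where V: "finite {g \<in> carrier G. V g \<noteq> topspace Iso_topology}"
    "\<forall>g\<in>carrier G. openin Iso_topology (V g)" "\<beta> \<in> Pi\<^sub>E (carrier G) V" "Pi\<^sub>E (carrier G) V \<subseteq> T"
    by (elim exE conjE) (rule that)
  define K where "K = {g \<in> carrier G. V g \<noteq> topspace Iso_topology}"
  have "\<forall>g\<in>carrier G. \<exists>A \<epsilon>. finite A \<and> 0 < \<epsilon>
      \<and> (\<forall>f\<in>isometries. (\<forall>x\<in>A. dist (f x) (\<beta> g x) < \<epsilon>) \<longrightarrow> f \<in> V g)"
  proof
    fix g assume g: "g \<in> carrier G"
    have "\<beta> g \<in> V g"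
      using V(3) g by blast
    show "\<exists>A \<epsilon>. finite A \<and> 0 < \<epsilon> \<and> (\<forall>f\<in>isometries. (\<forall>x\<in>A. dist (f x) (\<beta> g x) < \<epsilon>) \<longrightarrow> f \<in> V g)"
      by (rule openin_Iso_topologyD[OF V(2)[THEN bspec, OF g] \<open>\<beta> g \<in> V g\<close>]) blast
  qed
  then obtain A \<epsilon> where A: "\<And>g. g \<in> carrier G \<Longrightarrow> finite (A g)" "\<And>g. g \<in> carrier G \<Longrightarrow> 0 < \<epsilon> g"
    "\<And>g f. \<lbrakk>g \<in> carrier G; f \<in> isometries; \<forall>x\<in>A g. dist (f x) (\<beta> g x) < \<epsilon> g\<rbrakk> \<Longrightarrow> f \<in> V g"
    by metis
  \<comment> \<open>The inserted 1 covers the case of an empty \<open>K\<close>.\<close>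
  define e where "e = Min (insert 1 (\<epsilon> ` K))"
  have K: "finite K" "K \<subseteq> carrier G"
    using V(1) by (auto simp: K_def)
  have e: "0 < e" "\<And>g. g \<in> K \<Longrightarrow> e \<le> \<epsilon> g"
    using K A(2) by (auto simp: e_def)
  show thesis
  proof (rule that[OF K _ e(1), of "\<Union>g\<in>K. A g"])
    show "finite (\<Union>g\<in>K. A g)"
      using K A(1) by blast
    fix \<gamma> assume \<gamma>: "\<gamma> \<in> Hom_Iso G" "\<And>g x. \<lbrakk>g \<in> K; x \<in> (\<Union>g\<in>K. A g)\<rbrakk> \<Longrightarrow> dist (\<gamma> g x) (\<beta> g x) < e"
    have iso: "\<gamma> g \<in> isometries" if "g \<in> carrier G" for g
      using \<gamma>(1) that by (auto simp: Hom_Iso_def hom_def Iso_group_def)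
    have "\<gamma> g \<in> V g" if g: "g \<in> carrier G" for g
    proof (cases "g \<in> K")
      case True
      have "dist (\<gamma> g x) (\<beta> g x) < \<epsilon> g" if "x \<in> A g" for x
        using \<gamma>(2)[of g x] True that e(2)[OF True] by fastforce
      then show ?thesis
        using A(3)[OF g iso[OF g]] by blast
    next
      case False
      then have "V g = topspace Iso_topology"
        using g by (simp add: K_def)
      then show ?thesis
        using iso[OF g] by (simp add: Iso_topology_def)
    qed
    moreover have "\<gamma> \<in> extensional (carrier G)"
      using \<gamma>(1) by (simp add: Hom_Iso_def)
    ultimately show "\<gamma> \<in> U"
      using V(4) T(2) \<gamma>(1) by (auto simp: PiE_def)
  qed
qed

text \<open>
  Moving \<open>u\<close> into \<open>D\<close> and \<open>\<epsilon>\<close> to a rational costs a factor, whence the constant 3 here against 5 in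
  \<open>extensive_of_countable_instances\<close>.
\<close>

definition countable_instances ::
    "'g monoid \<Rightarrow> 'u::metric_space set \<Rightarrow> ('g \<Rightarrow> 'u \<Rightarrow> 'u) set set" where
  "countable_instances G D =
     {{\<beta> \<in> Hom_Iso G. extension_instance G 3 F H \<theta> n m d N u \<epsilon> \<epsilon>' \<beta>} |F H \<theta> n m d N u \<epsilon> \<epsilon>'.
       extension_data G F H \<theta> n m d N \<and> u \<in> {..<n} \<rightarrow> D \<and> \<epsilon> \<in> \<rat> \<and> \<epsilon>' \<in> \<rat> \<and> 0 < \<epsilon> \<and> 0 < \<epsilon>'}"

text \<open>As functions on whole types, \<open>\<theta>\<close>, \<open>d\<close> and
  \<open>u\<close> may range over uncountable sets; what counts are their restrictions to finite
  sets.\<close>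

lemma extension_instance_cong:
  assumes "\<And>f. f \<in> F \<Longrightarrow> \<theta> f = \<theta>' f" "\<And>f. f \<in> F \<Longrightarrow> \<theta> f \<in> H" "n \<le> m"
    and "\<And>x y. \<lbrakk>x \<in> H \<times> {..<m}; y \<in> H \<times> {..<m}\<rbrakk> \<Longrightarrow> d x y = d' x y"
    and "\<And>i. i < n \<Longrightarrow> u i = u' i"
  shows "extension_instance G c F H \<theta> n m d N u \<epsilon> \<epsilon>' \<beta>
    \<longleftrightarrow> extension_instance G c F H \<theta>' n m d' N u' \<epsilon> \<epsilon>' \<beta>"
proof -
  have d_\<theta>: "d (\<theta> f, i) (\<theta> k, j) = d' (\<theta>' f, i) (\<theta>' k, j)" if "f \<in> F" "k \<in> F" "i < n" "j < n" for f k i j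
    using assms(4)[of "(\<theta> f, i)" "(\<theta> k, j)"] assms(1,2)[OF that(1)] assms(1,2)[OF that(2)] assms(3) that by simp
  have d: "d (h, i) (k, j) = d' (h, i) (k, j)" if "h \<in> H" "k \<in> H" "i < m" "j < m" for h k i j
    using assms(4) that by simp
  show ?thesis
    unfolding extension_instance_def using d_\<theta> d assms(1,5) by (simp cong: ball_cong)
qed

lemma countable_countable_instances:
  fixes G :: "'g monoid" and D :: "'u::metric_space set"
  assumes G: "countable (carrier G)" and D: "countable D"
  shows "countable (countable_instances G D)"
proof -
  define \<F> where "\<F> = {F. finite F \<and> F \<subseteq> carrier G}"
  \<comment> \<open>The metric is taken in uncurried form, so that it ranges over functions on one
    finite set of pairs.\<close>
  define R where "R F H \<theta> n m d N u \<epsilon> \<epsilon>'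
    = {\<beta> \<in> Hom_Iso G. extension_instance G 3 F H \<theta> n m (\<lambda>x y. d (x, y)) N u \<epsilon> \<epsilon>' \<beta>}"
    for F H \<theta> n m N \<epsilon> \<epsilon>' and d :: "('g \<times> nat) \<times> ('g \<times> nat) \<Rightarrow> int" and u :: "nat \<Rightarrow> 'u"
  define \<U> where "\<U> = (\<Union>F\<in>\<F>. \<Union>H\<in>\<F>. \<Union>n. \<Union>m. \<Union>N. \<Union>\<epsilon>\<in>\<rat>. \<Union>\<epsilon>'\<in>\<rat>. \<Union>\<theta>\<in>F \<rightarrow>\<^sub>E H.
    \<Union>d\<in>((H \<times> {..<m}) \<times> (H \<times> {..<m})) \<rightarrow>\<^sub>E UNIV. \<Union>u\<in>{..<n} \<rightarrow>\<^sub>E D. {R F H \<theta> n m d N u \<epsilon> \<epsilon>'})"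
  have "countable \<F>"
    unfolding \<F>_def using G by (rule countable_Collect_finite_subset)
  then have "countable \<U>"
    unfolding \<U>_def using D
    by (intro countable_UN countable_PiE) (auto simp: \<F>_def countable_rat intro: countable_finite)
  moreover have "countable_instances G D \<subseteq> \<U>"
  proof
    fix X assume "X \<in> countable_instances G D"
    then obtain F H \<theta> n m d N u \<epsilon> \<epsilon>' where
      X: "X = {\<beta> \<in> Hom_Iso G. extension_instance G 3 F H \<theta> n m d N u \<epsilon> \<epsilon>' \<beta>}"
      and data: "extension_data G F H \<theta> n m d N" and u: "u \<in> {..<n} \<rightarrow> D" and \<epsilon>: "\<epsilon> \<in> \<rat>" "\<epsilon>' \<in> \<rat>"
      unfolding countable_instances_def by blast
    have FH: "F \<in> \<F>" "H \<in> \<F>" and nm: "n \<le> m"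
      using data subgroup.subset by (auto simp: extension_data_def \<F>_def)
    have \<theta>: "\<theta> f \<in> H" if "f \<in> F" for f
      using data that monD(1)[of \<theta> "G\<lparr>carrier := F\<rparr>" "G\<lparr>carrier := H\<rparr>" f] by (simp add: extension_data_def)
    define \<theta>' where "\<theta>' = restrict \<theta> F"
    define d' where "d' = restrict (case_prod d) ((H \<times> {..<m}) \<times> (H \<times> {..<m}))"
    define u' where "u' = restrict u {..<n}"
    have "X = R F H \<theta>' n m d' N u' \<epsilon> \<epsilon>'"
      unfolding X R_def
      by (intro Collect_cong conj_cong refl extension_instance_cong)
        (use \<theta> nm in \<open>simp_all add: \<theta>'_def d'_def u'_def\<close>)
    then have X': "X \<in> {R F H \<theta>' n m d' N u' \<epsilon> \<epsilon>'}"
      by simp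
    have res: "\<theta>' \<in> F \<rightarrow>\<^sub>E H" "d' \<in> ((H \<times> {..<m}) \<times> (H \<times> {..<m})) \<rightarrow>\<^sub>E UNIV" "u' \<in> {..<n} \<rightarrow>\<^sub>E D"
      using \<theta> u by (auto simp: \<theta>'_def d'_def u'_def)
    show "X \<in> \<U>"
      unfolding \<U>_def
      by (rule UN_I[OF FH(1)], rule UN_I[OF FH(2)], rule UN_I[OF UNIV_I[of n]], rule UN_I[OF UNIV_I[of m]],
          rule UN_I[OF UNIV_I[of N]], rule UN_I[OF \<epsilon>(1)], rule UN_I[OF \<epsilon>(2)], rule UN_I[OF res(1)],
          rule UN_I[OF res(2)], rule UN_I[OF res(3)], rule X')
  qed
  ultimately show ?thesis
    by (rule countable_subset[rotated])
qed

text \<open>A rational \<open>\<epsilon>1\<close> is chosen between \<epsilon> and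
  \<open>4 / 3 * \<epsilon>\<close>, and \<open>u\<close> is moved into \<open>D\<close> by less
  than half the gap, which the larger error absorbs. The displacement stays below
  \<open>3 * \<epsilon>1\<close> plus one sixth of \<epsilon>, hence below
  \<open>5 * \<epsilon>\<close>.\<close>

lemma extensive_of_countable_instances:
  fixes \<beta> :: "'g \<Rightarrow> 'u::metric_space \<Rightarrow> 'u"
  assumes "isometric_action G \<beta>" and D: "closure D = UNIV" and inst: "\<beta> \<in> \<Inter> (countable_instances G D)"
  shows "extensive G 5 \<beta>"
  unfolding extensive_def extension_instance_def
proof (intro allI impI)
  interpret isometric_action G \<beta> by (rule assms(1))
  fix F H \<theta> n m d N and u :: "nat \<Rightarrow> 'u" and \<epsilon> \<epsilon>' :: real
  assume data: "extension_data G F H \<theta> n m d N" and pos: "0 < \<epsilon>" "0 < \<epsilon>'"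
    and close: "\<forall>f\<in>F. \<forall>k\<in>F. \<forall>i<n. \<forall>j<n.
      \<bar>d (\<theta> f, i) (\<theta> k, j) / real N - dist (\<beta> f (u i)) (\<beta> k (u j))\<bar> \<le> \<epsilon>"
  have F: "f \<in> carrier G" if "f \<in> F" for f
    using data that subgroup.mem_carrier[of F G f] by (simp add: extension_data_def)
  obtain \<epsilon>1 where \<epsilon>1: "\<epsilon>1 \<in> \<rat>" "\<epsilon> < \<epsilon>1" "\<epsilon>1 < 4 / 3 * \<epsilon>"
    using Rats_dense_in_real[of \<epsilon> "4 / 3 * \<epsilon>"] pos by auto
  obtain \<epsilon>2 where \<epsilon>2: "\<epsilon>2 \<in> \<rat>" "0 < \<epsilon>2" "\<epsilon>2 < \<epsilon>'"
    using Rats_dense_in_real[of 0 \<epsilon>'] pos by auto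
  define \<eta> where "\<eta> = (\<epsilon>1 - \<epsilon>) / 2"
  have \<eta>: "2 * \<eta> = \<epsilon>1 - \<epsilon>"
    by (simp add: \<eta>_def)
  then have "0 < \<eta>"
    using \<epsilon>1 by linarith
  then have "\<forall>i. \<exists>x\<in>D. dist x (u i) < \<eta>"
    using D closure_approachable[of _ D] by auto
  then obtain u' where u': "\<And>i. u' i \<in> D" "\<And>i. dist (u' i) (u i) < \<eta>"
    by metis
  have "u' \<in> {..<n} \<rightarrow> D" "0 < \<epsilon>1"
    using u'(1) pos \<epsilon>1 by auto
  then have "{\<beta> \<in> Hom_Iso G. extension_instance G 3 F H \<theta> n m d N u' \<epsilon>1 \<epsilon>2 \<beta>} \<in> countable_instances G D"
    unfolding countable_instances_def using data \<epsilon>1(1) \<epsilon>2(1,2) by blast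
  with inst have inst': "extension_instance G 3 F H \<theta> n m d N u' \<epsilon>1 \<epsilon>2 \<beta>"
    by blast
  have close': "\<forall>f\<in>F. \<forall>k\<in>F. \<forall>i<n. \<forall>j<n.
      \<bar>d (\<theta> f, i) (\<theta> k, j) / real N - dist (\<beta> f (u' i)) (\<beta> k (u' j))\<bar> \<le> \<epsilon>1"
  proof (intro ballI allI impI)
    fix f k i j assume fk: "f \<in> F" "k \<in> F" "i < n" "j < n"
    have "dist (u' i) (u i) + dist (u' j) (u j) < \<epsilon>1 - \<epsilon>"
      using u'(2)[of i] u'(2)[of j] \<eta> by linarith
    then have "dist (\<beta> f (u' i)) (\<beta> f (u i)) + dist (\<beta> k (u' j)) (\<beta> k (u j)) < \<epsilon>1 - \<epsilon>"
      using F fk by simp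
    moreover have "\<bar>dist (\<beta> f (u' i)) (\<beta> k (u' j)) - dist (\<beta> f (u i)) (\<beta> k (u j))\<bar>
        \<le> dist (\<beta> f (u' i)) (\<beta> f (u i)) + dist (\<beta> k (u' j)) (\<beta> k (u j))"
      by (smt (verit) dist_commute dist_triangle)
    moreover have "\<bar>d (\<theta> f, i) (\<theta> k, j) / real N - dist (\<beta> f (u i)) (\<beta> k (u j))\<bar> \<le> \<epsilon>"
      using close fk by blast
    ultimately show "\<bar>d (\<theta> f, i) (\<theta> k, j) / real N - dist (\<beta> f (u' i)) (\<beta> k (u' j))\<bar> \<le> \<epsilon>1"
      by linarith
  qed
  from inst'[unfolded extension_instance_def, THEN mp, OF this]
  obtain \<phi> v where \<phi>: "\<phi> \<in> mon (G\<lparr>carrier := H\<rparr>) G" "\<forall>f\<in>F. \<phi> (\<theta> f) = f"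
    and v: "\<forall>i<n. dist (u' i) (v i) \<le> 3 * \<epsilon>1"
    and fine: "\<forall>h\<in>H. \<forall>k\<in>H. \<forall>i<m. \<forall>j<m.
      \<bar>d (h, i) (k, j) / real N - dist (\<beta> (\<phi> h) (v i)) (\<beta> (\<phi> k) (v j))\<bar> < \<epsilon>2"
    by (elim exE conjE) (rule that)
  show "\<exists>\<phi> v. \<phi> \<in> mon (G\<lparr>carrier := H\<rparr>) G \<and> (\<forall>f\<in>F. \<phi> (\<theta> f) = f) \<and> (\<forall>i<n. dist (u i) (v i) \<le> 5 * \<epsilon>)
      \<and> (\<forall>h\<in>H. \<forall>k\<in>H. \<forall>i<m. \<forall>j<m.
            \<bar>d (h, i) (k, j) / real N - dist (\<beta> (\<phi> h) (v i)) (\<beta> (\<phi> k) (v j))\<bar> < \<epsilon>')"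
  proof (intro exI[of _ \<phi>] exI[of _ v] conjI \<phi> allI ballI impI)
    fix i assume "i < n"
    then have "dist (u' i) (v i) \<le> 3 * \<epsilon>1"
      using v by blast
    then show "dist (u i) (v i) \<le> 5 * \<epsilon>"
      using dist_triangle3[of "u i" "v i" "u' i"] u'(2)[of i] \<epsilon>1 pos \<eta> by linarith
  next
    fix h k i j assume "h \<in> H" "k \<in> H" "i < m" "j < m"
    then have "\<bar>d (h, i) (k, j) / real N - dist (\<beta> (\<phi> h) (v i)) (\<beta> (\<phi> k) (v j))\<bar> < \<epsilon>2"
      using fine by blast
    with \<epsilon>2(3) show "\<bar>d (h, i) (k, j) / real N - dist (\<beta> (\<phi> h) (v i)) (\<beta> (\<phi> k) (v j))\<bar> < \<epsilon>'"
      by linarith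
  qed
qed

text \<open>An extension problem for \<beta> is translated by \<open>\<Phi>\<close> and
  \<open>\<psi>\<close> into one for \<alpha>, whose old subgroup is the image of \<open>F\<close>,
  and the solution is translated back by their inverses. Distances are preserved, so the constant
  stays the same.\<close>

lemma extensive_weakly_equivalent:
  assumes \<alpha>: "isometric_action G \<alpha>" "extensive G c \<alpha>" and \<beta>: "isometric_action G \<beta>"
    and "weakly_equivalent G \<beta> \<alpha>"
  shows "extensive G c \<beta>"
  unfolding extensive_def extension_instance_def
proof (intro allI impI)
  interpret \<alpha>: isometric_action G \<alpha> by (rule \<alpha>)
  interpret \<beta>: isometric_action G \<beta> by (rule \<beta>)
  obtain \<Phi> \<psi> where \<Phi>: "\<Phi> \<in> isometries" and \<psi>: "\<psi> \<in> iso G G"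
    and conj: "\<And>g x. g \<in> carrier G \<Longrightarrow> \<beta> g x = inv_into UNIV \<Phi> (\<alpha> (\<psi> g) (\<Phi> x))"
    using assms(4) unfolding weakly_equivalent_def by blast
  have \<Phi>\<beta>: "\<Phi> (\<beta> g x) = \<alpha> (\<psi> g) (\<Phi> x)" if "g \<in> carrier G" for g x
    using conj[OF that] isometries_inv(3)[OF \<Phi>] by simp
  have \<Phi>_dist: "dist (\<Phi> x) (\<Phi> y) = dist x y" for x y
    using isometriesD(1)[OF \<Phi>] .
  fix F H \<theta> n m d N u and \<epsilon> \<epsilon>' :: real
  assume data: "extension_data G F H \<theta> n m d N" and pos: "0 < \<epsilon>" "0 < \<epsilon>'"
    and close: "\<forall>f\<in>F. \<forall>k\<in>F. \<forall>i<n. \<forall>j<n.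
      \<bar>d (\<theta> f, i) (\<theta> k, j) / real N - dist (\<beta> f (u i)) (\<beta> k (u j))\<bar> \<le> \<epsilon>"
  have F: "subgroup F G" "finite F" and \<theta>: "\<theta> \<in> mon (G\<lparr>carrier := F\<rparr>) (G\<lparr>carrier := H\<rparr>)"
    and H: "subgroup H G"
    using data by (simp_all add: extension_data_def)
  have F_carrier: "f \<in> carrier G" if "f \<in> F" for f
    using subgroup.mem_carrier[OF F(1) that] .
  have \<psi>_mon: "\<psi> \<in> mon G G" and \<psi>_surj: "\<psi> ` carrier G = carrier G"
    using \<psi> by (auto simp: iso_def mon_def bij_betw_def)
  have \<psi>F: "\<psi> \<in> mon (G\<lparr>carrier := F\<rparr>) G"
  proof (rule monI)
    show "inj_on \<psi> (carrier (G\<lparr>carrier := F\<rparr>))"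
      using monD(3)[OF \<psi>_mon] by (rule inj_on_subset) (use F_carrier in auto)
  qed (use monD(1,2)[OF \<psi>_mon] F_carrier in simp_all)
  define \<kappa> where "\<kappa> = inv_into (carrier G) \<psi>"
  have \<kappa>: "\<kappa> \<in> mon G G"
    using mon_inv_into[OF \<psi>_mon \<alpha>.is_group] by (simp add: \<kappa>_def \<psi>_surj)
  have \<kappa>\<psi>: "\<kappa> (\<psi> g) = g" if "g \<in> carrier G" for g
    using monD(3)[OF \<psi>_mon] that by (simp add: \<kappa>_def)
  have \<psi>\<kappa>: "\<psi> (\<kappa> g) = g" if "g \<in> carrier G" for g
    unfolding \<kappa>_def by (rule f_inv_into_f) (simp add: \<psi>_surj that)
  define \<tau> where "\<tau> = inv_into F \<psi>"
  have \<tau>: "\<tau> \<in> mon (G\<lparr>carrier := \<psi> ` F\<rparr>) (G\<lparr>carrier := F\<rparr>)"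
    using mon_inv_into[OF \<psi>F \<alpha>.subgroup_imp_group[OF F(1)]] by (simp add: \<tau>_def)
  have \<tau>\<psi>: "\<tau> (\<psi> f) = f" if "f \<in> F" for f
    using monD(3)[OF \<psi>F] that by (simp add: \<tau>_def)
  have data': "extension_data G (\<psi> ` F) H (\<theta> \<circ> \<tau>) n m d N"
    using data mon_compose[OF \<tau> \<theta>] mon_image_subgroup[OF \<psi>F \<alpha>.is_group \<alpha>.is_group F(1)]
    by (simp add: extension_data_def)
  have close': "\<bar>d ((\<theta> \<circ> \<tau>) f, i) ((\<theta> \<circ> \<tau>) k, j) / real N - dist (\<alpha> f (\<Phi> (u i))) (\<alpha> k (\<Phi> (u j)))\<bar> \<le> \<epsilon>"
    if fk: "f \<in> \<psi> ` F" "k \<in> \<psi> ` F" "i < n" "j < n" for f k i j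
  proof -
    obtain f' k' where f': "f' \<in> F" "f = \<psi> f'" and k': "k' \<in> F" "k = \<psi> k'"
      using fk by blast
    have "dist (\<alpha> f (\<Phi> (u i))) (\<alpha> k (\<Phi> (u j))) = dist (\<beta> f' (u i)) (\<beta> k' (u j))"
      unfolding f'(2) k'(2) \<Phi>\<beta>[OF F_carrier[OF f'(1)], symmetric] \<Phi>\<beta>[OF F_carrier[OF k'(1)], symmetric]
      by (rule \<Phi>_dist)
    then show ?thesis
      using close fk f' k' \<tau>\<psi> by simp
  qed
  obtain \<phi> v where \<phi>: "\<phi> \<in> mon (G\<lparr>carrier := H\<rparr>) G" "\<And>f. f \<in> \<psi> ` F \<Longrightarrow> \<phi> ((\<theta> \<circ> \<tau>) f) = f"
    and v: "\<And>i. i < n \<Longrightarrow> dist (\<Phi> (u i)) (v i) \<le> c * \<epsilon>"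
    and fine: "\<And>h k i j. \<lbrakk>h \<in> H; k \<in> H; i < m; j < m\<rbrakk>
      \<Longrightarrow> \<bar>d (h, i) (k, j) / real N - dist (\<alpha> (\<phi> h) (v i)) (\<alpha> (\<phi> k) (v j))\<bar> < \<epsilon>'"
    by (rule extensiveD[OF \<alpha>(2) data' pos close']) (assumption | rule that)+
  have \<phi>_in: "\<phi> h \<in> carrier G" if "h \<in> H" for h
    using monD(1)[OF \<phi>(1)] that by simp
  show "\<exists>\<phi> v. \<phi> \<in> mon (G\<lparr>carrier := H\<rparr>) G \<and> (\<forall>f\<in>F. \<phi> (\<theta> f) = f) \<and> (\<forall>i<n. dist (u i) (v i) \<le> c * \<epsilon>)
      \<and> (\<forall>h\<in>H. \<forall>k\<in>H. \<forall>i<m. \<forall>j<m.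
            \<bar>d (h, i) (k, j) / real N - dist (\<beta> (\<phi> h) (v i)) (\<beta> (\<phi> k) (v j))\<bar> < \<epsilon>')"
  proof (intro exI[of _ "\<kappa> \<circ> \<phi>"] exI[of _ "inv_into UNIV \<Phi> \<circ> v"] conjI allI ballI impI)
    show "\<kappa> \<circ> \<phi> \<in> mon (G\<lparr>carrier := H\<rparr>) G"
      using \<phi>(1) \<kappa> by (rule mon_compose)
    show "(\<kappa> \<circ> \<phi>) (\<theta> f) = f" if "f \<in> F" for f
      using \<phi>(2)[of "\<psi> f"] that \<tau>\<psi> \<kappa>\<psi> F_carrier by simp
    show "dist (u i) ((inv_into UNIV \<Phi> \<circ> v) i) \<le> c * \<epsilon>" if "i < n" for i
      using v[OF that] \<Phi>_dist[of "u i" "inv_into UNIV \<Phi> (v i)"] isometries_inv(3)[OF \<Phi>] by simp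
    show "\<bar>d (h, i) (k, j) / real N - dist (\<beta> ((\<kappa> \<circ> \<phi>) h) ((inv_into UNIV \<Phi> \<circ> v) i))
        (\<beta> ((\<kappa> \<circ> \<phi>) k) ((inv_into UNIV \<Phi> \<circ> v) j))\<bar> < \<epsilon>'"
      if hk: "h \<in> H" "k \<in> H" "i < m" "j < m" for h k i j
    proof -
      have "\<Phi> (\<beta> (\<kappa> (\<phi> h)) (inv_into UNIV \<Phi> x)) = \<alpha> (\<phi> h) x" if "h \<in> H" for h x
        using \<Phi>\<beta>[OF monD(1)[OF \<kappa> \<phi>_in[OF that]]] \<psi>\<kappa>[OF \<phi>_in[OF that]] isometries_inv(3)[OF \<Phi>] by simp
      then have "dist (\<alpha> (\<phi> h) (v i)) (\<alpha> (\<phi> k) (v j))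
          = dist (\<beta> (\<kappa> (\<phi> h)) (inv_into UNIV \<Phi> (v i))) (\<beta> (\<kappa> (\<phi> k)) (inv_into UNIV \<Phi> (v j)))"
        using hk \<Phi>_dist by metis
      then show ?thesis
        using fine[OF hk] by simp
    qed
  qed
qed

lemma (in isometric_action) conjugate_Hom_Iso:
  assumes \<Phi>: "\<Phi> \<in> isometries" and \<Psi>: "\<Psi> \<in> iso G G"
  shows "(\<lambda>g\<in>carrier G. inv_into UNIV \<Phi> \<circ> \<beta> (\<Psi> g) \<circ> \<Phi>) \<in> Hom_Iso G"
proof -
  have \<Psi>_closed: "\<Psi> g \<in> carrier G" if "g \<in> carrier G" for g
    using \<Psi> that by (auto simp: iso_def hom_def)
  have \<Psi>_mult: "\<Psi> (g \<otimes> h) = \<Psi> g \<otimes> \<Psi> h" if "g \<in> carrier G" "h \<in> carrier G" for g h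
    using \<Psi> that by (auto simp: iso_def hom_def)
  have "inv_into UNIV \<Phi> \<circ> \<beta> (\<Psi> g) \<circ> \<Phi> \<in> isometries" if "g \<in> carrier G" for g
    using isometries_comp[OF isometries_comp[OF isometries_inv(1)[OF \<Phi>] isometry[OF \<Psi>_closed[OF that]]] \<Phi>] .
  moreover have "inv_into UNIV \<Phi> \<circ> \<beta> (\<Psi> (g \<otimes> h)) \<circ> \<Phi>
      = (inv_into UNIV \<Phi> \<circ> \<beta> (\<Psi> g) \<circ> \<Phi>) \<circ> (inv_into UNIV \<Phi> \<circ> \<beta> (\<Psi> h) \<circ> \<Phi>)"
    if "g \<in> carrier G" "h \<in> carrier G" for g h
    using that \<Psi>_closed isometries_inv(3)[OF \<Phi>] by (simp add: fun_eq_iff \<Psi>_mult act_mult)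
  ultimately show ?thesis
    by (simp add: Hom_Iso_def hom_def Iso_group_def)
qed

section \<open>The weak equivalence class\<close>

context completed_fraisse_limit
begin

sublocale G: countable_locally_finite_group G
proof
  show "countable (carrier G)"
    using countable_grp h_bij by (metis bij_betw_imp_surj_on countable_image)
  fix S assume S: "finite S" "S \<subseteq> carrier G"
  have "\<eta> ` S \<subseteq> carrier (grp L)"
    using monD(1)[OF \<eta>_mon] S by blast
  then obtain F where F: "subgroup F (grp L)" "finite F" "\<eta> ` S \<subseteq> F"
    by (rule locally_finite[OF finite_imageI[OF S(1)]]) (rule that)
  have "h \<in> mon (grp L\<lparr>carrier := F\<rparr>) G"
  proof (rule monI)
    show "inj_on h (carrier (grp L\<lparr>carrier := F\<rparr>))"
      using monD(3)[OF h_mon] subgroup.subset[OF F(1)] by (auto intro: inj_on_subset)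
  qed (use monD(1,2)[OF h_mon] subgroup.mem_carrier[OF F(1)] in simp_all)
  then have "subgroup (h ` F) G"
    using mon_image_subgroup[OF _ is_group G.is_group F(1)] by blast
  moreover have "S \<subseteq> h ` F"
  proof
    fix s assume "s \<in> S"
    then have "s = h (\<eta> s)" "\<eta> s \<in> F"
      using S(2) F(3) by auto
    then show "s \<in> h ` F"
      by blast
  qed
  ultimately show "\<exists>F. subgroup F G \<and> finite F \<and> S \<subseteq> F"
    using F(2) by blast
qed

lemma countable_dense: "countable (j ` pts L)"
  using countable_pts by simp

lemma extensive5: "extensive G 5 \<alpha>"
  using extensive by (rule extensive_mono) simp

lemma trivial_subgroup: "subgroup {\<one>\<^bsub>G\<^esub>} G" "finite {\<one>\<^bsub>G\<^esub>}"
  using G.triv_subgroup by simp_all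

lemma trivial_mon: "(\<lambda>f. f) \<in> mon (G\<lparr>carrier := {\<one>\<^bsub>G\<^esub>}\<rparr>) G"
  by (rule monI) auto

text \<open>The inclusions close up: members of the class are extensive with constant 3 and so
  satisfy all the instances, the instances force extensiveness with constant 5, and
  \<open>back_and_forth\<close> leads from there back to the class. The loss from 3 to 5 therefore
  leaves no trace in the equality.\<close>

lemma weakly_equivalent_iff_instances:
  "{\<beta> \<in> Hom_Iso G. weakly_equivalent G \<beta> \<alpha>} = Hom_Iso G \<inter> \<Inter> (countable_instances G (j ` pts L))"
proof (intro equalityI subsetI)
  fix \<beta> assume "\<beta> \<in> {\<beta> \<in> Hom_Iso G. weakly_equivalent G \<beta> \<alpha>}"
  then have \<beta>: "\<beta> \<in> Hom_Iso G" "weakly_equivalent G \<beta> \<alpha>"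
    by simp_all
  then interpret \<beta>: isometric_action G \<beta>
    by unfold_locales
  have "extensive G 3 \<beta>"
    using extensive_weakly_equivalent[OF \<alpha>.isometric_action_axioms extensive \<beta>.isometric_action_axioms \<beta>(2)] .
  then have "X \<in> countable_instances G (j ` pts L) \<Longrightarrow> \<beta> \<in> X" for X
    unfolding countable_instances_def extensive_def using \<beta>(1) by blast
  with \<beta>(1) show "\<beta> \<in> Hom_Iso G \<inter> \<Inter> (countable_instances G (j ` pts L))"
    by blast
next
  fix \<beta> assume \<beta>: "\<beta> \<in> Hom_Iso G \<inter> \<Inter> (countable_instances G (j ` pts L))"
  then interpret \<beta>: isometric_action G \<beta>
    by unfold_locales simp
  have "extensive G 5 \<beta>"
    using extensive_of_countable_instances[OF \<beta>.isometric_action_axioms j(2)] \<beta> by blast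
  \<comment> \<open>The back-and-forth starts from the trivial subgroup and no points, where any
    error is allowed.\<close>
  moreover have "matched G \<beta> \<alpha> {\<one>\<^bsub>G\<^esub>} (\<lambda>f. f) 0 u u 1" for u
    using trivial_subgroup trivial_mon by (simp add: matched_def)
  ultimately obtain \<Psi> \<Phi> where \<Psi>: "\<Psi> \<in> iso G G" and \<Phi>: "\<Phi> \<in> isometries"
    and \<Phi>\<beta>: "\<And>g x. g \<in> carrier G \<Longrightarrow> \<Phi> (\<beta> g x) = \<alpha> (\<Psi> g) (\<Phi> x)"
    using G.back_and_forth[OF \<beta>.isometric_action_axioms _ \<alpha>.isometric_action_axioms extensive5 _ _ countable_dense j(2)]
    by (metis zero_less_one)
  have "\<beta> g x = inv_into UNIV \<Phi> (\<alpha> (\<Psi> g) (\<Phi> x))" if "g \<in> carrier G" for g x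
    using \<Phi>\<beta>[OF that, of x, symmetric] isometries_inv(2)[OF \<Phi>] by simp
  then have "weakly_equivalent G \<beta> \<alpha>"
    unfolding weakly_equivalent_def using \<Psi> \<Phi> by blast
  with \<beta> show "\<beta> \<in> {\<beta> \<in> Hom_Iso G. weakly_equivalent G \<beta> \<alpha>}"
    by blast
qed

text \<open>
  Self-matchings of \<open>\<alpha>\<close> provide both homogeneity properties needed here: that an embedding of a
  finite subgroup extends to an automorphism of \<open>G\<close>, and that an approximately isometric pair of finite
  tuples is nearly matched by an isometry of the space.
\<close>

lemma weakly_equivalent_approx:
  assumes \<beta>0: "\<beta>0 \<in> Hom_Iso G" and K: "finite K" "K \<subseteq> carrier G" and A: "finite A" and \<epsilon>: "0 < \<epsilon>"
  obtains \<gamma> where "\<gamma> \<in> Hom_Iso G" "weakly_equivalent G \<gamma> \<alpha>"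
    and "\<And>g x. \<lbrakk>g \<in> K; x \<in> A\<rbrakk> \<Longrightarrow> dist (\<gamma> g x) (\<beta>0 g x) < \<epsilon>"
proof -
  interpret \<beta>0: isometric_action G \<beta>0
    using \<beta>0 by unfold_locales
  obtain F where F: "subgroup F G" "finite F" "K \<subseteq> F"
    using G.locally_finite[OF K] by blast
  have F_carrier: "f \<in> carrier G" if "f \<in> F" for f
    using subgroup.mem_carrier[OF F(1) that] .
  have one_F: "\<one>\<^bsub>G\<^esub> \<in> F"
    using F(1) by (rule subgroup.one_closed)
  \<comment> \<open>The extra element keeps the tuple nonempty, since \<open>extension_data\<close>
    asks for \<open>0 < m\<close>.\<close>
  define m where "m = card (insert undefined A)"
  obtain a where a: "bij_betw a {..<m} (insert undefined A)"
    using ex_bij_betw_nat_finite[of "insert undefined A"] A by (auto simp: m_def atLeast0LessThan)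
  have "0 < m"
    using A by (simp add: m_def card_gt_0_iff)
  \<comment> \<open>The final estimate is \<open>160 * \<eta>'\<close>: rounding and realization
    match two tuples up to \<open>2 * \<eta>'\<close>, the back-and-forth multiplies this by 40, and
    two such distances are added.\<close>
  define \<eta>' where "\<eta>' = \<epsilon> / 200"
  have \<eta>': "0 < \<eta>'"
    using \<epsilon> by (simp add: \<eta>'_def)
  obtain N d where N: "0 < N" and d: "invariant_metric G F m d"
    and d_close: "\<And>f k i l. \<lbrakk>f \<in> F; k \<in> F; i < m; l < m\<rbrakk>
      \<Longrightarrow> \<bar>d (f, i) (k, l) / real N - dist (\<beta>0 f (a i)) (\<beta>0 k (a l))\<bar> \<le> \<eta>'"
    by (rule \<beta>0.dist_approx_metric[OF F(1) \<eta>', of m a]) (assumption | rule that)+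
  have "(\<lambda>f. f) \<in> mon (G\<lparr>carrier := {\<one>\<^bsub>G\<^esub>}\<rparr>) (G\<lparr>carrier := F\<rparr>)"
    using one_F by (intro monI) auto
  \<comment> \<open>Over the trivial subgroup and with no prescribed points, \<alpha> is free to
    realize the rounded metric of \<beta>0 along some embedding \<open>\<phi>\<close> of
    \<open>F\<close>.\<close>
  then have data: "extension_data G {\<one>\<^bsub>G\<^esub>} F (\<lambda>f. f) 0 m d N"
    using trivial_subgroup F N d \<open>0 < m\<close> by (simp add: extension_data_def)
  obtain \<phi> v where \<phi>: "\<phi> \<in> mon (G\<lparr>carrier := F\<rparr>) G"
    and v: "\<And>f k i l. \<lbrakk>f \<in> F; k \<in> F; i < m; l < m\<rbrakk>
      \<Longrightarrow> \<bar>d (f, i) (k, l) / real N - dist (\<alpha> (\<phi> f) (v i)) (\<alpha> (\<phi> k) (v l))\<bar> < \<eta>'"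
    by (rule extensiveD[OF extensive data zero_less_one \<eta>']) (assumption | rule that | simp)+
  have \<phi>_in: "\<phi> f \<in> carrier G" if "f \<in> F" for f
    using monD(1)[OF \<phi>] that by simp
  have \<phi>_one: "\<phi> \<one>\<^bsub>G\<^esub> = \<one>\<^bsub>G\<^esub>"
    using mon_one[OF \<phi> G.subgroup_imp_group[OF F(1)] G.is_group] by simp
  note bf = G.back_and_forth[OF \<alpha>.isometric_action_axioms extensive5 \<alpha>.isometric_action_axioms extensive5
      _ _ countable_dense j(2)]
  \<comment> \<open>In this run only the group part is matched; it extends \<open>\<phi>\<close> to
    an automorphism.\<close>
  have matched_F: "matched G \<alpha> \<alpha> F \<phi> 0 v v 1"
    using F \<phi> by (simp add: matched_def)
  obtain \<Psi> where \<Psi>: "\<Psi> \<in> iso G G" and \<Psi>\<phi>: "\<And>f. f \<in> F \<Longrightarrow> \<Psi> f = \<phi> f"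
    by (rule bf[OF matched_F zero_less_one]) (rule that)
  \<comment> \<open>In the second run only the metric part is matched. The \<open>F\<close>-orbits
    are listed as one tuple over the trivial subgroup because \<open>\<Phi>\<close> has to carry
    orbits of \<beta>0, and not of \<alpha>, to orbits of \<alpha>.\<close>
  define M where "M = card (F \<times> {..<m})"
  obtain t where t: "bij_betw t {..<M} (F \<times> {..<m})"
    using ex_bij_betw_nat_finite[of "F \<times> {..<m}"] F(2) by (auto simp: M_def atLeast0LessThan)
  define z where "z = (\<lambda>s. \<beta>0 (fst (t s)) (a (snd (t s))))"
  define w where "w = (\<lambda>s. \<alpha> (\<phi> (fst (t s))) (v (snd (t s))))"
  have t_in: "fst (t s) \<in> F" "snd (t s) < m" if "s < M" for s
    using bij_betwE[OF t] that by (auto simp: mem_Times_iff)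
  have "\<bar>dist (z s) (z s') - dist (w s) (w s')\<bar> \<le> 2 * \<eta>'" if "s < M" "s' < M" for s s'
    using d_close[OF t_in(1)[OF that(1)] t_in(1)[OF that(2)] t_in(2)[OF that(1)] t_in(2)[OF that(2)]]
      v[OF t_in(1)[OF that(1)] t_in(1)[OF that(2)] t_in(2)[OF that(1)] t_in(2)[OF that(2)]]
    unfolding z_def w_def by linarith
  then have matched: "matched G \<alpha> \<alpha> {\<one>\<^bsub>G\<^esub>} (\<lambda>f. f) M z w (2 * \<eta>')"
    using trivial_subgroup trivial_mon by (simp add: matched_def)
  have pos: "0 < 2 * \<eta>'"
    using \<eta>' by simp
  obtain \<Phi> where \<Phi>: "\<Phi> \<in> isometries"
    and \<Phi>_close: "\<And>s. s < M \<Longrightarrow> dist (\<Phi> (z s)) (w s) \<le> 40 * (2 * \<eta>')"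
    by (rule bf[OF matched pos]) (rule that)
  have near: "dist (\<Phi> (\<beta>0 f (a i))) (\<alpha> (\<phi> f) (v i)) \<le> 80 * \<eta>'" if fi: "f \<in> F" "i < m" for f i
  proof -
    have "(f, i) \<in> t ` {..<M}"
      using t fi by (simp add: bij_betw_def)
    then obtain s where "s < M" "t s = (f, i)"
      by (metis imageE lessThan_iff)
    then show ?thesis
      using \<Phi>_close[of s] by (simp add: z_def w_def)
  qed
  define \<gamma> where "\<gamma> = (\<lambda>g\<in>carrier G. inv_into UNIV \<Phi> \<circ> \<alpha> (\<Psi> g) \<circ> \<Phi>)"
  show thesis
  proof (rule that)
    show "\<gamma> \<in> Hom_Iso G"
      unfolding \<gamma>_def using \<Phi> \<Psi> by (rule \<alpha>.conjugate_Hom_Iso)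
    show "weakly_equivalent G \<gamma> \<alpha>"
      unfolding weakly_equivalent_def using \<Phi> \<Psi> by (intro bexI[of _ \<Phi>] bexI[of _ \<Psi>]) (simp_all add: \<gamma>_def)
    fix g x assume "g \<in> K" "x \<in> A"
    then have g: "g \<in> F" "g \<in> carrier G"
      using F(3) F_carrier by auto
    have "x \<in> a ` {..<m}"
      using a \<open>x \<in> A\<close> by (simp add: bij_betw_def)
    then obtain i where i: "i < m" "x = a i"
      by blast
    \<comment> \<open>\<open>\<Phi> (a i)\<close> is near \<open>v i\<close>, so its image under
      \<open>\<alpha> (\<phi> g)\<close> is near that of \<open>v i\<close>, which in turn is near
      \<open>\<Phi> (\<beta>0 g (a i))\<close>.\<close>
    have "dist (\<gamma> g x) (\<beta>0 g x) = dist (\<Phi> (\<gamma> g x)) (\<Phi> (\<beta>0 g x))"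
      using isometriesD(1)[OF \<Phi>] by simp
    also have "\<dots> = dist (\<alpha> (\<phi> g) (\<Phi> (a i))) (\<Phi> (\<beta>0 g (a i)))"
      using g \<Psi>\<phi> i isometries_inv(3)[OF \<Phi>] by (simp add: \<gamma>_def)
    also have "\<dots> \<le> dist (\<alpha> (\<phi> g) (\<Phi> (a i))) (\<alpha> (\<phi> g) (v i)) + dist (\<Phi> (\<beta>0 g (a i))) (\<alpha> (\<phi> g) (v i))"
      by (rule dist_triangle2)
    also have "\<dots> \<le> 80 * \<eta>' + 80 * \<eta>'"
      using near[OF one_F i(1)] near[OF g(1) i(1)] \<phi>_in[OF g(1)] \<phi>_one by (intro add_mono) simp_all
    also have "\<dots> < \<epsilon>"
      using \<epsilon> by (simp add: \<eta>'_def)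
    finally show "dist (\<gamma> g x) (\<beta>0 g x) < \<epsilon>" .
  qed
qed

lemma weak_class_dense:
  "Hom_topology G closure_of {\<beta> \<in> Hom_Iso G. weakly_equivalent G \<beta> \<alpha>} = topspace (Hom_topology G)"
proof (intro equalityI subsetI)
  fix \<beta>0 assume "\<beta>0 \<in> topspace (Hom_topology G :: ('g \<Rightarrow> 'u \<Rightarrow> 'u) topology)"
  then have \<beta>0: "\<beta>0 \<in> Hom_Iso G"
    by simp
  have "\<exists>\<gamma>\<in>{\<beta> \<in> Hom_Iso G. weakly_equivalent G \<beta> \<alpha>}. \<gamma> \<in> T"
    if T: "openin (Hom_topology G) T" "\<beta>0 \<in> T" for T
  proof (rule openin_Hom_topologyD[OF T])
    fix K A and \<epsilon> :: real
    assume KA: "finite K" "K \<subseteq> carrier G" "finite A" "0 < \<epsilon>"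
      and T_nbhd: "\<And>\<gamma>. \<lbrakk>\<gamma> \<in> Hom_Iso G; \<And>g x. \<lbrakk>g \<in> K; x \<in> A\<rbrakk> \<Longrightarrow> dist (\<gamma> g x) (\<beta>0 g x) < \<epsilon>\<rbrakk> \<Longrightarrow> \<gamma> \<in> T"
    obtain \<gamma> where "\<gamma> \<in> Hom_Iso G" "weakly_equivalent G \<gamma> \<alpha>"
      "\<And>g x. \<lbrakk>g \<in> K; x \<in> A\<rbrakk> \<Longrightarrow> dist (\<gamma> g x) (\<beta>0 g x) < \<epsilon>"
      by (rule weakly_equivalent_approx[OF \<beta>0 KA]) (assumption | rule that)+
    then show ?thesis
      using T_nbhd by blast
  qed
  with \<beta>0 show "\<beta>0 \<in> Hom_topology G closure_of {\<beta> \<in> Hom_Iso G. weakly_equivalent G \<beta> \<alpha>}"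
    unfolding in_closure_of by simp
qed (rule subsetD[OF closure_of_subset_topspace])

lemma weak_class_generic:
  "weakly_generic G \<alpha> \<and> gdelta_in (Hom_topology G) {\<beta> \<in> Hom_Iso G. weakly_equivalent G \<beta> \<alpha>}"
proof -
  let ?X = "Hom_topology G :: ('g \<Rightarrow> 'u \<Rightarrow> 'u) topology"
  let ?W = "{\<beta> \<in> Hom_Iso G. weakly_equivalent G \<beta> \<alpha>}"
  let ?\<D> = "countable_instances G (j ` pts L)"
  have cnt: "countable ?\<D>"
    by (rule countable_countable_instances[OF G.countable_carrier countable_dense])
  have W: "?W = topspace ?X \<inter> \<Inter> ?\<D>"
    using weakly_equivalent_iff_instances by simp
  have open_D: "openin ?X D" if "D \<in> ?\<D>" for D
    using that unfolding countable_instances_def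
    by (elim CollectE exE conjE) (simp only: openin_extension_instance)
  \<comment> \<open>Each of the open sets contains the class, which is already known to be
    dense.\<close>
  have dense_D: "?X closure_of D = topspace ?X" if "D \<in> ?\<D>" for D
  proof (rule antisym[OF closure_of_subset_topspace])
    have "?W \<subseteq> D"
      using W that by blast
    from closure_of_mono[OF this, of ?X] show "topspace ?X \<subseteq> ?X closure_of D"
      unfolding weak_class_dense .
  qed
  \<comment> \<open>Inserting the whole space gives the intersection the form of \<open>W\<close>
    and keeps the family nonempty.\<close>
  have "gdelta_in ?X (\<Inter> (insert (topspace ?X) ?\<D>))"
  proof (rule gdelta_in_Inter)
    show "gdelta_in ?X D" if "D \<in> insert (topspace ?X) ?\<D>" for D
      using that by (elim insertE) (simp_all only: gdelta_in_topspace open_imp_gdelta_in[OF open_D])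
  qed (use cnt in simp_all)
  then have "gdelta_in ?X ?W"
    unfolding W Inter_insert .
  moreover have "comeager_in ?X ?W"
    unfolding comeager_in_def
  proof (intro conjI exI[of _ ?\<D>] ballI)
    show "?W \<subseteq> topspace ?X" "topspace ?X \<inter> \<Inter> ?\<D> \<subseteq> ?W"
      using W by blast+
  qed (use cnt open_D dense_D in simp_all)
  ultimately show ?thesis
    using Hom by (simp add: weakly_generic_def weak_class_def)
qed

end

theorem theorem0p3:
  fixes G :: "'g monoid"
    and L :: "('h, 'x) pointed_action"
    and \<alpha> :: "'g \<Rightarrow> 'u::complete_space \<Rightarrow> 'u"
  assumes "hall_group G"
    and "urysohn_space TYPE('u)"
    and "universal_action L G \<alpha>"
  shows "weakly_generic G \<alpha>
    \<and> gdelta_in (Hom_topology G) {\<beta> \<in> Hom_Iso G. weakly_equivalent G \<beta> \<alpha>}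
    \<and> Hom_topology G closure_of {\<beta> \<in> Hom_Iso G. weakly_equivalent G \<beta> \<alpha>}
        = topspace (Hom_topology G)"
proof -
  have G: "group G"
    using assms(1) by (simp add: hall_group_def)
  obtain h j where L: "action_fraisse_limit L" "\<alpha> \<in> Hom_Iso G" "h \<in> iso (grp L) G"
    "isometric_embedding (pts L) (met L) UNIV dist j" "closure (j ` pts L) = UNIV"
    and ext: "\<forall>g\<in>carrier (grp L). \<forall>x\<in>pts L. \<alpha> (h g) (j x) = j (act L g x)"
    using assms(3) unfolding universal_action_def by blast
  interpret fraisse_limit L
    using L(1) by unfold_locales
  interpret G: group G
    by (rule G)
  interpret completed_fraisse_limit L G \<alpha> h j
    by unfold_locales (use L ext in auto)
  show ?thesis
    using weak_class_generic weak_class_dense by blast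
qed

end
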